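(* Let $\mathbb{K}$ be an algebraically closed field of characteristic zero and $\mathbbm{i}\in\mathbb{K}$ a primitive fourth root of unity. Let $S$ (respectively $T$) be the $\mathbb{K}$-algebra with generators $x_1,x_2,x_3,x_4$ and relations $x_1x_2-x_3^2$, $x_4^2-x_2x_1$ (respectively $x_4^2+x_2x_1$), $x_1x_3-x_2x_4$, $x_4x_1-x_3x_2$, $x_2x_3-x_3x_1$, $x_4x_2-x_1x_4$ (respectively $x_4x_2+x_1x_4$). Let $P=M_{12}M_{34}-M_{13}M_{24}+M_{14}M_{23}$ and put $\alpha=1$ for $S$ and $\alpha=\mathbbm{i}$ for $T$. The irreducible components of the line scheme $\mathcal{L}(S)$ (respectively $\mathcal{L}(T)$) in $\mathbb{P}^5$ are: $$\begin{aligned} C_1&=\mathcal{V}(M_{12},M_{34},M_{13}-\alpha M_{24},P), & C_2&=\mathcal{V}(M_{12},M_{34},M_{13}+\alpha M_{24},P),\\ C_3&=\mathcal{V}(M_{13},M_{24},M_{14}-\alpha M_{23},P), & C_4&=\mathcal{V}(M_{13},M_{24},M_{14}+\alpha M_{23},P),\\ C_5&=\mathcal{V}(M_{14},M_{23},M_{12}-M_{34},P), & C_6&=\mathcal{V}(M_{14},M_{23},M_{12}+M_{34},P), \end{aligned}$$ $$\begin{aligned} C_7&=\mathcal{V}(M_{12}-M_{34},M_{13}-\alpha M_{24},M_{14}-\alpha M_{23},P),\\ C_8&=\mathcal{V}(M_{12}-M_{34},M_{13}+\alpha M_{24},M_{14}+\alpha M_{23},P),\\ C_9&=\mathcal{V}(M_{12}+M_{34},M_{13}-\alpha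 M_{24},M_{14}+\alpha M_{23},P),\\ C_{10}&=\mathcal{V}(M_{12}+M_{34},M_{13}+\alpha M_{24},M_{14}-\alpha M_{23},P). \end{aligned}$$ For $1\le i\le10$ the component $C_i$ is isomorphic to $\mathbb{P}^1$. The schemes $\mathcal{L}(S)$ and $\mathcal{L}(T)$ are equidimensional of dimension one and are reduced schemes.
   Context: Line scheme: let $A$ be a quadratic algebra with degree-one generators $x_1,\dots,x_4$ and six quadratic relations $r_1,\dots,r_6$. Let $z_1,\dots,z_4$ be the dual basis of $A_1^*$ and $f_1,\dots,f_{10}$ a basis of the relations of the quadratic dual $A^!$ (so $f_i(r_j)=0$). Write these relations as $\hat M\mathbf{z}=\mathbf{0}$, with $\hat M$ a $10\times4$ matrix of linear forms in the $z_i$ and $\mathbf{z}=(z_1,\dots,z_4)^T$. In $\mathbb{K}[u_1,\dots,u_4,v_1,\dots,v_4]$ let $\mathcal{M}=[\hat M_u\ \hat M_v]$ be the $10\times8$ matrix obtained by concatenating $\hat M$ with $z_i$ replaced by $u_i$ and $\hat M$ with $z_i$ replaced by $v_i$. Its forty-five $8\times8$ minors are expressible as quartic polynomials in $N_{ij}=u_iv_j-u_jv_i$, $1\le i<j\le4$. Substitute $N_{12}\mapsto M_{34}$, $N_{13}\mapsto -M_{24}$, $N_{14}\mapsto M_{23}$, $N_{23}\mapsto M_{14}$, $N_{24}\mapsto -M_{13}$, $N_{34}\mapsto M_{12}$. The line scheme $\mathcal{L}(A)$ is the closed subscheme of $\mathbb{P}^5$, with homogeneous coordinates $M_{12},M_{13},M_{14},M_{23},M_{24},M_{34}$,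 defined by the resulting forty-five quartics together with the Plücker polynomial $P$. $\mathcal{V}(\cdot)$ denotes the zero locus. *)

theory Defs
  imports
    "HOL-Analysis.Analysis"
    "HOL-Algebra.QuotRing"
    "HOL-Library.Poly_Mapping"
    "HOL-Library.Extended_Nat"
    "HOL-Computational_Algebra.Polynomial"
begin

section \<open>Polynomial rings and ideals\<close>

text \<open>Polynomials over \<open>'k\<close> in the variables \<open>'v\<close>, as finitely supported functions on exponent
  vectors; ring multiplication is the convolution product of \<^theory>\<open>HOL-Library.Poly_Mapping\<close>.\<close>

type_synonym ('v, 'k) mpoly = "('v \<Rightarrow>\<^sub>0 nat) \<Rightarrow>\<^sub>0 'k"

definition Const :: "'k::comm_ring_1 \<Rightarrow> ('v, 'k) mpoly" where
  "Const c = Poly_Mapping.single 0 c"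

definition Var :: "'v \<Rightarrow> ('v, 'k::comm_ring_1) mpoly" where
  "Var v = Poly_Mapping.single (Poly_Mapping.single v 1) 1"

definition mdeg :: "('v \<Rightarrow>\<^sub>0 nat) \<Rightarrow> nat" where
  "mdeg m = (\<Sum>v\<in>Poly_Mapping.keys m. Poly_Mapping.lookup m v)"

definition homogeneous :: "nat \<Rightarrow> ('v, 'k::comm_ring_1) mpoly \<Rightarrow> bool" where
  "homogeneous d p \<longleftrightarrow> (\<forall>m\<in>Poly_Mapping.keys p. mdeg m = d)"

definition hcomponent :: "nat \<Rightarrow> ('v, 'k::comm_ring_1) mpoly \<Rightarrow> ('v, 'k) mpoly" where
  "hcomponent d p = (\<Sum>m | m \<in> Poly_Mapping.keys p \<and> mdeg m = d. Poly_Mapping.single m (Poly_Mapping.lookup p m))"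

definition subst :: "('v \<Rightarrow> ('w, 'k) mpoly) \<Rightarrow> ('v, 'k::comm_ring_1) mpoly \<Rightarrow> ('w, 'k) mpoly" where
  "subst \<sigma> p = (\<Sum>m\<in>Poly_Mapping.keys p. Const (Poly_Mapping.lookup p m) * (\<Prod>v\<in>Poly_Mapping.keys m. \<sigma> v ^ Poly_Mapping.lookup m v))"

text \<open>Ideals are the submodules of a commutative ring over itself. The locale is not interpreted,
  since its simplification rules for scalar multiplication loop with associativity.\<close>

lemma module_self: "module ((*) :: 'a \<Rightarrow> 'a \<Rightarrow> 'a::comm_ring_1)"
  by standard (simp_all add: algebra_simps)

abbreviation is_ideal :: "'a::comm_ring_1 set \<Rightarrow> bool" where
  "is_ideal \<equiv> module.subspace (*)"

abbreviation ideal_generated :: "'a::comm_ring_1 set \<Rightarrow> 'a set" where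
  "ideal_generated \<equiv> module.span (*)"


section \<open>Projective space and its closed subschemes\<close>

definition homogeneous_prime :: "('v, 'k::comm_ring_1) mpoly set \<Rightarrow> bool" where
  "homogeneous_prime p \<longleftrightarrow>
     is_ideal p \<and> 1 \<notin> p \<and> (\<forall>a b. a * b \<in> p \<longrightarrow> a \<in> p \<or> b \<in> p) \<and>
     (\<forall>a\<in>p. \<forall>d. hcomponent d a \<in> p)"

text \<open>\<open>Proj k[x\<^sub>v : v \<in> 'v]\<close>, which is projective space of dimension \<open>CARD('v) - 1\<close>.\<close>

definition proj_space :: "('v::finite, 'k::comm_ring_1) mpoly set set" where
  "proj_space = {p. homogeneous_prime p \<and> (\<exists>v. Var v \<notin> p)}"

definition zero_locus :: "('v::finite, 'k::comm_ring_1) mpoly set \<Rightarrow> ('v, 'k) mpoly set set" where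
  "zero_locus G = {p \<in> proj_space. G \<subseteq> p}"

definition zariski :: "('v::finite, 'k::comm_ring_1) mpoly set topology" where
  "zariski = topology (\<lambda>U. \<exists>G. U = proj_space - zero_locus G)"

lemma istopology_zariski:
  "istopology (\<lambda>U. \<exists>G. U = proj_space - zero_locus (G :: ('v::finite, 'k::comm_ring_1) mpoly set))"
  unfolding istopology_def
proof (intro conjI allI impI)
  fix S T :: "('v, 'k) mpoly set set"
  assume "\<exists>G. S = proj_space - zero_locus G" and "\<exists>G. T = proj_space - zero_locus G"
  then obtain G H where GH: "S = proj_space - zero_locus G" "T = proj_space - zero_locus H"
    by blast
  have "G \<subseteq> p \<or> H \<subseteq> p \<longleftrightarrow> {g * h | g h. g \<in> G \<and> h \<in> H} \<subseteq> p" if "p \<in> proj_space" for p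
  proof -
    have prime: "a \<in> p \<or> b \<in> p" if "a * b \<in> p" for a b
      using \<open>p \<in> proj_space\<close> that by (auto simp: proj_space_def homogeneous_prime_def)
    have mult: "a * b \<in> p" if "b \<in> p" for a b
      using \<open>p \<in> proj_space\<close> that
      by (auto simp: proj_space_def homogeneous_prime_def module.subspace_def[OF module_self])
    have "a * b \<in> p" if "a \<in> p" for a b
      using mult[OF that, of b] by (simp add: mult.commute)
    then show ?thesis
      using prime mult by blast
  qed
  then have "S \<inter> T = proj_space - zero_locus {g * h | g h. g \<in> G \<and> h \<in> H}"
    unfolding GH zero_locus_def by blast
  then show "\<exists>G. S \<inter> T = proj_space - zero_locus G" ..
next
  fix \<K> :: "('v, 'k) mpoly set set set"
  assume "\<forall>K\<in>\<K>. \<exists>G. K = proj_space - zero_locus G"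
  then obtain G where G: "\<And>K. K \<in> \<K> \<Longrightarrow> K = proj_space - zero_locus (G K)"
    by metis
  have "\<Union>\<K> = (\<Union>K\<in>\<K>. proj_space - zero_locus (G K))"
    using G by auto
  also have "\<dots> = proj_space - zero_locus (\<Union>K\<in>\<K>. G K)"
    by (auto simp: zero_locus_def)
  finally show "\<exists>H. \<Union>\<K> = proj_space - zero_locus H" ..
qed

lemma openin_zariski: "openin zariski U \<longleftrightarrow> (\<exists>G. U = proj_space - zero_locus G)"
  unfolding zariski_def by (subst topology_inverse'[OF istopology_zariski]) simp

text \<open>A closed subscheme of projective space is represented by an ideal \<open>I\<close> generated by homogeneous
  polynomials. It has the underlying space \<open>subscheme_space I\<close>, and its structure sheaf is the sheaf
  of functions that are locally fractions, with stalk at \<open>p\<close> the degree zero part of the homogeneous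
  localization of \<open>k[x]/I\<close> at \<open>p\<close>.\<close>

definition subscheme_space ::
  "('v::finite, 'k::comm_ring_1) mpoly set \<Rightarrow> ('v, 'k) mpoly set topology" where
  "subscheme_space I = subtopology zariski (zero_locus I)"

text \<open>The fraction \<open>a / b\<close> at \<open>p\<close>, as the class of all pairs (numerator, denominator) equal to it.\<close>

definition frac :: "('v, 'k::comm_ring_1) mpoly set \<Rightarrow> ('v, 'k) mpoly set \<Rightarrow>
    ('v, 'k) mpoly \<Rightarrow> ('v, 'k) mpoly \<Rightarrow> (('v, 'k) mpoly \<times> ('v, 'k) mpoly) set" where
  "frac I p a b = {(c, e). (\<exists>d. homogeneous d c \<and> homogeneous d e) \<and> e \<notin> p \<and>
     (\<exists>t d. homogeneous d t \<and> t \<notin> p \<and> t * (a * e - c * b) \<in> I)}"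

definition local_ring :: "('v, 'k::comm_ring_1) mpoly set \<Rightarrow> ('v, 'k) mpoly set \<Rightarrow>
    (('v, 'k) mpoly \<times> ('v, 'k) mpoly) set ring" where
  "local_ring I p =
    \<lparr> carrier = {frac I p a b | a b d. homogeneous d a \<and> homogeneous d b \<and> b \<notin> p},
      mult = (\<lambda>A B. \<Union>(a, b)\<in>A. \<Union>(c, e)\<in>B. frac I p (a * c) (b * e)),
      one = frac I p 1 1,
      zero = frac I p 0 1,
      add = (\<lambda>A B. \<Union>(a, b)\<in>A. \<Union>(c, e)\<in>B. frac I p (a * e + c * b) (b * e)) \<rparr>"

definition sections :: "('v::finite, 'k::comm_ring_1) mpoly set \<Rightarrow> ('v, 'k) mpoly set set \<Rightarrow>
    (('v, 'k) mpoly set \<Rightarrow> (('v, 'k) mpoly \<times> ('v, 'k) mpoly) set) ring" where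
  "sections I U =
    \<lparr> carrier = {s \<in> extensional U. \<forall>p\<in>U. \<exists>V a b d.
         openin (subscheme_space I) V \<and> p \<in> V \<and> V \<subseteq> U \<and> homogeneous d a \<and> homogeneous d b \<and>
         (\<forall>q\<in>V. b \<notin> q \<and> s q = frac I q a b)},
      mult = (\<lambda>s t. \<lambda>p\<in>U. s p \<otimes>\<^bsub>local_ring I p\<^esub> t p),
      one = (\<lambda>p\<in>U. \<one>\<^bsub>local_ring I p\<^esub>),
      zero = (\<lambda>p\<in>U. \<zero>\<^bsub>local_ring I p\<^esub>),
      add = (\<lambda>s t. \<lambda>p\<in>U. s p \<oplus>\<^bsub>local_ring I p\<^esub> t p) \<rparr>"

text \<open>Isomorphism of schemes over \<open>k\<close>: a homeomorphism \<open>\<phi>\<close> and ring isomorphisms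
  \<open>\<theta> V : \<O>(V) \<rightarrow> \<O>(\<phi>\<inverse> V)\<close> that commute with restriction and fix the constants. The condition on
  stalks (local homomorphisms) is automatic because the maps on stalks are isomorphisms.\<close>

definition isomorphic_schemes ::
  "('v::finite, 'k::comm_ring_1) mpoly set \<Rightarrow> ('w::finite, 'k) mpoly set \<Rightarrow> bool" where
  "isomorphic_schemes I J \<longleftrightarrow> (\<exists>\<phi> \<theta>.
     homeomorphic_map (subscheme_space I) (subscheme_space J) \<phi> \<and>
     (\<forall>V. openin (subscheme_space J) V \<longrightarrow>
        (let U = {p \<in> zero_locus I. \<phi> p \<in> V} in
          \<theta> V \<in> ring_iso (sections J V) (sections I U) \<and>
          (\<forall>c. \<theta> V (\<lambda>q\<in>V. frac J q (Const c) 1) = (\<lambda>p\<in>U. frac I p (Const c) 1)) \<and>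
          (\<forall>W s. openin (subscheme_space J) W \<and> W \<subseteq> V \<and> s \<in> carrier (sections J V) \<longrightarrow>
             \<theta> W (restrict s W) = restrict (\<theta> V s) {p \<in> zero_locus I. \<phi> p \<in> W}))))"

definition reduced_ring :: "('a, 'b) ring_scheme \<Rightarrow> bool" where
  "reduced_ring R \<longleftrightarrow> (\<forall>a\<in>carrier R. \<forall>n::nat. a [^]\<^bsub>R\<^esub> n = \<zero>\<^bsub>R\<^esub> \<longrightarrow> a = \<zero>\<^bsub>R\<^esub>)"

definition reduced_scheme :: "('v::finite, 'k::comm_ring_1) mpoly set \<Rightarrow> bool" where
  "reduced_scheme I \<longleftrightarrow> (\<forall>p\<in>zero_locus I. reduced_ring (local_ring I p))"

text \<open>The ideal of the reduced induced subscheme structure on a closed subset \<open>Z\<close> of projective space: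
  the elements lying in every prime of \<open>Z\<close>, that is, the polynomials vanishing on \<open>Z\<close>.\<close>

definition vanishing_ideal :: "('v, 'k::comm_ring_1) mpoly set set \<Rightarrow> ('v, 'k) mpoly set" where
  "vanishing_ideal Z = \<Inter>Z"


section \<open>Irreducible components and dimension\<close>

definition irreducible_in :: "'a topology \<Rightarrow> 'a set \<Rightarrow> bool" where
  "irreducible_in X S \<longleftrightarrow> S \<subseteq> topspace X \<and> S \<noteq> {} \<and>
     (\<forall>A B. closedin X A \<and> closedin X B \<and> S \<subseteq> A \<union> B \<longrightarrow> S \<subseteq> A \<or> S \<subseteq> B)"

definition irreducible_components :: "'a topology \<Rightarrow> 'a set set" where
  "irreducible_components X =
     {S. irreducible_in X S \<and> (\<forall>T. irreducible_in X T \<and> S \<subseteq> T \<longrightarrow> T = S)}"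

text \<open>For the empty space this gives \<open>0\<close>; it is only applied to nonempty spaces.\<close>

definition krull_dimension :: "'a topology \<Rightarrow> enat" where
  "krull_dimension X = Sup {enat n | n. \<exists>Z.
     (\<forall>i\<le>n. closedin X (Z i) \<and> irreducible_in X (Z i)) \<and> (\<forall>i<n. Z i \<subset> Z (Suc i))}"

definition equidimensional :: "'a topology \<Rightarrow> enat \<Rightarrow> bool" where
  "equidimensional X d \<longleftrightarrow>
     (\<forall>C\<in>irreducible_components X. krull_dimension (subtopology X C) = d)"


section \<open>The line scheme of a quadratic algebra on four generators\<close>

text \<open>The type \<open>4\<close> has the elements \<open>1, 2, 3, 4\<close> (with \<open>4 = 0\<close>). A quadratic form in the noncommuting
  generators, \<open>\<Sum> r\<^sub>a\<^sub>b x\<^sub>a x\<^sub>b\<close>, is its coefficient vector \<open>r\<close>, indexed by pairs; likewise for the forms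
  \<open>\<Sum> g\<^sub>a\<^sub>b z\<^sub>a z\<^sub>b\<close> in the dual generators. A quadratic algebra is given by its set of relations.\<close>

type_synonym 'k qform = "'k ^ (4 \<times> 4)"

definition qmonom :: "4 \<Rightarrow> 4 \<Rightarrow> 'k::field qform" where
  "qmonom a b = axis (a, b) 1"

definition pairing :: "'k::field qform \<Rightarrow> 'k qform \<Rightarrow> 'k" where
  "pairing g r = (\<Sum>ab\<in>UNIV. g $ ab * r $ ab)"

definition quadratic_dual_basis :: "'k::field qform set \<Rightarrow> (10 \<Rightarrow> 'k qform) \<Rightarrow> bool" where
  "quadratic_dual_basis R f \<longleftrightarrow> inj f \<and> vec.independent (range f) \<and>
     vec.span (range f) = {g. \<forall>r\<in>R. pairing g r = 0}"

text \<open>The matrix of linear forms with \<open>f\<^sub>i = \<Sum>\<^sub>b (hat_matrix)\<^sub>i\<^sub>b z\<^sub>b\<close>, with the variables \<open>w\<close> in place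
  of \<open>z\<close> in its entries.\<close>

definition hat_matrix :: "(10 \<Rightarrow> 'k::field qform) \<Rightarrow> (4 \<Rightarrow> ('v, 'k) mpoly) \<Rightarrow> ('v, 'k) mpoly ^ 4 ^ 10" where
  "hat_matrix f w = (\<chi> i b. \<Sum>a\<in>UNIV. Const (f i $ (a, b)) * w a)"

abbreviation u_var :: "4 \<Rightarrow> (4 + 4, 'k::field) mpoly" where "u_var a \<equiv> Var (Inl a)"
abbreviation v_var :: "4 \<Rightarrow> (4 + 4, 'k::field) mpoly" where "v_var a \<equiv> Var (Inr a)"

definition uv_matrix :: "(10 \<Rightarrow> 'k::field qform) \<Rightarrow> (4 + 4, 'k) mpoly ^ (4 + 4) ^ 10" where
  "uv_matrix f = (\<chi> i j. case j of Inl b \<Rightarrow> hat_matrix f u_var $ i $ b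
                                  | Inr b \<Rightarrow> hat_matrix f v_var $ i $ b)"

text \<open>The maximal minor on the rows \<open>range \<rho>\<close>, for an injection \<open>\<rho>\<close>. There are forty-five sets of
  rows; injections with the same range give the same minor up to sign.\<close>

definition uv_minor :: "(10 \<Rightarrow> 'k::field qform) \<Rightarrow> (4 + 4 \<Rightarrow> 10) \<Rightarrow> (4 + 4, 'k) mpoly" where
  "uv_minor f \<rho> = det (\<chi> i j. uv_matrix f $ \<rho> i $ j)"

text \<open>Both the coordinates \<open>N\<^sub>i\<^sub>j\<close> and the coordinates \<open>M\<^sub>i\<^sub>j\<close> are indexed by the type \<open>6\<close>, in the order
  12, 13, 14, 23, 24, 34.\<close>

abbreviation M12 :: "(6, 'k::field) mpoly" where "M12 \<equiv> Var 1"
abbreviation M13 :: "(6, 'k::field) mpoly" where "M13 \<equiv> Var 2"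
abbreviation M14 :: "(6, 'k::field) mpoly" where "M14 \<equiv> Var 3"
abbreviation M23 :: "(6, 'k::field) mpoly" where "M23 \<equiv> Var 4"
abbreviation M24 :: "(6, 'k::field) mpoly" where "M24 \<equiv> Var 5"
abbreviation M34 :: "(6, 'k::field) mpoly" where "M34 \<equiv> Var 6"

definition pluecker :: "(6, 'k::field) mpoly" where
  "pluecker = M12 * M34 - M13 * M24 + M14 * M23"

definition N_uv :: "6 \<Rightarrow> (4 + 4, 'k::field) mpoly" where
  "N_uv n = (let N = (\<lambda>i j. u_var i * v_var j - u_var j * v_var i) in
     if n = 1 then N 1 2 else if n = 2 then N 1 3 else if n = 3 then N 1 4
     else if n = 4 then N 2 3 else if n = 5 then N 2 4 else N 3 4)"

definition N_to_M :: "6 \<Rightarrow> (6, 'k::field) mpoly" where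
  "N_to_M n =
     (if n = 1 then M34 else if n = 2 then - M24 else if n = 3 then M23
      else if n = 4 then M14 else if n = 5 then - M13 else M12)"

text \<open>The expression \<open>q\<close> of a minor as a quartic in the \<open>N\<^sub>i\<^sub>j\<close> is unique only modulo
  \<open>N\<^sub>1\<^sub>2 N\<^sub>3\<^sub>4 - N\<^sub>1\<^sub>3 N\<^sub>2\<^sub>4 + N\<^sub>1\<^sub>4 N\<^sub>2\<^sub>3\<close>, which the substitution sends to \<open>pluecker\<close>. As \<open>pluecker\<close> is itself
  among the generators, one expression for each minor generates the same ideal as all of them.\<close>

definition line_scheme_ideal :: "(10 \<Rightarrow> 'k::field qform) \<Rightarrow> (6, 'k) mpoly set" where
  "line_scheme_ideal f = ideal_generated (insert pluecker
     {subst N_to_M q | q \<rho>. inj \<rho> \<and> homogeneous 4 q \<and> subst N_uv q = uv_minor f \<rho>})"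


section \<open>The algebras \<open>S\<close> and \<open>T\<close> and the ten curves\<close>

definition relations_S :: "'k::field qform set" where
  "relations_S =
    {qmonom 1 2 - qmonom 3 3, qmonom 4 4 - qmonom 2 1, qmonom 1 3 - qmonom 2 4,
     qmonom 4 1 - qmonom 3 2, qmonom 2 3 - qmonom 3 1, qmonom 4 2 - qmonom 1 4}"

definition relations_T :: "'k::field qform set" where
  "relations_T =
    {qmonom 1 2 - qmonom 3 3, qmonom 4 4 + qmonom 2 1, qmonom 1 3 - qmonom 2 4,
     qmonom 4 1 - qmonom 3 2, qmonom 2 3 - qmonom 3 1, qmonom 4 2 + qmonom 1 4}"

definition line_curves :: "'k::field \<Rightarrow> (6, 'k) mpoly set set list" where
  "line_curves \<alpha> =
    [zero_locus {M12, M34, M13 - Const \<alpha> * M24, pluecker},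
     zero_locus {M12, M34, M13 + Const \<alpha> * M24, pluecker},
     zero_locus {M13, M24, M14 - Const \<alpha> * M23, pluecker},
     zero_locus {M13, M24, M14 + Const \<alpha> * M23, pluecker},
     zero_locus {M14, M23, M12 - M34, pluecker},
     zero_locus {M14, M23, M12 + M34, pluecker},
     zero_locus {M12 - M34, M13 - Const \<alpha> * M24, M14 - Const \<alpha> * M23, pluecker},
     zero_locus {M12 - M34, M13 + Const \<alpha> * M24, M14 + Const \<alpha> * M23, pluecker},
     zero_locus {M12 + M34, M13 - Const \<alpha> * M24, M14 + Const \<alpha> * M23, pluecker},
     zero_locus {M12 + M34, M13 + Const \<alpha> * M24, M14 - Const \<alpha> * M23, pluecker}]"

end

theory Submission
  imports Defs "Jordan_Normal_Form.Determinant"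
begin

section \<open>Substitution and homogeneity\<close>

text \<open>Everything rests on the six linear forms \<open>Y \<alpha> v\<close>, namely M12 + M34,
  M12 - M34, M13 + \<alpha> M24, M13 - \<alpha> M24, M14 + \<alpha> M23, M14 - \<alpha> M23. They
  are coordinates on P^5, they diagonalise the Pluecker quadric (\<open>pluecker_diagonal\<close>),
  and each of the ten curves is cut out of that quadric by three of them. The ten triples are the
  minimal non-faces of a six-vertex triangulation of the real projective plane, so the ten cubic
  products belonging to them generate a Stanley-Reisner ideal, whose zero set is a union of ten
  coordinate planes. Locally at every point the line scheme is the section of these planes by the
  quadric. S and T are treated together: the relations depend only on b = \<alpha>^2, which is 1 for
  S and -1 for T.

  Each curve by itself: on a coordinate plane the quadric becomes a nondegenerate diagonal ternary
  form, which over an algebraically closed field is y^2 = x z up to coordinates. Hence its ideal is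
  the kernel of a map from the polynomial ring to k[s,t] that sends the variables to binary quadrics
  (\<open>conic_veronese\<close>). Such a kernel is prime and defines a scheme isomorphic to P^1
  (\<open>isomorphic_projective_line\<close>); its dimension is one because binary forms split into
  linear factors (\<open>nonzero_prime_maximal\<close>).

  The curves lie on the line scheme: suppose that some nonzero combination of the six relations has
  a coefficient matrix all of whose columns lie on the line through u and v. The dual relations
  annihilate this matrix, and expressing its columns through u and v turns this into a nonzero
  kernel vector of the 10 x 8 matrix, so all maximal minors vanish. At the generic point of each
  conic such a combination is written down explicitly (\<open>incident_relation_exists\<close>,
  \<open>line_scheme_subset_conic\<close>).

  Nothing else lies on it: Laplace expansion along the four pairs of columns (u_b, v_b) writes a
  minor as a quartic in the line coordinates (\<open>row_det_quartic\<close>), and for a sparse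
  basis of the dual relations all forty-five quartics can be listed
  (\<open>base_minor_values\<close>). Modulo the Pluecker polynomial, suitable linear combinations
  of them are the products of the three forms of a triple with one form repeated
  (\<open>square_products\<close>). At a point of the scheme at least two of the six forms do not
  vanish, since a diagonal quadric contains no coordinate vertex (\<open>two_Y_notin\<close>).
  Cancelling these units leaves in the local ring two of the remaining forms and the product of the
  other two, together with the Pluecker polynomial (\<open>edge\<close>). So near the point the
  scheme is one conic or the union of two, with a radical ideal. This yields both the list of
  components and reducedness.\<close>

lemma Const_add: "Const (a + b) = Const a + Const b"
  by (simp add: Const_def single_add)

lemma Const_0 [simp]: "Const 0 = 0"
  by (simp add: Const_def)

lemma Const_1 [simp]: "Const 1 = 1"
  by (simp add: Const_def)

lemma Const_mult: "Const (a * b) = Const a * Const b"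
  by (simp add: Const_def mult_single)

lemma Const_uminus: "Const (- a) = - Const a"
  by (simp add: Const_def single_uminus)

lemma Const_diff: "Const (a - b) = Const a - Const b"
  by (simp add: Const_def single_diff)

lemma Const_power: "Const (a ^ n) = Const a ^ n"
  by (induction n) (simp_all add: Const_mult)

lemma Const_numeral: "Const (numeral n) = numeral n"
  by (simp add: Const_def)

lemma Const_eq_0_iff [simp]: "Const a = 0 \<longleftrightarrow> a = 0"
  by (metis Const_0 Const_def lookup_single_eq)

lemma Var_neq_0 [simp]: "Var v \<noteq> 0"
  by (metis Var_def lookup_single_eq lookup_zero zero_neq_one)

lemma Const_inverse_mult: "c \<noteq> 0 \<Longrightarrow> Const (inverse c) * (Const c * p) = p"
  for c :: "'k::field"
  by (simp add: mult.assoc [symmetric] flip: Const_mult)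

section \<open>Monomials, degrees and induction over polynomials\<close>

lemma mpoly_sum_single: "p = (\<Sum>m\<in>Poly_Mapping.keys p. Poly_Mapping.single m (Poly_Mapping.lookup p m))"
  by (rule poly_mapping_eqI)
    (simp add: lookup_sum lookup_single when_def sum.delta' in_keys_iff)

lemma mpoly_single_induct [case_names single add]:
  assumes "\<And>m c. P (Poly_Mapping.single m c)" and "\<And>p q. P p \<Longrightarrow> P q \<Longrightarrow> P (p + q)"
  shows "P (p :: 'a::zero \<Rightarrow>\<^sub>0 'b::comm_monoid_add)"
proof -
  have "P (\<Sum>m\<in>S. Poly_Mapping.single m (Poly_Mapping.lookup p m))" if "finite S" for S
    using that
  proof (induction S)
    case empty
    show ?case using assms(1)[of 0 0] by simp
  qed (simp add: assms)
  then show ?thesis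
    by (subst mpoly_sum_single) simp
qed

lemma lookup_sum_single:
  "Poly_Mapping.lookup (\<Sum>v\<in>A. Poly_Mapping.single v (g v)) w = (if finite A \<and> w \<in> A then g w else 0)"
  by (cases "finite A") (auto simp: lookup_sum lookup_single when_def sum.delta')

lemma mdeg_superset:
  assumes "finite A" "Poly_Mapping.keys m \<subseteq> A"
  shows "mdeg m = (\<Sum>v\<in>A. Poly_Mapping.lookup m v)"
  unfolding mdeg_def using assms by (intro sum.mono_neutral_left) (auto simp: in_keys_iff)

lemma mdeg_add [simp]: "mdeg (m + n) = mdeg m + mdeg n"
proof -
  let ?A = "Poly_Mapping.keys m \<union> Poly_Mapping.keys n"
  have "Poly_Mapping.keys (m + n) \<subseteq> ?A"
    by (rule keys_add)
  then show ?thesis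
    by (simp add: mdeg_superset[of ?A] lookup_add sum.distrib)
qed

lemma mdeg_0 [simp]: "mdeg 0 = 0"
  by (simp add: mdeg_def)

lemma mdeg_single [simp]: "mdeg (Poly_Mapping.single v k) = k"
  by (simp add: mdeg_def)

lemma exponent_split:
  assumes "mdeg m = Suc k"
  obtains v m' where "m = m' + Poly_Mapping.single v 1" "mdeg m' = k"
proof -
  have "m \<noteq> 0" using assms by auto
  then obtain v where v: "Poly_Mapping.lookup m v \<noteq> 0"
    by (metis lookup_zero poly_mapping_eqI)
  have m: "m = (m - Poly_Mapping.single v 1) + Poly_Mapping.single v 1"
    using v by (intro poly_mapping_eqI) (auto simp: lookup_add lookup_minus lookup_single when_def)
  moreover have "mdeg (m - Poly_Mapping.single v 1) = k"
    using assms by (subst (asm) m) simp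
  ultimately show thesis by (rule that)
qed

lemma mdeg_eq_0_iff [simp]: "mdeg m = 0 \<longleftrightarrow> m = 0"
  by (auto simp: mdeg_def in_keys_iff intro!: poly_mapping_eqI)

lemma exponent_induct [case_names zero add]:
  assumes "P 0" and "\<And>m v. P m \<Longrightarrow> P (m + Poly_Mapping.single v 1)"
  shows "P (m :: 'v \<Rightarrow>\<^sub>0 nat)"
proof (induction "mdeg m" arbitrary: m)
  case 0
  then show ?case using assms(1) by simp
next
  case (Suc k)
  obtain v m' where "m = m' + Poly_Mapping.single v 1" "mdeg m' = k"
    using Suc.hyps(2)[symmetric] by (rule exponent_split)
  then show ?case
    using Suc.hyps(1) assms(2) by simp
qed

lemma mpoly_induct [case_names Const add Var]:
  assumes C: "\<And>c. P (Const c)" and A: "\<And>p q. P p \<Longrightarrow> P q \<Longrightarrow> P (p + q)"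
    and V: "\<And>p v. P p \<Longrightarrow> P (p * Var v)"
  shows "P p"
proof (induction p rule: mpoly_single_induct)
  case (single m c)
  show ?case
  proof (induction m rule: exponent_induct)
    case zero
    then show ?case using C by (simp add: Const_def)
  next
    case (add m v)
    then show ?case using V[OF add, of v] by (simp add: Var_def mult_single)
  qed
qed (rule A)

section \<open>Substitution as a ring homomorphism\<close>

definition mono_subst :: "('v \<Rightarrow> ('w, 'k::comm_ring_1) mpoly) \<Rightarrow> ('v \<Rightarrow>\<^sub>0 nat) \<Rightarrow> ('w, 'k) mpoly" where
  "mono_subst \<sigma> m = (\<Prod>v\<in>Poly_Mapping.keys m. \<sigma> v ^ Poly_Mapping.lookup m v)"

lemma mono_subst_superset:
  assumes "finite A" "Poly_Mapping.keys m \<subseteq> A"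
  shows "mono_subst \<sigma> m = (\<Prod>v\<in>A. \<sigma> v ^ Poly_Mapping.lookup m v)"
  unfolding mono_subst_def using assms by (intro prod.mono_neutral_left) (auto simp: in_keys_iff)

lemma mono_subst_add: "mono_subst \<sigma> (m + n) = mono_subst \<sigma> m * mono_subst \<sigma> n"
proof -
  let ?A = "Poly_Mapping.keys m \<union> Poly_Mapping.keys n"
  have "Poly_Mapping.keys (m + n) \<subseteq> ?A"
    by (rule keys_add)
  then show ?thesis
    by (simp add: mono_subst_superset[of ?A] lookup_add power_add prod.distrib)
qed

lemma subst_superset:
  assumes "finite S" "Poly_Mapping.keys p \<subseteq> S"
  shows "subst \<sigma> p = (\<Sum>m\<in>S. Const (Poly_Mapping.lookup p m) * mono_subst \<sigma> m)"
  unfolding subst_def mono_subst_def using assms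
  by (intro sum.mono_neutral_left) (auto simp: in_keys_iff)

lemma subst_add: "subst \<sigma> (p + q) = subst \<sigma> p + subst \<sigma> q"
proof -
  let ?A = "Poly_Mapping.keys p \<union> Poly_Mapping.keys q"
  have "Poly_Mapping.keys (p + q) \<subseteq> ?A"
    by (rule keys_add)
  then show ?thesis
    by (simp add: subst_superset[of ?A] lookup_add Const_add algebra_simps sum.distrib)
qed

lemma subst_single: "subst \<sigma> (Poly_Mapping.single m c) = Const c * mono_subst \<sigma> m"
  by (subst subst_superset[of "{m}"]) simp_all

lemma subst_mult: "subst \<sigma> (p * q) = subst \<sigma> p * subst \<sigma> q"
proof (induction p rule: mpoly_single_induct)
  case (single m c)
  show ?case
    by (induction q rule: mpoly_single_induct)
      (simp_all add: mult_single subst_single subst_add mono_subst_add Const_mult algebra_simps)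
qed (simp_all add: subst_add algebra_simps)

lemma subst_Const [simp]: "subst \<sigma> (Const c) = Const c"
  by (simp add: Const_def subst_single mono_subst_def)

lemma subst_Var [simp]: "subst \<sigma> (Var v) = \<sigma> v"
  by (simp add: Var_def subst_single mono_subst_def)

lemma subst_0 [simp]: "subst \<sigma> 0 = 0"
  using subst_Const[of \<sigma> 0] by simp

lemma subst_1 [simp]: "subst \<sigma> 1 = 1"
  using subst_Const[of \<sigma> 1] by simp

lemma subst_uminus: "subst \<sigma> (- p) = - subst \<sigma> p"
  using subst_add[of \<sigma> p "- p"] by (simp add: eq_neg_iff_add_eq_0 add.commute)

lemma subst_diff: "subst \<sigma> (p - q) = subst \<sigma> p - subst \<sigma> q"
  using subst_add[of \<sigma> p "- q"] by (simp add: subst_uminus)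

lemma subst_power: "subst \<sigma> (p ^ n) = subst \<sigma> p ^ n"
  by (induction n) (simp_all add: subst_mult)

lemma subst_sum: "subst \<sigma> (sum g A) = (\<Sum>i\<in>A. subst \<sigma> (g i))"
  by (induction A rule: infinite_finite_induct) (simp_all add: subst_add)

lemma subst_prod: "subst \<sigma> (prod g A) = (\<Prod>i\<in>A. subst \<sigma> (g i))"
  by (induction A rule: infinite_finite_induct) (simp_all add: subst_mult)

lemmas subst_simps = subst_add subst_mult subst_uminus subst_diff subst_power

lemma subst_subst: "subst \<tau> (subst \<sigma> p) = subst (\<lambda>v. subst \<tau> (\<sigma> v)) p"
  by (induction p rule: mpoly_induct) (simp_all add: subst_add subst_mult)

section \<open>Homogeneous polynomials and homogeneous components\<close>

lemma homogeneous_0 [simp]: "homogeneous d 0"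
  by (simp add: homogeneous_def)

lemma homogeneous_single [simp]: "mdeg m = d \<Longrightarrow> homogeneous d (Poly_Mapping.single m c)"
  by (simp add: homogeneous_def)

lemma homogeneous_Const [simp]: "homogeneous 0 (Const c)"
  by (simp add: Const_def)

lemma homogeneous_1 [simp]: "homogeneous 0 1"
  using homogeneous_Const[of 1] by simp

lemma homogeneous_Var [simp]: "homogeneous (Suc 0) (Var v)"
  by (simp add: Var_def)

lemma homogeneous_add: "homogeneous d p \<Longrightarrow> homogeneous d q \<Longrightarrow> homogeneous d (p + q)"
  unfolding homogeneous_def using keys_add[of p q] by blast

lemma homogeneous_uminus: "homogeneous d p \<Longrightarrow> homogeneous d (- p)"
  unfolding homogeneous_def by (simp add: in_keys_iff)

lemma homogeneous_diff: "homogeneous d p \<Longrightarrow> homogeneous d q \<Longrightarrow> homogeneous d (p - q)"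
  using homogeneous_add[of d p "- q"] by (simp add: homogeneous_uminus)

lemma homogeneous_mult: "homogeneous d p \<Longrightarrow> homogeneous e q \<Longrightarrow> homogeneous (d + e) (p * q)"
  unfolding homogeneous_def by (fastforce dest: subsetD[OF keys_mult])

lemma homogeneous_Const_mult: "homogeneous d p \<Longrightarrow> homogeneous d (Const c * p)"
  using homogeneous_mult[OF homogeneous_Const[of c], of d p] by simp

lemma homogeneous_sum: "(\<And>i. i \<in> A \<Longrightarrow> homogeneous d (g i)) \<Longrightarrow> homogeneous d (sum g A)"
  by (induction A rule: infinite_finite_induct) (simp_all add: homogeneous_add)

lemma homogeneous_power: "homogeneous d p \<Longrightarrow> homogeneous (n * d) (p ^ n)"
  by (induction n) (simp_all add: homogeneous_mult)

lemma lookup_hcomponent: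
  "Poly_Mapping.lookup (hcomponent d p) m = (if mdeg m = d then Poly_Mapping.lookup p m else 0)"
proof -
  have "finite {m \<in> Poly_Mapping.keys p. mdeg m = d}"
    by simp
  then show ?thesis
    by (simp add: hcomponent_def lookup_sum_single in_keys_iff)
qed

lemma hcomponent_homogeneous: "homogeneous d p \<Longrightarrow> hcomponent e p = (if e = d then p else 0)"
  by (rule poly_mapping_eqI) (auto simp: lookup_hcomponent homogeneous_def in_keys_iff)

lemma homogeneous_hcomponent [simp]: "homogeneous d (hcomponent d p)"
  by (auto simp: homogeneous_def in_keys_iff lookup_hcomponent split: if_splits)

lemma hcomponent_add: "hcomponent d (p + q) = hcomponent d p + hcomponent d q"
  by (rule poly_mapping_eqI) (simp add: lookup_hcomponent lookup_add)

lemma hcomponent_0 [simp]: "hcomponent d 0 = 0"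
  by (simp add: hcomponent_def)

lemma hcomponent_sum: "hcomponent d (sum g A) = (\<Sum>i\<in>A. hcomponent d (g i))"
  by (induction A rule: infinite_finite_induct) (simp_all add: hcomponent_add)

lemma sum_hcomponent: "\<exists>n. \<forall>k\<ge>n. p = (\<Sum>d<k. hcomponent d p)"
proof -
  obtain n where n: "\<And>m. m \<in> Poly_Mapping.keys p \<Longrightarrow> mdeg m < n"
    using finite_nat_set_iff_bounded[of "mdeg ` Poly_Mapping.keys p"] by auto
  have "p = (\<Sum>d<k. hcomponent d p)" if "k \<ge> n" for k
  proof (rule poly_mapping_eqI)
    fix m
    show "Poly_Mapping.lookup p m = Poly_Mapping.lookup (\<Sum>d<k. hcomponent d p) m"
    proof (cases "m \<in> Poly_Mapping.keys p")
      case True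
      then have "mdeg m < k" using n that by fastforce
      then show ?thesis
        by (simp add: lookup_sum lookup_hcomponent)
    qed (simp add: lookup_sum lookup_hcomponent in_keys_iff)
  qed
  then show ?thesis by blast
qed

lemma hcomponent_mult_homogeneous:
  assumes "homogeneous e q"
  shows "hcomponent d (p * q) = (if e \<le> d then hcomponent (d - e) p * q else 0)"
proof -
  obtain n where n: "p = (\<Sum>i<k. hcomponent i p)" if "k \<ge> n" for k
    using sum_hcomponent by blast
  let ?k = "max n (Suc d)"
  have *: "hcomponent d (hcomponent i p * q) = (if i + e = d then hcomponent i p * q else 0)" for i
    by (auto simp: hcomponent_homogeneous[OF homogeneous_mult[OF homogeneous_hcomponent assms]])
  have "hcomponent d (p * q) = (\<Sum>i<?k. hcomponent d (hcomponent i p * q))"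
    using arg_cong[OF n[of ?k], of "\<lambda>x. hcomponent d (x * q)"]
    by (simp only: sum_distrib_right hcomponent_sum max.cobounded1)
  also have "\<dots> = (\<Sum>i<?k. if i + e = d then hcomponent i p * q else 0)"
    by (simp only: *)
  also have "\<dots> = (if e \<le> d then hcomponent (d - e) p * q else 0)"
  proof (cases "e \<le> d")
    case True
    have "(\<Sum>i<?k. if i + e = d then hcomponent i p * q else 0)
        = (\<Sum>i<?k. if i = d - e then hcomponent (d - e) p * q else 0)"
      using True by (intro sum.cong) auto
    then show ?thesis using True by (simp add: less_max_iff_disj less_Suc_eq_le)
  qed auto
  finally show ?thesis .
qed

lemma homogeneous_subst:
  assumes "\<And>v. homogeneous e (\<sigma> v)" "homogeneous d p"
  shows "homogeneous (d * e) (subst \<sigma> p)"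
proof -
  have mono: "homogeneous (mdeg m * e) (mono_subst \<sigma> m)" for m
  proof (induction m rule: exponent_induct)
    case (add m v)
    have "mono_subst \<sigma> (Poly_Mapping.single v 1) = \<sigma> v"
      by (simp add: mono_subst_def)
    then show ?case
      using homogeneous_mult[OF add assms(1)[of v]] by (simp add: mono_subst_add add.commute)
  qed (simp add: mono_subst_def)
  have "homogeneous (d * e) (mono_subst \<sigma> m)" if "m \<in> Poly_Mapping.keys p" for m
    using mono[of m] assms(2) that by (metis homogeneous_def)
  then show ?thesis
    unfolding subst_def mono_subst_def[symmetric]
    by (intro homogeneous_sum homogeneous_Const_mult)
qed

lemma hcomponent_subst:
  assumes "\<And>v. homogeneous e (\<sigma> v)" "e > 0"
  shows "hcomponent (d * e) (subst \<sigma> p) = subst \<sigma> (hcomponent d p)"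
proof -
  obtain n where n: "p = (\<Sum>i<k. hcomponent i p)" if "k \<ge> n" for k
    using sum_hcomponent by blast
  let ?k = "max n (Suc d)"
  have "hcomponent (d * e) (subst \<sigma> p) = hcomponent (d * e) (subst \<sigma> (\<Sum>i<?k. hcomponent i p))"
    using n[of ?k] by (rule arg_cong) simp
  also have "\<dots> = (\<Sum>i<?k. hcomponent (d * e) (subst \<sigma> (hcomponent i p)))"
    by (simp only: subst_sum hcomponent_sum)
  also have "\<dots> = (\<Sum>i<?k. if i = d then subst \<sigma> (hcomponent d p) else 0)"
  proof (rule sum.cong [OF refl])
    fix i
    have "homogeneous (i * e) (subst \<sigma> (hcomponent i p))"
      using assms(1) by (rule homogeneous_subst) simp
    then show "hcomponent (d * e) (subst \<sigma> (hcomponent i p)) = (if i = d then subst \<sigma> (hcomponent d p) else 0)"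
      using assms(2) by (simp add: hcomponent_homogeneous)
  qed
  also have "\<dots> = subst \<sigma> (hcomponent d p)"
    by (simp add: less_max_iff_disj)
  finally show ?thesis .
qed

section \<open>Ideals, homogeneous primes, and closed irreducible sets as closures of points\<close>

section \<open>Ideals and projective schemes\<close>

lemma is_ideal_iff:
  "is_ideal I \<longleftrightarrow> 0 \<in> I \<and> (\<forall>a\<in>I. \<forall>b\<in>I. a + b \<in> I) \<and> (\<forall>c. \<forall>a\<in>I. c * a \<in> I)"
  by (auto simp: module.subspace_def[OF module_self])

lemma ideal_0: "is_ideal I \<Longrightarrow> 0 \<in> I"
  and ideal_add: "is_ideal I \<Longrightarrow> a \<in> I \<Longrightarrow> b \<in> I \<Longrightarrow> a + b \<in> I"
  and ideal_mult: "is_ideal I \<Longrightarrow> a \<in> I \<Longrightarrow> c * a \<in> I"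
  by (auto simp: is_ideal_iff)

lemma ideal_mult_right: "is_ideal I \<Longrightarrow> a \<in> I \<Longrightarrow> a * c \<in> I"
  using ideal_mult[of I a c] by (simp add: mult.commute)

lemma ideal_uminus: "is_ideal I \<Longrightarrow> a \<in> I \<Longrightarrow> - a \<in> I"
  using ideal_mult[of I a "- 1"] by simp

lemma ideal_diff: "is_ideal I \<Longrightarrow> a \<in> I \<Longrightarrow> b \<in> I \<Longrightarrow> a - b \<in> I"
  using ideal_add[of I a "- b"] by (simp add: ideal_uminus)

lemma ideal_sum: "is_ideal I \<Longrightarrow> (\<And>i. i \<in> A \<Longrightarrow> g i \<in> I) \<Longrightarrow> sum g A \<in> I"
  by (induction A rule: infinite_finite_induct) (auto simp: ideal_0 ideal_add)

lemma ideal_congI: "is_ideal I \<Longrightarrow> a - b \<in> I \<Longrightarrow> a \<in> I \<longleftrightarrow> b \<in> I"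
  using ideal_add[of I "a - b" b] ideal_diff[of I a "a - b"] by auto

lemma is_ideal_generated: "is_ideal (ideal_generated G)"
  by (rule module.subspace_span[OF module_self])

lemma ideal_generated_base: "a \<in> G \<Longrightarrow> a \<in> ideal_generated G"
  by (rule module.span_base[OF module_self])

lemma ideal_generated_least: "is_ideal I \<Longrightarrow> G \<subseteq> I \<Longrightarrow> ideal_generated G \<subseteq> I"
  by (rule module.span_minimal[OF module_self])

lemma ideal_generated_mono: "G \<subseteq> H \<Longrightarrow> ideal_generated G \<subseteq> ideal_generated H"
  by (rule module.span_mono[OF module_self])

lemma ideal_generated_insert: "a \<in> ideal_generated (insert g G) \<longleftrightarrow> (\<exists>k. a - k * g \<in> ideal_generated G)"
  by (simp add: module.span_insert[OF module_self])

lemma ideal_subst_vimage: "is_ideal I \<Longrightarrow> is_ideal {p. subst \<sigma> p \<in> I}"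
  by (auto simp: is_ideal_iff subst_add subst_mult)

lemma prime_ideal: "homogeneous_prime p \<Longrightarrow> is_ideal p"
  and prime_one: "homogeneous_prime p \<Longrightarrow> 1 \<notin> p"
  and prime_mult: "homogeneous_prime p \<Longrightarrow> a * b \<in> p \<Longrightarrow> a \<in> p \<or> b \<in> p"
  and prime_hcomponent: "homogeneous_prime p \<Longrightarrow> a \<in> p \<Longrightarrow> hcomponent d a \<in> p"
  by (simp_all add: homogeneous_prime_def)

lemma prime_power: "homogeneous_prime p \<Longrightarrow> a ^ n \<in> p \<Longrightarrow> a \<in> p"
  by (induction n) (auto dest: prime_one prime_mult)

lemma prime_mult_iff: "homogeneous_prime p \<Longrightarrow> a * b \<in> p \<longleftrightarrow> a \<in> p \<or> b \<in> p"
  using prime_mult ideal_mult[OF prime_ideal] ideal_mult_right[OF prime_ideal] by blast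

lemma prime_Const: "homogeneous_prime p \<Longrightarrow> Const c \<in> p \<longleftrightarrow> c = 0"
  for c :: "'k::field"
proof (cases "c = 0")
  assume p: "homogeneous_prime p" and "c \<noteq> 0"
  then have "Const (inverse c) * Const c = 1"
    by (simp flip: Const_mult)
  then show ?thesis
    using ideal_mult[OF prime_ideal[OF p], of "Const c" "Const (inverse c)"] prime_one[OF p] \<open>c \<noteq> 0\<close>
    by metis
qed (simp add: ideal_0 prime_ideal)

lemma proj_space_prime: "p \<in> proj_space \<Longrightarrow> homogeneous_prime p"
  by (simp add: proj_space_def)

lemma zero_locus_iff: "p \<in> zero_locus G \<longleftrightarrow> p \<in> proj_space \<and> G \<subseteq> p"
  by (auto simp: zero_locus_def)

lemma zero_locus_ideal_generated: "zero_locus (ideal_generated G) = zero_locus G"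
proof -
  have "ideal_generated G \<subseteq> p \<longleftrightarrow> G \<subseteq> p" if "p \<in> proj_space" for p :: "('a, 'b) mpoly set"
    using ideal_generated_least[OF prime_ideal[OF proj_space_prime[OF that]], of G]
      ideal_generated_base[of _ G] by auto
  then show ?thesis
    unfolding zero_locus_def by blast
qed

lemma zero_locus_Un: "zero_locus (G \<union> H) = zero_locus G \<inter> zero_locus H"
  by (auto simp: zero_locus_def)

lemma zero_locus_subset_iff: "p \<in> proj_space \<Longrightarrow> zero_locus p \<subseteq> zero_locus G \<longleftrightarrow> G \<subseteq> p"
  by (auto simp: zero_locus_def)

lemma zero_locus_inject: "p \<in> proj_space \<Longrightarrow> q \<in> proj_space \<Longrightarrow> zero_locus p = zero_locus q \<longleftrightarrow> p = q"
  by (metis subset_antisym subset_refl zero_locus_subset_iff)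

lemma topspace_zariski: "topspace zariski = proj_space"
proof -
  have "proj_space = proj_space - zero_locus ({1} :: ('a, 'b) mpoly set)"
    by (auto simp: zero_locus_def proj_space_def homogeneous_prime_def)
  then have "openin zariski (proj_space :: ('a, 'b) mpoly set set)"
    unfolding openin_zariski by blast
  then show ?thesis
    by (metis Diff_subset openin_subset openin_topspace openin_zariski subset_antisym)
qed

lemma topspace_subscheme: "topspace (subscheme_space I) = zero_locus I"
  by (auto simp: subscheme_space_def topspace_zariski zero_locus_def)

lemma openin_subscheme:
  "openin (subscheme_space I) U \<longleftrightarrow> (\<exists>G. U = zero_locus I - zero_locus G)"
proof -
  have "(proj_space - zero_locus G) \<inter> zero_locus I = zero_locus I - zero_locus G" for G
    by (auto simp: zero_locus_def)
  then show ?thesis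
    unfolding subscheme_space_def openin_subtopology openin_zariski by metis
qed

lemma closedin_subscheme:
  "closedin (subscheme_space I) Z \<longleftrightarrow> (\<exists>G. Z = zero_locus I \<inter> zero_locus G)"
proof -
  have "Z \<subseteq> zero_locus I \<and> zero_locus I - Z = zero_locus I - zero_locus G
      \<longleftrightarrow> Z = zero_locus I \<inter> zero_locus G" for G
    by auto
  then show ?thesis
    unfolding closedin_def openin_subscheme topspace_subscheme by auto
qed

text \<open>\<open>zero_locus p\<close> is the closure of the point p: a closed set that contains p
  contains all of it. Of two closed sets covering it, the one containing p is therefore
  enough.\<close>

lemma irreducible_zero_locus:
  assumes "p \<in> zero_locus I"
  shows "irreducible_in (subscheme_space I) (zero_locus p)"
proof -
  have p: "p \<in> zero_locus p" "p \<in> proj_space" "zero_locus p \<subseteq> zero_locus I"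
    using assms by (auto simp: zero_locus_def)
  have *: "zero_locus p \<subseteq> A" if A: "closedin (subscheme_space I) A" "p \<in> A" for A
  proof -
    obtain G where "A = zero_locus I \<inter> zero_locus G"
      using A by (auto simp: closedin_subscheme)
    then show ?thesis using that p by (auto simp: zero_locus_def)
  qed
  show ?thesis
    using p * unfolding irreducible_in_def topspace_subscheme by blast
qed

text \<open>The generic point is the intersection of all primes of Z. If a product lay in it but
  neither factor did, the loci of the two factors would cover Z without either containing
  it.\<close>

lemma generic_point:
  assumes Z: "closedin (subscheme_space I) Z" and irr: "irreducible_in (subscheme_space I) Z"
  shows "\<Inter>Z \<in> zero_locus I" and "Z = zero_locus (\<Inter>Z)"
proof -
  obtain G where G: "Z = zero_locus I \<inter> zero_locus G"
    using Z by (auto simp: closedin_subscheme)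
  have prime: "homogeneous_prime p" if "p \<in> Z" for p
    using that G by (auto simp: zero_locus_iff proj_space_def)
  obtain p where p: "p \<in> Z"
    using irr by (auto simp: irreducible_in_def)
  have "a \<in> \<Inter>Z \<or> b \<in> \<Inter>Z" if ab: "a * b \<in> \<Inter>Z" for a b
  proof -
    have "Z \<subseteq> (zero_locus I \<inter> zero_locus {a}) \<union> (zero_locus I \<inter> zero_locus {b})"
    proof
      fix q assume q: "q \<in> Z"
      have "a \<in> q \<or> b \<in> q"
        using ab q by (intro prime_mult[OF prime[OF q]]) auto
      then show "q \<in> (zero_locus I \<inter> zero_locus {a}) \<union> (zero_locus I \<inter> zero_locus {b})"
        using q unfolding G by (auto simp: zero_locus_iff)
    qed
    then have "Z \<subseteq> zero_locus I \<inter> zero_locus {a} \<or> Z \<subseteq> zero_locus I \<inter> zero_locus {b}"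
      using irr unfolding irreducible_in_def closedin_subscheme by blast
    then show ?thesis by (auto simp: zero_locus_iff)
  qed
  moreover have "is_ideal (\<Inter>Z)"
    using prime_ideal[OF prime] unfolding is_ideal_iff by blast
  moreover have "1 \<notin> \<Inter>Z"
    using p prime prime_one by blast
  moreover have "hcomponent d a \<in> \<Inter>Z" if "a \<in> \<Inter>Z" for a d
    using that prime prime_hcomponent by blast
  ultimately have "homogeneous_prime (\<Inter>Z)"
    unfolding homogeneous_prime_def by blast
  moreover obtain v where "Var v \<notin> p"
    using p G by (auto simp: zero_locus_iff proj_space_def)
  ultimately have proj: "\<Inter>Z \<in> proj_space"
    using p unfolding proj_space_def by blast
  have I: "I \<subseteq> \<Inter>Z" and G': "G \<subseteq> \<Inter>Z"
    unfolding G by (auto simp: zero_locus_iff)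
  show "\<Inter>Z \<in> zero_locus I"
    using proj I by (simp add: zero_locus_iff)
  show "Z = zero_locus (\<Inter>Z)"
  proof
    show "Z \<subseteq> zero_locus (\<Inter>Z)"
      unfolding G by (auto simp: zero_locus_iff)
    have "zero_locus (\<Inter>Z) \<subseteq> zero_locus I \<inter> zero_locus G"
      using I G' unfolding zero_locus_def by blast
    then show "zero_locus (\<Inter>Z) \<subseteq> Z"
      by (simp add: G)
  qed
qed

lemma vanishing_ideal_zero_locus: "p \<in> proj_space \<Longrightarrow> vanishing_ideal (zero_locus p) = p"
  unfolding vanishing_ideal_def zero_locus_def by blast

lemma subtopology_subscheme:
  "I \<subseteq> J \<Longrightarrow> subtopology (subscheme_space I) (zero_locus J) = subscheme_space J"
proof -
  assume "I \<subseteq> J"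
  then have "zero_locus I \<inter> zero_locus J = zero_locus J"
    by (auto simp: zero_locus_def)
  then show ?thesis
    by (simp add: subscheme_space_def subtopology_subtopology)
qed

text \<open>An irreducible set covered by finitely many closed sets lies in one of them, so every
  irreducible set lies in the closure of some point of \<P>. These closures are the maximal
  irreducible sets because no point of \<P> specialises to another.\<close>

lemma irreducible_components_finite:
  assumes sub: "\<And>p. p \<in> \<P> \<Longrightarrow> p \<in> zero_locus I"
    and cover: "\<And>q. q \<in> zero_locus I \<Longrightarrow> \<exists>p\<in>\<P>. p \<subseteq> q"
    and anti: "\<And>p q. p \<in> \<P> \<Longrightarrow> q \<in> \<P> \<Longrightarrow> p \<subseteq> q \<Longrightarrow> p = q"
    and fin: "finite \<P>"
  shows "irreducible_components (subscheme_space I) = zero_locus ` \<P>"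
proof -
  let ?X = "subscheme_space I"
  have closed: "closedin ?X (zero_locus p)" if "p \<in> \<P>" for p
    using sub[OF that] unfolding closedin_subscheme
    by (intro exI[of _ p]) (blast intro: order.trans dest: zero_locus_iff[THEN iffD1] intro!: zero_locus_iff[THEN iffD2])
  have within: "\<exists>p\<in>\<Q>. T \<subseteq> zero_locus p"
    if "finite \<Q>" "\<Q> \<subseteq> \<P>" "T \<subseteq> \<Union>(zero_locus ` \<Q>)" "irreducible_in ?X T" for T \<Q>
    using that
  proof (induction \<Q>)
    case empty
    then show ?case by (auto simp: irreducible_in_def)
  next
    case (insert p \<Q>)
    have "closedin ?X (zero_locus p)" "closedin ?X (\<Union>(zero_locus ` \<Q>))"
      using insert.prems closed insert.hyps(1) by (auto intro!: closedin_Union)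
    then have "T \<subseteq> zero_locus p \<or> T \<subseteq> \<Union>(zero_locus ` \<Q>)"
      using insert.prems unfolding irreducible_in_def by auto
    then show ?case using insert by blast
  qed
  have into: "\<exists>p\<in>\<P>. T \<subseteq> zero_locus p" if "irreducible_in ?X T" for T
  proof (rule within[OF fin order.refl _ that])
    have "T \<subseteq> zero_locus I"
      using that by (simp add: irreducible_in_def topspace_subscheme)
    moreover have "\<exists>p\<in>\<P>. q \<in> zero_locus p" if "q \<in> zero_locus I" for q
      using cover[OF that] that by (auto simp: zero_locus_iff)
    ultimately show "T \<subseteq> \<Union>(zero_locus ` \<P>)"
      by blast
  qed
  have eq: "p = q" if "p \<in> \<P>" "q \<in> \<P>" "zero_locus p \<subseteq> zero_locus q" for p q
    using that sub anti[of q p] zero_locus_subset_iff[of p q] by (auto simp: zero_locus_iff)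
  have "S \<in> zero_locus ` \<P>" if S: "S \<in> irreducible_components ?X" for S
  proof -
    have "irreducible_in ?X S" and max: "\<And>T. irreducible_in ?X T \<Longrightarrow> S \<subseteq> T \<Longrightarrow> T = S"
      using S by (simp_all add: irreducible_components_def)
    then obtain p where p: "p \<in> \<P>" "S \<subseteq> zero_locus p"
      using into by blast
    then have "zero_locus p = S"
      by (intro max irreducible_zero_locus sub)
    then show ?thesis using p by blast
  qed
  moreover have "zero_locus p \<in> irreducible_components ?X" if p: "p \<in> \<P>" for p
  proof -
    have "T = zero_locus p" if T: "irreducible_in ?X T" "zero_locus p \<subseteq> T" for T
    proof -
      obtain q where q: "q \<in> \<P>" "T \<subseteq> zero_locus q"
        using into[OF T(1)] by blast
      then have "p = q"
        using p T(2) by (intro eq) auto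
      then show ?thesis using q T by simp
    qed
    then show ?thesis
      using irreducible_zero_locus[OF sub[OF p]] by (simp add: irreducible_components_def)
  qed
  ultimately show ?thesis by blast
qed


section \<open>Homogeneous localisation and arithmetic of fractions\<close>

section \<open>Local rings\<close>

definition denominator :: "('v, 'k::comm_ring_1) mpoly set \<Rightarrow> ('v, 'k) mpoly \<Rightarrow> bool" where
  "denominator p t \<longleftrightarrow> (\<exists>d. homogeneous d t) \<and> t \<notin> p"

lemma denominator_1: "homogeneous_prime p \<Longrightarrow> denominator p 1"
  unfolding denominator_def using prime_one homogeneous_1 by blast

lemma denominator_mult:
  "homogeneous_prime p \<Longrightarrow> denominator p s \<Longrightarrow> denominator p t \<Longrightarrow> denominator p (s * t)"
  unfolding denominator_def using homogeneous_mult prime_mult by blast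

lemma denominator_power: "homogeneous_prime p \<Longrightarrow> denominator p t \<Longrightarrow> denominator p (t ^ n)"
  by (induction n) (simp_all add: denominator_1 denominator_mult)

definition is_frac :: "('v, 'k::comm_ring_1) mpoly set \<Rightarrow> ('v, 'k) mpoly \<Rightarrow> ('v, 'k) mpoly \<Rightarrow> bool" where
  "is_frac p a b \<longleftrightarrow> (\<exists>d. homogeneous d a \<and> homogeneous d b) \<and> b \<notin> p"

lemma is_frac_denominator: "is_frac p a b \<Longrightarrow> denominator p b"
  by (auto simp: is_frac_def denominator_def)

lemma is_frac_mult:
  assumes p: "homogeneous_prime p" and "is_frac p a b" "is_frac p c e"
  shows "is_frac p (a * c) (b * e)"
proof -
  obtain m n where "homogeneous m a" "homogeneous m b" "homogeneous n c" "homogeneous n e"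
    using assms by (auto simp: is_frac_def)
  then have "homogeneous (m + n) (a * c) \<and> homogeneous (m + n) (b * e)"
    by (simp add: homogeneous_mult)
  moreover have "b * e \<notin> p"
    using assms prime_mult[OF p] by (auto simp: is_frac_def)
  ultimately show ?thesis
    unfolding is_frac_def by blast
qed

lemma is_frac_add:
  assumes p: "homogeneous_prime p" and "is_frac p a b" "is_frac p c e"
  shows "is_frac p (a * e + c * b) (b * e)"
proof -
  obtain m n where "homogeneous m a" "homogeneous m b" "homogeneous n c" "homogeneous n e"
    using assms by (auto simp: is_frac_def)
  then have "homogeneous (m + n) (a * e + c * b)" "homogeneous (m + n) (b * e)"
    using homogeneous_mult[of m a n e] homogeneous_mult[of n c m b] homogeneous_mult[of m b n e]
    by (simp_all add: homogeneous_add add.commute)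
  moreover have "b * e \<notin> p"
    using assms prime_mult[OF p] by (auto simp: is_frac_def)
  ultimately show ?thesis
    unfolding is_frac_def by blast
qed

lemma is_frac_const: "homogeneous_prime p \<Longrightarrow> is_frac p (Const c) 1"
  unfolding is_frac_def using prime_one homogeneous_Const homogeneous_1 by blast

lemma frac_iff:
  "(c, e) \<in> frac I p a b \<longleftrightarrow> is_frac p c e \<and> (\<exists>t. denominator p t \<and> t * (a * e - c * b) \<in> I)"
  by (auto simp: frac_def is_frac_def denominator_def)

lemma frac_same:
  assumes "is_ideal I" "homogeneous_prime p" "is_frac p a b"
  shows "(a, b) \<in> frac I p a b"
  unfolding frac_iff using assms denominator_1[of p] ideal_0[of I] by (intro conjI exI[of _ 1]) auto

text \<open>Transitivity of equality of fractions: to eliminate the middle fraction one multiplies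
  the two multipliers by its denominator, which is again outside p.\<close>

lemma frac_eq:
  assumes I: "is_ideal I" and p: "homogeneous_prime p"
    and ab: "is_frac p a b" and ce: "(c, e) \<in> frac I p a b"
  shows "frac I p c e = frac I p a b"
proof -
  obtain t where t: "denominator p t" "t * (a * e - c * b) \<in> I"
    using ce unfolding frac_iff by blast
  have b: "denominator p b" and e: "denominator p e"
    using ab ce by (auto simp: frac_iff is_frac_denominator)
  have "(\<exists>s. denominator p s \<and> s * (c * e' - c' * e) \<in> I)
      \<longleftrightarrow> (\<exists>s. denominator p s \<and> s * (a * e' - c' * b) \<in> I)" for c' e'
  proof
    assume "\<exists>s. denominator p s \<and> s * (c * e' - c' * e) \<in> I"
    then obtain s where s: "denominator p s" "s * (c * e' - c' * e) \<in> I"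
      by blast
    have "(s * t * e) * (a * e' - c' * b) = (s * e') * (t * (a * e - c * b)) + (t * b) * (s * (c * e' - c' * e))"
      by (simp add: algebra_simps)
    also have "\<dots> \<in> I"
      by (rule ideal_add[OF I ideal_mult[OF I t(2)] ideal_mult[OF I s(2)]])
    finally show "\<exists>s. denominator p s \<and> s * (a * e' - c' * b) \<in> I"
      using denominator_mult[OF p denominator_mult[OF p s(1) t(1)] e] by blast
  next
    assume "\<exists>s. denominator p s \<and> s * (a * e' - c' * b) \<in> I"
    then obtain s where s: "denominator p s" "s * (a * e' - c' * b) \<in> I"
      by blast
    have "(s * t * b) * (c * e' - c' * e) = (- s * e') * (t * (a * e - c * b)) + (t * e) * (s * (a * e' - c' * b))"
      by (simp add: algebra_simps)
    also have "\<dots> \<in> I"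
      by (rule ideal_add[OF I ideal_mult[OF I t(2)] ideal_mult[OF I s(2)]])
    finally show "\<exists>s. denominator p s \<and> s * (c * e' - c' * e) \<in> I"
      using denominator_mult[OF p denominator_mult[OF p s(1) t(1)] b] by blast
  qed
  then show ?thesis
    by (auto simp: frac_iff)
qed

lemma carrier_local_ring: "carrier (local_ring I p) = {frac I p a b | a b. is_frac p a b}"
  by (auto simp: local_ring_def is_frac_def)

lemma frac_UN:
  assumes "frac I p a b \<noteq> {}" "frac I p c e \<noteq> {}"
    and "\<And>a' b' c' e'. (a', b') \<in> frac I p a b \<Longrightarrow> (c', e') \<in> frac I p c e \<Longrightarrow> F a' b' c' e' = X"
  shows "(\<Union>(a', b')\<in>frac I p a b. \<Union>(c', e')\<in>frac I p c e. F a' b' c' e') = X"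
proof -
  obtain a0 b0 c0 e0 where "(a0, b0) \<in> frac I p a b" "(c0, e0) \<in> frac I p c e"
    using assms(1,2) by auto
  then show ?thesis
    using assms(3) by fastforce
qed

text \<open>The common core of well-definedness of products and sums: when the cross difference of
  the results is a combination of the cross differences of the operands, the product of the two
  multipliers brings it into I.\<close>

lemma frac_cross:
  assumes I: "is_ideal I" and p: "homogeneous_prime p"
    and 1: "(a', b') \<in> frac I p a b" and 2: "(c', e') \<in> frac I p c e"
    and "is_frac p x y" and eq: "u * y - x * v = k * (a * b' - a' * b) + l * (c * e' - c' * e)"
  shows "(x, y) \<in> frac I p u v"
proof -
  obtain t where t: "denominator p t" "t * (a * b' - a' * b) \<in> I"
    using 1 unfolding frac_iff by blast
  obtain s where s: "denominator p s" "s * (c * e' - c' * e) \<in> I"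
    using 2 unfolding frac_iff by blast
  have "(s * t) * (u * y - x * v) = (s * k) * (t * (a * b' - a' * b)) + (t * l) * (s * (c * e' - c' * e))"
    unfolding eq by (simp add: algebra_simps)
  also have "\<dots> \<in> I"
    by (rule ideal_add[OF I ideal_mult[OF I t(2)] ideal_mult[OF I s(2)]])
  finally show ?thesis
    unfolding frac_iff using assms(5) denominator_mult[OF p s(1) t(1)] by blast
qed

lemma local_ring_mult:
  assumes I: "is_ideal I" and p: "homogeneous_prime p" and ab: "is_frac p a b" and ce: "is_frac p c e"
  shows "frac I p a b \<otimes>\<^bsub>local_ring I p\<^esub> frac I p c e = frac I p (a * c) (b * e)"
proof -
  have "frac I p (a' * c') (b' * e') = frac I p (a * c) (b * e)"
    if 1: "(a', b') \<in> frac I p a b" and 2: "(c', e') \<in> frac I p c e" for a' b' c' e'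
  proof (rule frac_eq[OF I p is_frac_mult[OF p ab ce]], rule frac_cross[OF I p 1 2])
    show "is_frac p (a' * c') (b' * e')"
      using 1 2 p by (intro is_frac_mult) (auto simp: frac_iff)
    show "a * c * (b' * e') - a' * c' * (b * e) = (c * e') * (a * b' - a' * b) + (a' * b) * (c * e' - c' * e)"
      by (simp add: algebra_simps)
  qed
  moreover have "frac I p a b \<noteq> {}" "frac I p c e \<noteq> {}"
    using frac_same[OF I p ab] frac_same[OF I p ce] by auto
  ultimately show ?thesis
    unfolding local_ring_def by (simp add: frac_UN)
qed

lemma local_ring_add:
  assumes I: "is_ideal I" and p: "homogeneous_prime p" and ab: "is_frac p a b" and ce: "is_frac p c e"
  shows "frac I p a b \<oplus>\<^bsub>local_ring I p\<^esub> frac I p c e = frac I p (a * e + c * b) (b * e)"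
proof -
  have "frac I p (a' * e' + c' * b') (b' * e') = frac I p (a * e + c * b) (b * e)"
    if 1: "(a', b') \<in> frac I p a b" and 2: "(c', e') \<in> frac I p c e" for a' b' c' e'
  proof (rule frac_eq[OF I p is_frac_add[OF p ab ce]], rule frac_cross[OF I p 1 2])
    show "is_frac p (a' * e' + c' * b') (b' * e')"
      using 1 2 p by (intro is_frac_add) (auto simp: frac_iff)
    show "(a * e + c * b) * (b' * e') - (a' * e' + c' * b') * (b * e)
        = (e * e') * (a * b' - a' * b) + (b * b') * (c * e' - c' * e)"
      by (simp add: algebra_simps)
  qed
  moreover have "frac I p a b \<noteq> {}" "frac I p c e \<noteq> {}"
    using frac_same[OF I p ab] frac_same[OF I p ce] by auto
  ultimately show ?thesis
    unfolding local_ring_def by (simp add: frac_UN)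
qed

lemma local_ring_one: "\<one>\<^bsub>local_ring I p\<^esub> = frac I p 1 1"
  and local_ring_zero: "\<zero>\<^bsub>local_ring I p\<^esub> = frac I p 0 1"
  by (simp_all add: local_ring_def)

lemma local_ring_pow:
  assumes I: "is_ideal I" and p: "homogeneous_prime p" and ab: "is_frac p a b"
  shows "is_frac p (a ^ n) (b ^ n) \<and> frac I p a b [^]\<^bsub>local_ring I p\<^esub> n = frac I p (a ^ n) (b ^ n)"
proof (induction n)
  case 0
  show ?case
    using is_frac_const[OF p, of 1] by (simp add: nat_pow_def local_ring_one)
next
  case (Suc n)
  then show ?case
    using local_ring_mult[OF I p _ ab, of "a ^ n" "b ^ n"] is_frac_mult[OF p _ ab, of "a ^ n" "b ^ n"]
    by (simp add: nat_pow_def power_Suc2 del: power_Suc)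
qed

text \<open>The polynomials that become zero in the quotient by I once the homogeneous elements
  outside p are inverted. A fraction is zero exactly if its numerator lies here, so questions about
  local rings become questions about this ideal.\<close>

definition localized :: "('v, 'k::comm_ring_1) mpoly set \<Rightarrow> ('v, 'k) mpoly set \<Rightarrow> ('v, 'k) mpoly set" where
  "localized I p = {a. \<exists>t. denominator p t \<and> t * a \<in> I}"

lemma localizedI: "denominator p t \<Longrightarrow> t * a \<in> I \<Longrightarrow> a \<in> localized I p"
  by (auto simp: localized_def)

lemma localizedE:
  assumes "a \<in> localized I p"
  obtains t where "denominator p t" "t * a \<in> I"
  using assms by (auto simp: localized_def)

lemma frac_eq_zero_iff:
  assumes I: "is_ideal I" and p: "homogeneous_prime p" and ab: "is_frac p a b"
  shows "frac I p a b = frac I p 0 1 \<longleftrightarrow> a \<in> localized I p"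
proof
  assume "frac I p a b = frac I p 0 1"
  then have "(a, b) \<in> frac I p 0 1"
    using frac_same[OF I p ab] by simp
  then obtain t where "denominator p t" "t * (0 * b - a * 1) \<in> I"
    unfolding frac_iff by blast
  then show "a \<in> localized I p"
    using ideal_uminus[OF I, of "t * (0 * b - a * 1)"] by (intro localizedI) auto
next
  assume "a \<in> localized I p"
  then obtain t where t: "denominator p t" "t * a \<in> I"
    by (rule localizedE)
  have "(a, b) \<in> frac I p 0 1"
    unfolding frac_iff using ab t ideal_uminus[OF I t(2)] by (intro conjI exI[of _ t]) auto
  then show "frac I p a b = frac I p 0 1"
    using frac_eq[OF I p is_frac_const[OF p, of 0]] by simp
qed

text \<open>The n-th power of a / b is a^n / b^n, so nilpotency concerns only the numerator.\<close>

lemma reduced_schemeI: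
  assumes I: "is_ideal I"
    and rad: "\<And>p a n. p \<in> zero_locus I \<Longrightarrow> a ^ n \<in> localized I p \<Longrightarrow> a \<in> localized I p"
  shows "reduced_scheme I"
  unfolding reduced_scheme_def reduced_ring_def
proof (intro ballI allI impI)
  fix p X and n :: nat
  assume p: "p \<in> zero_locus I" and X: "X \<in> carrier (local_ring I p)"
    and pow: "X [^]\<^bsub>local_ring I p\<^esub> n = \<zero>\<^bsub>local_ring I p\<^esub>"
  have p': "homogeneous_prime p"
    using p by (simp add: zero_locus_iff proj_space_prime)
  obtain a b where ab: "X = frac I p a b" "is_frac p a b"
    using X by (auto simp: carrier_local_ring)
  have "a ^ n \<in> localized I p"
    using local_ring_pow[OF I p' ab(2), of n] frac_eq_zero_iff[OF I p'] pow
    by (simp add: ab(1) local_ring_zero)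
  then have "a \<in> localized I p"
    by (rule rad[OF p])
  then show "X = \<zero>\<^bsub>local_ring I p\<^esub>"
    using frac_eq_zero_iff[OF I p' ab(2)] by (simp add: ab(1) local_ring_zero)
qed

lemma is_ideal_localized:
  assumes I: "is_ideal I" and p: "homogeneous_prime p"
  shows "is_ideal (localized I p)"
  unfolding is_ideal_iff
proof (intro conjI ballI allI)
  show "0 \<in> localized I p"
    using denominator_1[OF p] ideal_0[OF I] by (intro localizedI[of _ 1]) auto
next
  fix a b assume "a \<in> localized I p" "b \<in> localized I p"
  then obtain t s where t: "denominator p t" "t * a \<in> I" and s: "denominator p s" "s * b \<in> I"
    by (auto elim!: localizedE)
  have "(t * s) * (a + b) = s * (t * a) + t * (s * b)"
    by (simp add: algebra_simps)
  also have "\<dots> \<in> I"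
    by (rule ideal_add[OF I ideal_mult[OF I t(2)] ideal_mult[OF I s(2)]])
  finally show "a + b \<in> localized I p"
    by (rule localizedI[OF denominator_mult[OF p t(1) s(1)]])
next
  fix a c assume "a \<in> localized I p"
  then obtain t where t: "denominator p t" "t * a \<in> I"
    by (rule localizedE)
  have "t * (c * a) \<in> I"
    using ideal_mult[OF I t(2), of c] by (simp add: ac_simps)
  then show "c * a \<in> localized I p"
    by (rule localizedI[OF t(1)])
qed

lemma localized_base: "homogeneous_prime p \<Longrightarrow> a \<in> I \<Longrightarrow> a \<in> localized I p"
  using denominator_1 by (intro localizedI[of _ 1]) auto

lemma localized_cancel:
  assumes p: "homogeneous_prime p" and s: "denominator p s" "s * a \<in> localized I p"
  shows "a \<in> localized I p"
proof -
  obtain t where t: "denominator p t" "t * (s * a) \<in> I"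
    using s(2) by (rule localizedE)
  show ?thesis
    by (rule localizedI[OF denominator_mult[OF p t(1) s(1)]]) (use t(2) in \<open>simp add: mult.assoc\<close>)
qed

section \<open>Binary quadrics, and the homeomorphism between a conic and P^1\<close>

section \<open>The projective line as a plane conic\<close>

text \<open>If neither a nor b is in J, take their components of least degree m and n outside J. The
  component of a * b in degree m + n is the product of these two up to terms in J, which contradicts
  primality for homogeneous elements.\<close>

lemma graded_primeI:
  assumes J: "is_ideal J" and "1 \<notin> J" and comp: "\<And>a d. a \<in> J \<Longrightarrow> hcomponent d a \<in> J"
    and prime: "\<And>d e a b. homogeneous d a \<Longrightarrow> homogeneous e b \<Longrightarrow> a * b \<in> J \<Longrightarrow> a \<in> J \<or> b \<in> J"
  shows "homogeneous_prime J"
proof -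
  have least: "\<exists>m. hcomponent m a \<notin> J \<and> (\<forall>i<m. hcomponent i a \<in> J)" if "a \<notin> J" for a
  proof -
    obtain n where "a = (\<Sum>i<n. hcomponent i a)"
      using sum_hcomponent by blast
    then have "\<exists>m. hcomponent m a \<notin> J"
      using that ideal_sum[OF J, of "{..<n}" "\<lambda>i. hcomponent i a"] by auto
    then show ?thesis
      using exists_least_iff[of "\<lambda>m. hcomponent m a \<notin> J"] by auto
  qed
  have "a \<in> J \<or> b \<in> J" if ab: "a * b \<in> J" for a b
  proof (rule ccontr)
    assume "\<not> (a \<in> J \<or> b \<in> J)"
    then obtain m n where m: "hcomponent m a \<notin> J" "\<And>i. i < m \<Longrightarrow> hcomponent i a \<in> J"
      and n: "hcomponent n b \<notin> J" "\<And>i. i < n \<Longrightarrow> hcomponent i b \<in> J"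
      using least[of a] least[of b] by auto
    obtain N where N: "a = (\<Sum>i<k. hcomponent i a)" if "k \<ge> N" for k
      using sum_hcomponent by blast
    let ?N = "max N (Suc m)"
    let ?c = "\<lambda>i. if i \<le> m + n then hcomponent i a * hcomponent (m + n - i) b else 0"
    have "a * b = (\<Sum>i<?N. b * hcomponent i a)"
      using arg_cong[OF N[of ?N], of "\<lambda>x. x * b"]
      by (simp only: sum_distrib_right max.cobounded1 mult.commute[of b])
    then have "hcomponent (m + n) (a * b) = (\<Sum>i<?N. hcomponent (m + n) (b * hcomponent i a))"
      by (simp only: hcomponent_sum)
    also have "\<dots> = (\<Sum>i<?N. ?c i)"
      by (intro sum.cong refl) (auto simp: hcomponent_mult_homogeneous[OF homogeneous_hcomponent] mult.commute)
    also have "\<dots> = ?c m + (\<Sum>i\<in>{..<?N} - {m}. ?c i)"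
      by (rule sum.remove) auto
    finally have eq: "hcomponent (m + n) (a * b) - (\<Sum>i\<in>{..<?N} - {m}. ?c i) = hcomponent m a * hcomponent n b"
      by simp
    have "(\<Sum>i\<in>{..<?N} - {m}. ?c i) \<in> J"
    proof (rule ideal_sum[OF J])
      fix i assume "i \<in> {..<?N} - {m}"
      \<comment> \<open>An index other than m makes one of the two factors have degree below the
        chosen minimum, or exceeds m + n and contributes zero.\<close>
      then have "i < m \<or> m + n - i < n \<or> \<not> i \<le> m + n"
        by auto
      then show "?c i \<in> J"
        using m(2)[of i] n(2)[of "m + n - i"] ideal_mult[OF J] ideal_mult_right[OF J] ideal_0[OF J] by auto
    qed
    then have "hcomponent m a * hcomponent n b \<in> J"
      unfolding eq[symmetric] by (rule ideal_diff[OF J comp[OF ab]])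
    then show False
      using prime[OF homogeneous_hcomponent homogeneous_hcomponent, of m a n b] m(1) n(1) by simp
  qed
  then show ?thesis
    using assms unfolding homogeneous_prime_def by blast
qed

lemma homogeneous_in_irrelevant:
  assumes J: "is_ideal J" and V: "\<And>v. Var v \<in> J" and b: "homogeneous (Suc d) b"
  shows "b \<in> J"
proof -
  have "Poly_Mapping.single m c \<in> J" if m: "mdeg m = Suc d" for m c
  proof -
    obtain v m' where "m = m' + Poly_Mapping.single v 1"
      using exponent_split[OF m] by blast
    then have "Poly_Mapping.single m c = Poly_Mapping.single m' c * Var v"
      by (simp add: Var_def mult_single)
    then show ?thesis
      using ideal_mult[OF J V] by simp
  qed
  then have "(\<Sum>m\<in>Poly_Mapping.keys b. Poly_Mapping.single m (Poly_Mapping.lookup b m)) \<in> J"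
    using b by (intro ideal_sum[OF J]) (auto simp: homogeneous_def)
  then show ?thesis
    using mpoly_sum_single[of b] by simp
qed

lemma zero_in_proj_space: "{0} \<in> (proj_space :: ('v::{finite,linorder}, 'k::field) mpoly set set)"
proof -
  have "homogeneous_prime ({0} :: ('v, 'k) mpoly set)"
    by (auto simp: homogeneous_prime_def is_ideal_iff)
  then show ?thesis
    by (simp add: proj_space_def)
qed

lemma is_ideal_zero: "is_ideal {0 :: 'a::comm_ring_1}"
  by (simp add: is_ideal_iff)

text \<open>The map from P^1 given by binary quadrics. Since linear forms already reach every
  product of two variables, the image of \<nu> consists exactly of the polynomials all of whose
  terms have even degree, the second Veronese subring of k[s,t].\<close>

locale veronese =
  fixes \<sigma> :: "'v::finite \<Rightarrow> (2, 'k::field) mpoly"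
  assumes hom_sigma: "homogeneous 2 (\<sigma> v)"
    and lift_quadric: "\<exists>a. homogeneous 1 a \<and> subst \<sigma> a = Var i * Var j"
begin

abbreviation \<nu> :: "('v, 'k) mpoly \<Rightarrow> (2, 'k) mpoly" where "\<nu> \<equiv> subst \<sigma>"

definition comap :: "(2, 'k) mpoly set \<Rightarrow> ('v, 'k) mpoly set" where
  "comap q = {a. \<nu> a \<in> q}"

text \<open>The inverse of contracting primes along \<nu>. A form of odd degree is not in the image
  of \<nu>, but its square is, and a prime contains a form exactly if it contains the square; hence
  the condition on squares of components.\<close>

definition expand :: "('v, 'k) mpoly set \<Rightarrow> (2, 'k) mpoly set" where
  "expand p = {b. \<forall>d. \<exists>a\<in>p. \<nu> a = (hcomponent d b)\<^sup>2}"

abbreviation kernel :: "('v, 'k) mpoly set" where "kernel \<equiv> {a. \<nu> a = 0}"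

lemma comap_iff: "a \<in> comap q \<longleftrightarrow> \<nu> a \<in> q"
  by (simp add: comap_def)

lemma homogeneous_nu: "homogeneous d a \<Longrightarrow> homogeneous (2 * d) (\<nu> a)"
  using homogeneous_subst[of 2 \<sigma> d a] hom_sigma by (simp add: mult.commute)

lemma lift_single:
  assumes "mdeg m = 2 * d"
  shows "\<exists>a. homogeneous d a \<and> \<nu> a = Poly_Mapping.single m c"
  using assms
proof (induction d arbitrary: m)
  case 0
  then have "m = 0" by simp
  then show ?case
    using subst_Const[of \<sigma> c] by (intro exI[of _ "Const c"]) (simp add: Const_def)
next
  case (Suc d)
  have "mdeg m = Suc (Suc (2 * d))"
    using Suc.prems by simp
  then obtain i m1 where m1: "m = m1 + Poly_Mapping.single i 1" "mdeg m1 = Suc (2 * d)"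
    by (rule exponent_split)
  obtain j m2 where m2: "m1 = m2 + Poly_Mapping.single j 1" "mdeg m2 = 2 * d"
    using m1(2) by (rule exponent_split)
  obtain a where a: "homogeneous d a" "\<nu> a = Poly_Mapping.single m2 c"
    using Suc.IH[OF m2(2)] by blast
  obtain b where b: "homogeneous 1 b" "\<nu> b = Var j * Var i"
    using lift_quadric by blast
  have "homogeneous (Suc d) (a * b)"
    using homogeneous_mult[OF a(1) b(1)] by simp
  moreover have "\<nu> (a * b) = Poly_Mapping.single m c"
    by (simp add: subst_mult a b m1 m2 Var_def mult_single add.assoc)
  ultimately show ?case by blast
qed

lemma lift:
  assumes "homogeneous (2 * d) b"
  shows "\<exists>a. homogeneous d a \<and> \<nu> a = b"
proof -
  have "\<forall>m\<in>Poly_Mapping.keys b. \<exists>a. homogeneous d a \<and> \<nu> a = Poly_Mapping.single m (Poly_Mapping.lookup b m)"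
  proof (intro ballI lift_single)
    fix m assume "m \<in> Poly_Mapping.keys b"
    then show "mdeg m = 2 * d"
      using assms by (simp add: homogeneous_def)
  qed
  then obtain g where g: "\<And>m. m \<in> Poly_Mapping.keys b \<Longrightarrow>
      homogeneous d (g m) \<and> \<nu> (g m) = Poly_Mapping.single m (Poly_Mapping.lookup b m)"
    by metis
  have "\<nu> (sum g (Poly_Mapping.keys b)) = b"
    using g mpoly_sum_single[of b] by (simp add: subst_sum)
  moreover have "homogeneous d (sum g (Poly_Mapping.keys b))"
    using g by (intro homogeneous_sum) auto
  ultimately show ?thesis by blast
qed

lemma lift_square: "homogeneous d b \<Longrightarrow> \<exists>a. homogeneous d a \<and> \<nu> a = b\<^sup>2"
  using lift[of d "b\<^sup>2"] homogeneous_power[of d b 2] by simp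

lemma lift_prod: "homogeneous d b \<Longrightarrow> homogeneous d c \<Longrightarrow> \<exists>a. homogeneous d a \<and> \<nu> a = b * c"
  using lift[of d "b * c"] homogeneous_mult[of d b d c] by (simp add: mult_2)

lemma comap_proj:
  assumes "q \<in> proj_space"
  shows "comap q \<in> zero_locus kernel"
proof -
  have q: "homogeneous_prime q" and qi: "is_ideal q"
    using assms proj_space_prime prime_ideal by auto
  have "is_ideal (comap q)"
    unfolding comap_def by (rule ideal_subst_vimage[OF qi])
  moreover have "hcomponent d a \<in> comap q" if "a \<in> comap q" for a d
    using that prime_hcomponent[OF q, of "\<nu> a" "d * 2"] hom_sigma
    by (simp add: comap_iff hcomponent_subst)
  ultimately have prime: "homogeneous_prime (comap q)"
    using prime_one[OF q] prime_mult[OF q]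
    unfolding homogeneous_prime_def by (simp add: comap_iff subst_mult)
  have "\<exists>v. Var v \<notin> comap q"
  proof (rule ccontr)
    assume "\<nexists>v. Var v \<notin> comap q"
    then have V: "\<And>v. Var v \<in> comap q" by blast
    \<comment> \<open>The square of each variable is the image of a linear form; if that form is in
      the contraction, then q contains the variable itself.\<close>
    have "Var i \<in> q" for i
    proof -
      obtain a where a: "homogeneous 1 a" "\<nu> a = Var i * Var i"
        using lift_quadric by blast
      then have "a \<in> comap q"
        using homogeneous_in_irrelevant[OF prime_ideal[OF prime] V] by simp
      then show ?thesis
        using a(2) prime_mult[OF q] by (auto simp: comap_iff)
    qed
    then show False
      using assms by (simp add: proj_space_def)
  qed
  then have "comap q \<in> proj_space"
    using prime by (simp add: proj_space_def)
  moreover have "kernel \<subseteq> comap q"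
    using ideal_0[OF qi] by (auto simp: comap_iff)
  ultimately show ?thesis
    by (simp add: zero_locus_iff)
qed

lemma comap_zero: "comap {0} = kernel"
  by (simp add: comap_def)

lemma kernel_proj: "kernel \<in> proj_space"
  using comap_proj[OF zero_in_proj_space] by (simp add: zero_locus_iff comap_zero)

context
  fixes p assumes p: "p \<in> zero_locus kernel"
begin

lemma p_prime: "homogeneous_prime p" and p_ideal: "is_ideal p"
  using p proj_space_prime prime_ideal by (auto simp: zero_locus_iff)

lemma nu_eq:
  assumes "a \<in> p" "\<nu> a = \<nu> b"
  shows "b \<in> p"
proof -
  have "a - b \<in> kernel"
    using assms by (simp add: subst_diff)
  then have "a - b \<in> p"
    using p unfolding zero_locus_iff by blast
  then show ?thesis
    using ideal_congI[OF p_ideal, of a b] assms by simp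
qed

text \<open>In the expansion of (b + c)^2 only the mixed term needs care: a lift k of b * c has k^2
  mapping to b^2 * c^2, so k^2, and then k, lies in the prime p.\<close>

lemma square_add:
  assumes hom: "homogeneous d b" "homogeneous d c"
    and "\<exists>a\<in>p. \<nu> a = b\<^sup>2" "\<exists>a\<in>p. \<nu> a = c\<^sup>2"
  shows "\<exists>a\<in>p. \<nu> a = (b + c)\<^sup>2"
proof -
  obtain g h where g: "g \<in> p" "\<nu> g = b\<^sup>2" and h: "h \<in> p" "\<nu> h = c\<^sup>2"
    using assms by blast
  obtain k where k: "\<nu> k = b * c"
    using lift_prod[OF hom] by blast
  have "k\<^sup>2 \<in> p"
    using ideal_mult[OF p_ideal h(1), of g]
    by (rule nu_eq) (simp add: subst_mult subst_power g h k power_mult_distrib)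
  then have "k \<in> p"
    by (rule prime_power[OF p_prime])
  then have "g + (k + k) + h \<in> p"
    using g h by (intro ideal_add[OF p_ideal])
  moreover have "\<nu> (g + (k + k) + h) = (b + c)\<^sup>2"
    unfolding subst_add g h k by (simp add: power2_eq_square algebra_simps)
  ultimately show ?thesis by blast
qed

lemma square_mult:
  assumes "homogeneous e c" "\<exists>a\<in>p. \<nu> a = b\<^sup>2"
  shows "\<exists>a\<in>p. \<nu> a = (c * b)\<^sup>2"
proof -
  obtain g where g: "g \<in> p" "\<nu> g = b\<^sup>2"
    using assms by blast
  obtain h where "\<nu> h = c\<^sup>2"
    using lift_square[OF assms(1)] by blast
  then show ?thesis
    using ideal_mult[OF p_ideal g(1), of h] g(2) by (intro bexI[of _ "h * g"]) (simp_all add: subst_mult power_mult_distrib)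
qed

lemma square_0: "\<exists>a\<in>p. \<nu> a = 0\<^sup>2"
  using ideal_0[OF p_ideal] by (intro bexI[of _ 0]) auto

lemma square_sum:
  assumes "\<And>i. i \<in> A \<Longrightarrow> homogeneous d (g i)" "\<And>i. i \<in> A \<Longrightarrow> \<exists>a\<in>p. \<nu> a = (g i)\<^sup>2"
  shows "\<exists>a\<in>p. \<nu> a = (sum g A)\<^sup>2"
  using assms
proof (induction A rule: infinite_finite_induct)
  case (insert i A)
  have "\<exists>a\<in>p. \<nu> a = (g i + sum g A)\<^sup>2"
    by (rule square_add) (use insert in \<open>auto intro: homogeneous_sum\<close>)
  then show ?case using insert.hyps by simp
qed (use square_0 in auto)

lemma expand_homogeneous:
  assumes "homogeneous d b"
  shows "b \<in> expand p \<longleftrightarrow> (\<exists>a\<in>p. \<nu> a = b\<^sup>2)"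
proof
  assume "b \<in> expand p"
  then have "\<exists>a\<in>p. \<nu> a = (hcomponent d b)\<^sup>2"
    unfolding expand_def by blast
  then show "\<exists>a\<in>p. \<nu> a = b\<^sup>2"
    by (simp add: hcomponent_homogeneous[OF assms])
next
  assume "\<exists>a\<in>p. \<nu> a = b\<^sup>2"
  then show "b \<in> expand p"
    using square_0 by (auto simp: expand_def hcomponent_homogeneous[OF assms])
qed

lemma expand_ideal: "is_ideal (expand p)"
  unfolding is_ideal_iff
proof (intro conjI ballI allI)
  show "0 \<in> expand p"
    using square_0 by (simp add: expand_def)
next
  fix b c assume "b \<in> expand p" "c \<in> expand p"
  then show "b + c \<in> expand p"
    unfolding expand_def hcomponent_add mem_Collect_eq
    by (intro allI square_add[OF homogeneous_hcomponent homogeneous_hcomponent]) blast+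
next
  fix b c :: "(2, 'k) mpoly" assume b: "b \<in> expand p"
  obtain n where n: "c = (\<Sum>i<n. hcomponent i c)"
    using sum_hcomponent by blast
  have "\<exists>a\<in>p. \<nu> a = (hcomponent d (c * b))\<^sup>2" for d
  proof -
    have "hcomponent d (b * c) = (\<Sum>i<n. hcomponent d (b * hcomponent i c))"
      using arg_cong[OF n, of "\<lambda>x. hcomponent d (b * x)"] by (simp only: sum_distrib_left hcomponent_sum)
    moreover have "\<exists>a\<in>p. \<nu> a = (hcomponent d (b * hcomponent i c))\<^sup>2" for i
    proof -
      have "\<exists>a\<in>p. \<nu> a = (hcomponent i c * hcomponent (d - i) b)\<^sup>2"
        using b by (intro square_mult[OF homogeneous_hcomponent]) (simp add: expand_def)
      then show ?thesis
        using square_0 by (simp add: hcomponent_mult_homogeneous[OF homogeneous_hcomponent] mult.commute)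
    qed
    ultimately show ?thesis
      using square_sum[of "{..<n}" d "\<lambda>i. hcomponent d (b * hcomponent i c)"]
      by (simp add: mult.commute)
  qed
  then show "c * b \<in> expand p"
    by (simp add: expand_def)
qed

lemma expand_prime: "homogeneous_prime (expand p)"
proof (rule graded_primeI[OF expand_ideal])
  show "1 \<notin> expand p"
    using nu_eq[of _ 1] prime_one[OF p_prime] by (auto simp: expand_homogeneous[OF homogeneous_1])
next
  fix a d assume "a \<in> expand p"
  then show "hcomponent d a \<in> expand p"
    unfolding expand_homogeneous[OF homogeneous_hcomponent] by (simp add: expand_def)
next
  fix d e b c assume hom: "homogeneous d b" "homogeneous e c" and "b * c \<in> expand p"
  then obtain a where a: "a \<in> p" "\<nu> a = (b * c)\<^sup>2"
    using expand_homogeneous[OF homogeneous_mult[OF hom]] by blast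
  obtain g h where g: "\<nu> g = b\<^sup>2" and h: "\<nu> h = c\<^sup>2"
    using lift_square hom by meson
  have "g * h \<in> p"
    using a(1) by (rule nu_eq) (simp add: a g h subst_mult power_mult_distrib)
  then have "g \<in> p \<or> h \<in> p"
    by (rule prime_mult[OF p_prime])
  then show "b \<in> expand p \<or> c \<in> expand p"
    using g h by (auto simp: expand_homogeneous[OF hom(1)] expand_homogeneous[OF hom(2)])
qed

lemma nu_expand_homogeneous: "homogeneous d a \<Longrightarrow> \<nu> a \<in> expand p \<longleftrightarrow> a \<in> p"
proof -
  assume hom: "homogeneous d a"
  have "(\<exists>b\<in>p. \<nu> b = (\<nu> a)\<^sup>2) \<longleftrightarrow> a\<^sup>2 \<in> p"
    using nu_eq[of _ "a\<^sup>2"] by (metis subst_power)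
  also have "\<dots> \<longleftrightarrow> a \<in> p"
    using prime_power[OF p_prime] prime_mult_iff[OF p_prime] by (auto simp: power2_eq_square)
  finally show ?thesis
    by (simp add: expand_homogeneous[OF homogeneous_nu[OF hom]])
qed

lemma comap_expand: "comap (expand p) = p"
proof -
  have comp: "(\<forall>d. hcomponent d a \<in> p) \<longleftrightarrow> a \<in> p" for a
  proof
    obtain n where n: "a = (\<Sum>d<n. hcomponent d a)"
      using sum_hcomponent by blast
    show "a \<in> p" if "\<forall>d. hcomponent d a \<in> p"
      using that ideal_sum[OF p_ideal, of "{..<n}" "\<lambda>d. hcomponent d a"] n by simp
  qed (simp add: prime_hcomponent[OF p_prime])
  have "a \<in> p" if "a \<in> comap (expand p)" for a
  proof -
    have "hcomponent d a \<in> p" for d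
      using prime_hcomponent[OF expand_prime, of "\<nu> a" "d * 2"] that nu_expand_homogeneous[OF homogeneous_hcomponent]
      by (simp add: comap_iff hcomponent_subst hom_sigma)
    then show ?thesis using comp by blast
  qed
  moreover have "a \<in> comap (expand p)" if "a \<in> p" for a
  proof -
    obtain n where n: "a = (\<Sum>d<n. hcomponent d a)"
      using sum_hcomponent by blast
    have "(\<Sum>d<n. \<nu> (hcomponent d a)) \<in> expand p"
      using prime_hcomponent[OF p_prime that] nu_expand_homogeneous[OF homogeneous_hcomponent]
      by (intro ideal_sum[OF expand_ideal]) simp
    then show ?thesis
      using arg_cong[OF n, of \<nu>] by (simp add: comap_iff subst_sum)
  qed
  ultimately show ?thesis by blast
qed

lemma expand_proj: "expand p \<in> proj_space"
proof -
  have "\<exists>i. Var i \<notin> expand p"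
  proof (rule ccontr)
    assume "\<nexists>i. Var i \<notin> expand p"
    then have "\<sigma> v \<in> expand p" for v
      using homogeneous_in_irrelevant[OF expand_ideal, of 1 "\<sigma> v"] hom_sigma
      by (simp add: numeral_2_eq_2)
    then have "Var v \<in> p" for v
      using comap_expand by (metis comap_iff subst_Var)
    then show False
      using p by (simp add: zero_locus_iff proj_space_def)
  qed
  then show ?thesis
    using expand_prime by (simp add: proj_space_def)
qed

end

text \<open>Every square of a component has a lift, so membership in \<open>expand (comap q)\<close>
  says that q contains the squares of all components; q is prime and homogeneous.\<close>

lemma expand_comap:
  assumes q: "q \<in> proj_space"
  shows "expand (comap q) = q"
proof -
  have prime: "homogeneous_prime q"
    using q by (rule proj_space_prime)
  have "b \<in> expand (comap q) \<longleftrightarrow> (\<forall>d. (hcomponent d b)\<^sup>2 \<in> q)" for b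
  proof -
    have "(\<exists>a\<in>comap q. \<nu> a = (hcomponent d b)\<^sup>2) \<longleftrightarrow> (hcomponent d b)\<^sup>2 \<in> q" for d
    proof -
      obtain g where "\<nu> g = (hcomponent d b)\<^sup>2"
        using lift_square[OF homogeneous_hcomponent, of d b] by blast
      then show ?thesis
        by (auto simp: comap_iff)
    qed
    then show ?thesis by (simp add: expand_def)
  qed
  moreover have "(\<forall>d. (hcomponent d b)\<^sup>2 \<in> q) \<longleftrightarrow> (\<forall>d. hcomponent d b \<in> q)" for b
    using prime_power[OF prime] prime_mult_iff[OF prime] by (metis power2_eq_square)
  moreover have "(\<forall>d. hcomponent d b \<in> q) \<longleftrightarrow> b \<in> q" for b
  proof
    obtain n where n: "b = (\<Sum>d<n. hcomponent d b)"
      using sum_hcomponent by blast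
    show "b \<in> q" if "\<forall>d. hcomponent d b \<in> q"
      using that ideal_sum[OF prime_ideal[OF prime], of "{..<n}" "\<lambda>d. hcomponent d b"] n by simp
  qed (simp add: prime_hcomponent[OF prime])
  ultimately show ?thesis by blast
qed

end

section \<open>Sections of the structure sheaf and their transport along the conic
  parametrisation\<close>

lemma carrier_sections:
  "s \<in> carrier (sections I U) \<longleftrightarrow> s \<in> extensional U \<and>
    (\<forall>p\<in>U. \<exists>V a b. openin (subscheme_space I) V \<and> p \<in> V \<and> V \<subseteq> U \<and>
       (\<forall>q\<in>V. is_frac q a b \<and> s q = frac I q a b))"
  (is "_ \<longleftrightarrow> _ \<and> (\<forall>p\<in>U. ?R p)")
proof -
  have "(\<exists>V a b d. openin (subscheme_space I) V \<and> p \<in> V \<and> V \<subseteq> U \<and> homogeneous d a \<and> homogeneous d b \<and>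
         (\<forall>q\<in>V. b \<notin> q \<and> s q = frac I q a b)) \<longleftrightarrow> ?R p" for p
  proof
    assume "\<exists>V a b d. openin (subscheme_space I) V \<and> p \<in> V \<and> V \<subseteq> U \<and> homogeneous d a \<and> homogeneous d b \<and>
      (\<forall>q\<in>V. b \<notin> q \<and> s q = frac I q a b)"
    then obtain V a b d where "openin (subscheme_space I) V \<and> p \<in> V \<and> V \<subseteq> U"
      "homogeneous d a \<and> homogeneous d b" "\<forall>q\<in>V. b \<notin> q \<and> s q = frac I q a b"
      by blast
    then have "openin (subscheme_space I) V \<and> p \<in> V \<and> V \<subseteq> U \<and> (\<forall>q\<in>V. is_frac q a b \<and> s q = frac I q a b)"
      by (auto simp: is_frac_def)
    then show "?R p" by blast
  next
    assume "?R p"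
    then obtain V a b where V: "openin (subscheme_space I) V \<and> p \<in> V \<and> V \<subseteq> U"
      "\<forall>q\<in>V. is_frac q a b \<and> s q = frac I q a b"
      by blast
    then obtain d where "homogeneous d a \<and> homogeneous d b"
      by (auto simp: is_frac_def)
    then have "openin (subscheme_space I) V \<and> p \<in> V \<and> V \<subseteq> U \<and> homogeneous d a \<and> homogeneous d b \<and>
        (\<forall>q\<in>V. b \<notin> q \<and> s q = frac I q a b)"
      using V by (auto simp: is_frac_def)
    then show "\<exists>V a b d. openin (subscheme_space I) V \<and> p \<in> V \<and> V \<subseteq> U \<and> homogeneous d a \<and> homogeneous d b \<and>
      (\<forall>q\<in>V. b \<notin> q \<and> s q = frac I q a b)"
      by blast
  qed
  then show ?thesis
    by (simp add: sections_def)
qed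

context veronese
begin

lemma zero_locus_zero: "zero_locus {0 :: (2, 'k) mpoly} = proj_space"
  using ideal_0[OF prime_ideal[OF proj_space_prime]] by (auto simp: zero_locus_def)

lemma expand_in: "p \<in> zero_locus kernel \<Longrightarrow> expand p \<in> zero_locus {0}"
  by (simp add: zero_locus_zero expand_proj)

text \<open>This is continuity of \<open>expand\<close>. All lifts of the same square differ by
  kernel elements, so one of them lies in p exactly if all do, which makes the existential condition
  defining \<open>expand\<close> a closed condition on p.\<close>

lemma expand_zero_locus_iff:
  assumes p: "p \<in> zero_locus kernel"
  shows "expand p \<in> zero_locus H \<longleftrightarrow> p \<in> zero_locus {a. \<exists>h\<in>H. \<exists>d. \<nu> a = (hcomponent d h)\<^sup>2}"
proof -
  have "(\<exists>a\<in>p. \<nu> a = (hcomponent d h)\<^sup>2) \<longleftrightarrow> (\<forall>a. \<nu> a = (hcomponent d h)\<^sup>2 \<longrightarrow> a \<in> p)" for d h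
  proof -
    obtain g where "\<nu> g = (hcomponent d h)\<^sup>2"
      using lift_square[OF homogeneous_hcomponent, of d h] by blast
    then show ?thesis
      using nu_eq[OF p] by metis
  qed
  then have "H \<subseteq> expand p \<longleftrightarrow> {a. \<exists>h\<in>H. \<exists>d. \<nu> a = (hcomponent d h)\<^sup>2} \<subseteq> p"
    unfolding expand_def by blast
  then show ?thesis
    using p expand_proj[OF p] by (simp add: zero_locus_iff)
qed

lemma comap_zero_locus_iff:
  "q \<in> proj_space \<Longrightarrow> comap q \<in> zero_locus G \<longleftrightarrow> q \<in> zero_locus (\<nu> ` G)"
  using comap_proj[of q] by (auto simp: zero_locus_iff comap_def)

definition preimage :: "(2, 'k) mpoly set set \<Rightarrow> ('v, 'k) mpoly set set" where
  "preimage V = {p \<in> zero_locus kernel. expand p \<in> V}"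

lemma openin_preimage:
  assumes "openin (subscheme_space {0}) V"
  shows "openin (subscheme_space kernel) (preimage V)"
proof -
  obtain H where H: "V = zero_locus {0} - zero_locus H"
    using assms by (auto simp: openin_subscheme)
  have "preimage V = zero_locus kernel - zero_locus {a. \<exists>h\<in>H. \<exists>d. \<nu> a = (hcomponent d h)\<^sup>2}"
    unfolding preimage_def H using expand_in expand_zero_locus_iff by auto
  then show ?thesis
    unfolding openin_subscheme by blast
qed

lemma openin_comap_preimage:
  assumes "openin (subscheme_space kernel) U"
  shows "openin (subscheme_space {0}) {q \<in> zero_locus {0}. comap q \<in> U}"
proof -
  obtain G where G: "U = zero_locus kernel - zero_locus G"
    using assms by (auto simp: openin_subscheme)
  have "{q \<in> zero_locus {0}. comap q \<in> U} = zero_locus {0} - zero_locus (\<nu> ` G)"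
    unfolding G using comap_proj comap_zero_locus_iff by (auto simp: zero_locus_zero)
  then show ?thesis
    unfolding openin_subscheme by blast
qed

lemma homeomorphic_map_expand: "homeomorphic_map (subscheme_space kernel) (subscheme_space {0}) expand"
proof -
  have "homeomorphic_maps (subscheme_space kernel) (subscheme_space {0}) expand comap"
    unfolding homeomorphic_maps_def continuous_map topspace_subscheme
    using expand_in comap_proj openin_preimage openin_comap_preimage comap_expand expand_comap
    by (auto simp: preimage_def zero_locus_zero)
  then show ?thesis
    using homeomorphic_maps_map by blast
qed

text \<open>Keeps the representatives that are defined on the conic: those pairs whose images under
  \<nu> represent the given fraction on P^1.\<close>

definition pull :: "((2, 'k) mpoly \<times> (2, 'k) mpoly) set \<Rightarrow> (('v, 'k) mpoly \<times> ('v, 'k) mpoly) set" where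
  "pull X = {(c, e). (\<exists>d. homogeneous d c \<and> homogeneous d e) \<and> (\<nu> c, \<nu> e) \<in> X}"

text \<open>The way back goes through cross multiplication, because a fraction on P^1 also has
  representatives of odd degree, which are not images under \<nu>.\<close>

definition push :: "(2, 'k) mpoly set \<Rightarrow> (('v, 'k) mpoly \<times> ('v, 'k) mpoly) set \<Rightarrow>
    ((2, 'k) mpoly \<times> (2, 'k) mpoly) set" where
  "push q X = {(c, e). is_frac q c e \<and> (\<exists>(a, b)\<in>X. \<nu> a * e = c * \<nu> b)}"

lemma is_ideal_kernel: "is_ideal kernel"
  using kernel_proj by (simp add: prime_ideal proj_space_prime)

context
  fixes q :: "(2, 'k) mpoly set"
  assumes q: "q \<in> proj_space"
begin

lemma denominator_nonzero: "denominator q t \<Longrightarrow> t \<noteq> 0"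
  using ideal_0[OF prime_ideal[OF proj_space_prime[OF q]]] by (auto simp: denominator_def)

lemma frac_zero_iff: "(c, e) \<in> frac {0} q a b \<longleftrightarrow> is_frac q c e \<and> a * e = c * b"
  unfolding frac_iff using denominator_nonzero denominator_1[OF proj_space_prime[OF q]] by auto

lemma is_frac_nu: "is_frac (comap q) a b \<Longrightarrow> is_frac q (\<nu> a) (\<nu> b)"
  unfolding is_frac_def using homogeneous_nu by (auto simp: comap_iff)

lemma comap_prime: "homogeneous_prime (comap q)"
  using comap_proj[OF q] proj_space_prime by (auto simp: zero_locus_iff)

lemma frac_kernel_iff:
  "(c, e) \<in> frac kernel (comap q) a b \<longleftrightarrow> is_frac (comap q) c e \<and> \<nu> a * \<nu> e = \<nu> c * \<nu> b"
proof -
  have "\<nu> t \<noteq> 0" if "denominator (comap q) t" for t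
    using that ideal_0[OF prime_ideal[OF proj_space_prime[OF q]]] by (auto simp: denominator_def comap_iff)
  then show ?thesis
    unfolding frac_iff using denominator_1[OF comap_prime] by (auto simp: subst_simps)
qed

lemma pull_frac: "pull (frac {0} q (\<nu> a) (\<nu> b)) = frac kernel (comap q) a b"
proof -
  have "is_frac (comap q) c e \<longleftrightarrow> (\<exists>d. homogeneous d c \<and> homogeneous d e) \<and> is_frac q (\<nu> c) (\<nu> e)" for c e
    unfolding is_frac_def using homogeneous_nu by (auto simp: comap_iff)
  then show ?thesis
    unfolding pull_def by (auto simp: frac_zero_iff frac_kernel_iff)
qed

lemma push_frac:
  assumes ab: "is_frac (comap q) a b"
  shows "push q (frac kernel (comap q) a b) = frac {0} q (\<nu> a) (\<nu> b)"
proof -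
  have "(\<exists>(a', b')\<in>frac kernel (comap q) a b. \<nu> a' * e = c * \<nu> b') \<longleftrightarrow> \<nu> a * e = c * \<nu> b" for c e
  proof
    assume "\<exists>(a', b')\<in>frac kernel (comap q) a b. \<nu> a' * e = c * \<nu> b'"
    then obtain a' b' where *: "is_frac (comap q) a' b'" "\<nu> a * \<nu> b' = \<nu> a' * \<nu> b" "\<nu> a' * e = c * \<nu> b'"
      by (auto simp: frac_kernel_iff)
    have "\<nu> b' * (\<nu> a * e) = (\<nu> a * \<nu> b') * e"
      by (simp add: ac_simps)
    also have "\<dots> = \<nu> b * (\<nu> a' * e)"
      unfolding *(2) by (simp add: ac_simps)
    also have "\<dots> = \<nu> b' * (c * \<nu> b)"
      unfolding *(3) by (simp add: ac_simps)
    finally show "\<nu> a * e = c * \<nu> b"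
      using denominator_nonzero[OF is_frac_denominator[OF is_frac_nu[OF *(1)]]] by simp
  next
    assume "\<nu> a * e = c * \<nu> b"
    then show "\<exists>(a', b')\<in>frac kernel (comap q) a b. \<nu> a' * e = c * \<nu> b'"
      using frac_same[OF is_ideal_kernel comap_prime ab] by blast
  qed
  then show ?thesis
    unfolding push_def by (auto simp: frac_zero_iff)
qed

text \<open>Writing a / b as (a * b) / (b * b) makes numerator and denominator of even degree, hence
  liftable.\<close>

lemma frac_even:
  assumes a: "\<nu> a' = a * b" and b: "\<nu> b' = b * b" and "is_frac q a b" "homogeneous d a'" "homogeneous d b'"
  shows "is_frac (comap q) a' b'" and "frac {0} q a b = frac {0} q (\<nu> a') (\<nu> b')"
proof -
  have p: "homogeneous_prime q"
    using q by (rule proj_space_prime)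
  have "b * b \<notin> q"
    using assms(3) prime_mult[OF p] by (auto simp: is_frac_def)
  then show *: "is_frac (comap q) a' b'"
    using assms unfolding is_frac_def by (auto simp: comap_iff)
  have "(\<nu> a', \<nu> b') \<in> frac {0} q a b"
    using is_frac_nu[OF *] by (simp add: frac_zero_iff a b ac_simps)
  then show "frac {0} q a b = frac {0} q (\<nu> a') (\<nu> b')"
    using frac_eq[OF is_ideal_zero p assms(3)] by simp
qed

end

definition pullback :: "(2, 'k) mpoly set set \<Rightarrow>
    ((2, 'k) mpoly set \<Rightarrow> ((2, 'k) mpoly \<times> (2, 'k) mpoly) set) \<Rightarrow>
    ('v, 'k) mpoly set \<Rightarrow> (('v, 'k) mpoly \<times> ('v, 'k) mpoly) set" where
  "pullback V s = (\<lambda>p\<in>preimage V. pull (s (expand p)))"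

text \<open>The lifts of a * b and b * b do not depend on the point, so a single lifted fraction
  represents the section on a whole neighbourhood.\<close>

lemma sections_local:
  assumes "s \<in> carrier (sections {0} V)" "q \<in> V"
  obtains W a b where "openin (subscheme_space {0}) W" "q \<in> W" "W \<subseteq> V"
    "\<And>q'. q' \<in> W \<Longrightarrow> q' \<in> proj_space \<and> is_frac (comap q') a b \<and> s q' = frac {0} q' (\<nu> a) (\<nu> b)"
proof -
  obtain W a b where W: "openin (subscheme_space {0}) W" "q \<in> W" "W \<subseteq> V"
    and ab: "\<And>q'. q' \<in> W \<Longrightarrow> is_frac q' a b \<and> s q' = frac {0} q' a b"
    using assms unfolding carrier_sections by meson
  have proj: "q' \<in> proj_space" if "q' \<in> W" for q'
    using openin_subset[OF W(1)] that by (auto simp: topspace_subscheme zero_locus_zero)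
  obtain d where d: "homogeneous d a" "homogeneous d b"
    using ab[OF W(2)] by (auto simp: is_frac_def)
  obtain a' b' where a': "homogeneous d a'" "\<nu> a' = a * b" and b': "homogeneous d b'" "\<nu> b' = b * b"
    using lift_prod[OF d] lift_prod[OF d(2) d(2)] by blast
  show thesis
  proof (rule that[OF W])
    fix q' assume q': "q' \<in> W"
    then show "q' \<in> proj_space \<and> is_frac (comap q') a' b' \<and> s q' = frac {0} q' (\<nu> a') (\<nu> b')"
      using frac_even[OF proj[OF q'] a'(2) b'(2) _ a'(1) b'(1)] ab[OF q'] proj[OF q'] by simp
  qed
qed

lemma section_value:
  assumes "s \<in> carrier (sections {0} V)" "q \<in> V"
  obtains a b where "q \<in> proj_space" "is_frac (comap q) a b" "s q = frac {0} q (\<nu> a) (\<nu> b)"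
  using sections_local[OF assms] by metis

lemma preimageD:
  assumes "p \<in> preimage V"
  shows "p \<in> zero_locus kernel" "expand p \<in> V" "comap (expand p) = p" "expand p \<in> proj_space"
  using assms comap_expand expand_proj by (auto simp: preimage_def)

lemma preimage_comap:
  assumes "openin (subscheme_space {0}) V" "q \<in> V"
  shows "q \<in> proj_space" "comap q \<in> preimage V" "expand (comap q) = q"
proof -
  show q: "q \<in> proj_space"
    using openin_subset[OF assms(1)] assms(2) by (auto simp: topspace_subscheme zero_locus_zero)
  then show "expand (comap q) = q"
    by (rule expand_comap)
  then show "comap q \<in> preimage V"
    using comap_proj[OF q] assms(2) by (simp add: preimage_def)
qed

lemma pullback_carrier:
  assumes s: "s \<in> carrier (sections {0} V)"
  shows "pullback V s \<in> carrier (sections kernel (preimage V))"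
  unfolding carrier_sections
proof (intro conjI ballI)
  fix p assume p: "p \<in> preimage V"
  obtain W a b where W: "openin (subscheme_space {0}) W" "expand p \<in> W" "W \<subseteq> V"
    and ab: "\<And>q'. q' \<in> W \<Longrightarrow> q' \<in> proj_space \<and> is_frac (comap q') a b \<and> s q' = frac {0} q' (\<nu> a) (\<nu> b)"
    using sections_local[OF s preimageD(2)[OF p]] by metis
  have sub: "preimage W \<subseteq> preimage V"
    using W(3) by (auto simp: preimage_def)
  have "is_frac p' a b \<and> pullback V s p' = frac kernel p' a b" if p': "p' \<in> preimage W" for p'
  proof -
    have "pullback V s p' = pull (s (expand p'))"
      using p' sub by (auto simp: pullback_def)
    then show ?thesis
      using ab[OF preimageD(2)[OF p']] pull_frac[of "expand p'" a b] preimageD(3)[OF p'] by simp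
  qed
  moreover have "p \<in> preimage W"
    using p W(2) by (simp add: preimage_def)
  ultimately show "\<exists>U a b. openin (subscheme_space kernel) U \<and> p \<in> U \<and> U \<subseteq> preimage V \<and>
      (\<forall>p'\<in>U. is_frac p' a b \<and> pullback V s p' = frac kernel p' a b)"
    using openin_preimage[OF W(1)] sub by blast
qed (simp add: pullback_def)

lemma pullback_hom:
  "pullback V \<in> Ring.ring_hom (sections {0} V) (sections kernel (preimage V))"
proof (rule ring_hom_memI)
  fix s t assume s: "s \<in> carrier (sections {0} V)" and t: "t \<in> carrier (sections {0} V)"
  have stalk: "pull (s (expand p) \<otimes>\<^bsub>local_ring {0} (expand p)\<^esub> t (expand p))
        = pull (s (expand p)) \<otimes>\<^bsub>local_ring kernel p\<^esub> pull (t (expand p))"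
      "pull (s (expand p) \<oplus>\<^bsub>local_ring {0} (expand p)\<^esub> t (expand p))
        = pull (s (expand p)) \<oplus>\<^bsub>local_ring kernel p\<^esub> pull (t (expand p))"
    if p: "p \<in> preimage V" for p
  proof -
    let ?q = "expand p"
    obtain a b where q: "?q \<in> proj_space" and ab: "is_frac p a b" "s ?q = frac {0} ?q (\<nu> a) (\<nu> b)"
      using section_value[OF s preimageD(2)[OF p]] preimageD(3)[OF p] by metis
    obtain c e where ce: "is_frac p c e" "t ?q = frac {0} ?q (\<nu> c) (\<nu> e)"
      using section_value[OF t preimageD(2)[OF p]] preimageD(3)[OF p] by metis
    have prime: "homogeneous_prime ?q" "homogeneous_prime p"
      using q comap_prime[OF q] preimageD(3)[OF p] by (auto simp: proj_space_prime)
    have pull: "pull (frac {0} ?q (\<nu> x) (\<nu> y)) = frac kernel p x y" for x y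
      using pull_frac[OF q, of x y] preimageD(3)[OF p] by simp
    have nu: "is_frac ?q (\<nu> a) (\<nu> b)" "is_frac ?q (\<nu> c) (\<nu> e)"
      using ab ce is_frac_nu[OF q] preimageD(3)[OF p] by auto
    show "pull (s ?q \<otimes>\<^bsub>local_ring {0} ?q\<^esub> t ?q) = pull (s ?q) \<otimes>\<^bsub>local_ring kernel p\<^esub> pull (t ?q)"
      using pull[of "a * c" "b * e"]
      by (simp add: ab ce pull local_ring_mult[OF is_ideal_zero prime(1) nu]
          local_ring_mult[OF is_ideal_kernel prime(2) ab(1) ce(1)] subst_mult)
    show "pull (s ?q \<oplus>\<^bsub>local_ring {0} ?q\<^esub> t ?q) = pull (s ?q) \<oplus>\<^bsub>local_ring kernel p\<^esub> pull (t ?q)"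
      using pull[of "a * e + c * b" "b * e"]
      by (simp add: ab ce pull local_ring_add[OF is_ideal_zero prime(1) nu]
          local_ring_add[OF is_ideal_kernel prime(2) ab(1) ce(1)] subst_mult subst_add)
  qed
  show "pullback V s \<in> carrier (sections kernel (preimage V))"
    using s by (rule pullback_carrier)
  show "pullback V (s \<otimes>\<^bsub>sections {0} V\<^esub> t)
      = pullback V s \<otimes>\<^bsub>sections kernel (preimage V)\<^esub> pullback V t"
    using stalk(1) by (auto simp: pullback_def sections_def fun_eq_iff preimageD(2))
  show "pullback V (s \<oplus>\<^bsub>sections {0} V\<^esub> t)
      = pullback V s \<oplus>\<^bsub>sections kernel (preimage V)\<^esub> pullback V t"
    using stalk(2) by (auto simp: pullback_def sections_def fun_eq_iff preimageD(2))
next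
  have "pull (frac {0} (expand p) 1 1) = frac kernel p 1 1" if "p \<in> preimage V" for p
    using pull_frac[OF preimageD(4)[OF that], of 1 1] preimageD(3)[OF that] by simp
  then show "pullback V \<one>\<^bsub>sections {0} V\<^esub> = \<one>\<^bsub>sections kernel (preimage V)\<^esub>"
    by (auto simp: pullback_def sections_def fun_eq_iff local_ring_one preimageD(2))
qed

lemma push_pullback:
  assumes V: "openin (subscheme_space {0}) V" and s: "s \<in> carrier (sections {0} V)" and q: "q \<in> V"
  shows "push q (pullback V s (comap q)) = s q"
proof -
  obtain a b where ab: "is_frac (comap q) a b" "s q = frac {0} q (\<nu> a) (\<nu> b)"
    using section_value[OF s q] by metis
  have "pullback V s (comap q) = frac kernel (comap q) a b"
    using preimage_comap[OF V q] ab pull_frac[of q a b] by (simp add: pullback_def)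
  then show ?thesis
    using push_frac[OF preimage_comap(1)[OF V q] ab(1)] ab(2) by simp
qed

text \<open>The preimage of t is formed stalk by stalk with \<open>push\<close>; it is again locally
  a fraction because the images under \<nu> of a local numerator and denominator of t represent it
  on the corresponding open set.\<close>

lemma pullback_surj:
  assumes V: "openin (subscheme_space {0}) V" and t: "t \<in> carrier (sections kernel (preimage V))"
  shows "t \<in> pullback V ` carrier (sections {0} V)"
proof
  let ?s = "\<lambda>q\<in>V. push q (t (comap q))"
  show "?s \<in> carrier (sections {0} V)"
    unfolding carrier_sections
  proof (intro conjI ballI)
    fix q assume q: "q \<in> V"
    obtain U a b where U: "openin (subscheme_space kernel) U" "comap q \<in> U" "U \<subseteq> preimage V"
      and ab: "\<And>p. p \<in> U \<Longrightarrow> is_frac p a b \<and> t p = frac kernel p a b"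
      using t preimage_comap(2)[OF V q] unfolding carrier_sections by meson
    let ?W = "{q \<in> zero_locus {0}. comap q \<in> U}"
    have W: "q' \<in> proj_space \<and> q' \<in> V" if q': "q' \<in> ?W" for q'
    proof -
      have proj: "q' \<in> proj_space"
        using q' by (simp add: zero_locus_zero)
      have "comap q' \<in> preimage V"
        using q' U(3) by blast
      then show ?thesis
        using preimageD(2)[of "comap q'" V] expand_comap[OF proj] proj by simp
    qed
    have "is_frac q' (\<nu> a) (\<nu> b) \<and> ?s q' = frac {0} q' (\<nu> a) (\<nu> b)" if q': "q' \<in> ?W" for q'
      using is_frac_nu push_frac[of q' a b] W[OF q'] ab[of "comap q'"] q' by simp
    moreover have "q \<in> ?W"
      using preimage_comap(1)[OF V q] U(2) by (simp add: zero_locus_zero)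
    ultimately show "\<exists>W a b. openin (subscheme_space {0}) W \<and> q \<in> W \<and> W \<subseteq> V \<and>
        (\<forall>q'\<in>W. is_frac q' a b \<and> ?s q' = frac {0} q' a b)"
      using openin_comap_preimage[OF U(1)] W by blast
  qed simp
  show "t = pullback V ?s"
  proof
    fix p
    show "t p = pullback V ?s p"
    proof (cases "p \<in> preimage V")
      case True
      note p = preimageD[OF True]
      obtain a b where ab: "is_frac p a b" "t p = frac kernel p a b"
        using t True unfolding carrier_sections by meson
      then have "pull (push (expand p) (t p)) = t p"
        using push_frac[OF p(4), of a b] pull_frac[OF p(4), of a b] p(3) by simp
      then show ?thesis
        using True p by (simp add: pullback_def)
    next
      case False
      then show ?thesis
        using t by (simp add: pullback_def carrier_sections extensional_def)
    qed
  qed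
qed

lemma pullback_iso:
  assumes V: "openin (subscheme_space {0}) V"
  shows "pullback V \<in> ring_iso (sections {0} V) (sections kernel (preimage V))"
proof -
  have "inj_on (pullback V) (carrier (sections {0} V))"
  proof
    fix s t assume s: "s \<in> carrier (sections {0} V)" and t: "t \<in> carrier (sections {0} V)"
      and eq: "pullback V s = pullback V t"
    show "s = t"
    proof (rule extensionalityI)
      show "s \<in> extensional V" "t \<in> extensional V"
        using s t by (simp_all add: carrier_sections)
      show "s q = t q" if "q \<in> V" for q
        using push_pullback[OF V s that] push_pullback[OF V t that] eq by simp
    qed
  qed
  then have "bij_betw (pullback V) (carrier (sections {0} V)) (carrier (sections kernel (preimage V)))"
    using pullback_carrier pullback_surj[OF V] by (auto simp: bij_betw_def)
  then show ?thesis
    using pullback_hom by (simp add: ring_iso_def)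
qed

theorem isomorphic_projective_line: "isomorphic_schemes kernel {0 :: (2, 'k) mpoly}"
  unfolding isomorphic_schemes_def
proof (intro exI[of _ expand] exI[of _ pullback] conjI allI impI)
  show "homeomorphic_map (subscheme_space kernel) (subscheme_space {0}) expand"
    by (rule homeomorphic_map_expand)
  fix V :: "(2, 'k) mpoly set set"
  assume V: "openin (subscheme_space {0}) V"
  have "pullback V (\<lambda>q\<in>V. frac {0} q (Const c) 1) = (\<lambda>p\<in>preimage V. frac kernel p (Const c) 1)" for c
  proof -
    have "pull (frac {0} (expand p) (Const c) 1) = frac kernel p (Const c) 1" if "p \<in> preimage V" for p
      using pull_frac[OF preimageD(4)[OF that], of "Const c" 1] preimageD(3)[OF that] by simp
    then show ?thesis
      by (auto simp: pullback_def fun_eq_iff preimageD(2))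
  qed
  moreover have "pullback W (restrict s W) = restrict (pullback V s) (preimage W)" if "W \<subseteq> V" for W s
    using that by (auto simp: pullback_def fun_eq_iff preimage_def)
  ultimately show "let U = {p \<in> zero_locus kernel. expand p \<in> V} in
      pullback V \<in> ring_iso (sections {0} V) (sections kernel U) \<and>
      (\<forall>c. pullback V (\<lambda>q\<in>V. frac {0} q (Const c) 1) = (\<lambda>p\<in>U. frac kernel p (Const c) 1)) \<and>
      (\<forall>W s. openin (subscheme_space {0}) W \<and> W \<subseteq> V \<and> s \<in> carrier (sections {0} V) \<longrightarrow>
         pullback W (restrict s W) = restrict (pullback V s) {p \<in> zero_locus kernel. expand p \<in> W})"
    using pullback_iso[OF V] unfolding preimage_def[symmetric] Let_def by blast
qed

end

section \<open>Binary forms split into linear factors, so P^1 has dimension one\<close>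

section \<open>Dimension of the projective line\<close>

lemma subst_cong_ideal:
  assumes J: "is_ideal J" and "\<And>v. \<sigma> v - \<tau> v \<in> J"
  shows "subst \<sigma> p - subst \<tau> p \<in> J"
proof (induction p rule: mpoly_induct)
  case (add p q)
  then show ?case
    using ideal_add[OF J, of "subst \<sigma> p - subst \<tau> p" "subst \<sigma> q - subst \<tau> q"]
    by (simp add: subst_add algebra_simps)
next
  case (Var p v)
  have "subst \<sigma> (p * Var v) - subst \<tau> (p * Var v) = \<sigma> v * (subst \<sigma> p - subst \<tau> p) + subst \<tau> p * (\<sigma> v - \<tau> v)"
    by (simp add: subst_mult algebra_simps)
  also have "\<dots> \<in> J"
    using Var assms(2) by (intro ideal_add[OF J] ideal_mult[OF J])
  finally show ?case .
qed (simp add: ideal_0[OF J])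

lemma subst_Var_id: "subst Var p = p"
  by (induction p rule: mpoly_induct) (simp_all add: subst_add subst_mult)

lemma subst_scaled:
  assumes "homogeneous d p"
  shows "subst (\<lambda>v. c * \<sigma> v) p = c ^ d * subst \<sigma> p"
proof -
  have "mono_subst (\<lambda>v. c * \<sigma> v) m = c ^ mdeg m * mono_subst \<sigma> m" for m
    by (simp add: mono_subst_def power_mult_distrib prod.distrib mdeg_def power_sum)
  then show ?thesis
    using assms unfolding subst_def mono_subst_def[symmetric] sum_distrib_left
    by (intro sum.cong) (auto simp: homogeneous_def)
qed

lemma subst_constants: "\<exists>e. subst (\<lambda>v. Const (k v)) p = Const e"
proof (induction p rule: mpoly_induct)
  case (add p q)
  then show ?case by (metis Const_add subst_add)
next
  case (Var p v)
  then show ?case by (metis Const_mult subst_mult subst_Var)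
qed auto

lemma subst_collinear:
  fixes w :: "('w, 'k::comm_ring_1) mpoly"
  assumes "homogeneous d p"
  shows "\<exists>e. subst (\<lambda>v. Const (k v) * w) p = Const e * w ^ d"
proof -
  obtain e where "subst (\<lambda>v. Const (k v)) p = (Const e :: ('w, 'k) mpoly)"
    using subst_constants by blast
  then show ?thesis
    using subst_scaled[OF assms, of w "\<lambda>v. Const (k v)"]
    by (intro exI[of _ e]) (simp add: mult.commute)
qed

text \<open>The binary form of degree d whose value at \<open>Var 2\<close> = 1 is g, provided g has
  degree at most d. If g has smaller degree, the surplus becomes a power of
  \<open>Var 2\<close>.\<close>

definition homogenize :: "nat \<Rightarrow> 'k::comm_ring_1 poly \<Rightarrow> (2, 'k) mpoly" where
  "homogenize d g = (\<Sum>i\<le>d. Const (coeff g i) * Var 1 ^ i * Var 2 ^ (d - i))"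

lemma homogenize_add: "homogenize d (g + h) = homogenize d g + homogenize d h"
  by (simp add: homogenize_def Const_add algebra_simps sum.distrib)

lemma homogenize_smult: "homogenize d (Polynomial.smult c g) = Const c * homogenize d g"
  by (simp add: homogenize_def Const_mult sum_distrib_left mult.assoc)

lemma homogenize_pCons: "homogenize (Suc d) (pCons 0 g) = Var 1 * homogenize d g"
  by (simp add: homogenize_def sum.atMost_Suc_shift sum_distrib_left ac_simps del: sum.atMost_Suc)

lemma homogenize_Suc:
  assumes "degree g \<le> d"
  shows "homogenize (Suc d) g = Var 2 * homogenize d g"
proof -
  have "coeff g (Suc d) = 0"
    using assms by (intro coeff_eq_0) simp
  moreover have "(\<Sum>i\<le>d. Const (coeff g i) * Var 1 ^ i * Var 2 ^ (Suc d - i))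
      = (\<Sum>i\<le>d. Var 2 * (Const (coeff g i) * Var 1 ^ i * Var 2 ^ (d - i)) :: (2, 'a) mpoly)"
    by (intro sum.cong) (auto simp: Suc_diff_le ac_simps)
  ultimately show ?thesis
    by (simp add: homogenize_def sum_distrib_left)
qed

lemma homogenize_linear_factor:
  assumes "degree g \<le> d"
  shows "homogenize (Suc d) ([:- r, 1:] * g) = (Var 1 - Const r * Var 2) * homogenize d g"
proof -
  have "[:- r, 1:] * g = Polynomial.smult (- r) g + pCons 0 g"
    by simp
  then show ?thesis
    by (simp only: homogenize_add homogenize_smult homogenize_pCons homogenize_Suc[OF assms])
      (simp add: Const_uminus algebra_simps)
qed

lemma homogenize_const: "homogenize d [:c:] = Const c * Var 2 ^ d"
proof -
  have "(\<Sum>i\<le>d. Const (coeff [:c:] i) * Var 1 ^ i * Var 2 ^ (d - i))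
      = (\<Sum>i\<le>d. if i = 0 then Const c * Var 2 ^ d else 0 :: (2, 'a) mpoly)"
    by (intro sum.cong) (auto simp: coeff_pCons split: nat.split)
  then show ?thesis
    by (simp add: homogenize_def)
qed

lemma homogenize_exists:
  fixes b :: "(2, 'k::comm_ring_1) mpoly"
  assumes "homogeneous d b"
  shows "\<exists>g. degree g \<le> d \<and> b = homogenize d g"
proof -
  let ?P = "\<lambda>b :: (2, 'k) mpoly. \<exists>g. degree g \<le> d \<and> b = homogenize d g"
  have single: "?P (Poly_Mapping.single m c)" if m: "mdeg m = d" for m c
  proof -
    let ?i = "Poly_Mapping.lookup m 1"
    have d: "?i + Poly_Mapping.lookup m 2 = d"
      using m mdeg_superset[OF finite_class.finite_UNIV subset_UNIV, of m] by (simp add: UNIV_2)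
    have "m = Poly_Mapping.single 1 ?i + Poly_Mapping.single 2 (d - ?i)"
    proof (rule poly_mapping_eqI)
      fix v :: 2
      show "Poly_Mapping.lookup m v =
          Poly_Mapping.lookup (Poly_Mapping.single 1 ?i + Poly_Mapping.single 2 (d - ?i)) v"
        using exhaust_2[of v] d by (auto simp: lookup_add lookup_single)
    qed
    moreover have pow: "Var v ^ n = Poly_Mapping.single (Poly_Mapping.single v n) (1 :: 'k)" for v :: 2 and n
      by (induction n) (simp_all add: Var_def mult_single flip: single_add)
    ultimately have eq: "Const c * Var 1 ^ ?i * Var 2 ^ (d - ?i) = Poly_Mapping.single m c"
      by (simp add: pow Const_def mult_single)
    have "homogenize d (monom c ?i) = (\<Sum>j\<le>d. if j = ?i then Const c * Var 1 ^ ?i * Var 2 ^ (d - ?i) else 0)"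
      unfolding homogenize_def by (intro sum.cong) auto
    also have "\<dots> = Poly_Mapping.single m c"
      using d by (simp add: eq)
    finally show ?thesis
      using d by (intro exI[of _ "monom c ?i"]) (auto intro: order.trans[OF degree_monom_le])
  qed
  have sum: "?P (\<Sum>m\<in>S. Poly_Mapping.single m (Poly_Mapping.lookup b m))"
    if "finite S" "S \<subseteq> Poly_Mapping.keys b" for S
    using that
  proof (induction S)
    case empty
    show ?case
      by (intro exI[of _ 0]) (simp add: homogenize_def)
  next
    case (insert m S)
    then obtain g where g: "degree g \<le> d" "(\<Sum>m\<in>S. Poly_Mapping.single m (Poly_Mapping.lookup b m)) = homogenize d g"
      by auto
    have "mdeg m = d"
      using insert.prems assms by (auto simp: homogeneous_def)
    then obtain h where h: "degree h \<le> d" "Poly_Mapping.single m (Poly_Mapping.lookup b m) = homogenize d h"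
      using single by blast
    show ?case
      using insert.hyps g h by (intro exI[of _ "h + g"]) (simp add: homogenize_add degree_add_le)
  qed
  show ?thesis
    using sum[OF finite_keys subset_refl] mpoly_sum_single[of b] by simp
qed

text \<open>Split g into linear factors over the algebraically closed field. The prime q contains
  one of the homogenised factors or the power of \<open>Var 2\<close> that remains for the constant
  polynomial.\<close>

lemma linear_form_in_prime:
  fixes q :: "(2, 'k::alg_closed_field) mpoly set"
  assumes q: "homogeneous_prime q" and "g \<noteq> 0" "degree g \<le> d" "homogenize d g \<in> q"
  shows "Var 2 \<in> q \<or> (\<exists>r. Var 1 - Const r * Var 2 \<in> q)"
  using assms(2-)
proof (induction "degree g" arbitrary: g d)
  case 0
  then obtain c where c: "g = [:c:]"
    using degree_eq_zeroE by metis
  then have "Var 2 ^ d \<in> q"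
    using 0 prime_mult[OF q, of "Const c" "Var 2 ^ d"] prime_Const[OF q, of c] by (auto simp: homogenize_const)
  then show ?case
    using prime_power[OF q] by blast
next
  case (Suc n)
  obtain r where "poly g r = 0"
    using alg_closed_imp_poly_has_root[of g] Suc.hyps(2) by auto
  then obtain h where h: "g = [:- r, 1:] * h"
    by (auto simp: poly_eq_0_iff_dvd)
  then have "h \<noteq> 0" using Suc.prems by auto
  then have n: "degree h = n"
    using Suc.hyps(2) by (simp add: h degree_mult_eq del: mult_pCons_left)
  obtain e where d: "d = Suc e"
    using Suc.hyps(2) Suc.prems(2) by (cases d) auto
  have "degree h \<le> e"
    using n Suc.hyps(2) Suc.prems(2) d by simp
  then have "(Var 1 - Const r * Var 2) * homogenize e h \<in> q"
    using Suc.prems(3) homogenize_linear_factor[of h e r] by (simp add: h d del: mult_pCons_left)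
  then show ?case
    using prime_mult[OF q] Suc.hyps(1)[of h e] n \<open>h \<noteq> 0\<close> \<open>degree h \<le> e\<close> by blast
qed

text \<open>A nonzero homogeneous prime contains a nonzero linear form. Modulo that form everything
  depends on one variable w, so a form of degree e is a multiple c * w^e. If c were nonzero for a
  form in r, then w and with it all variables would lie in r.\<close>

lemma nonzero_prime_maximal:
  fixes q r :: "(2, 'k::alg_closed_field) mpoly set"
  assumes q: "q \<in> proj_space" and r: "r \<in> proj_space" and qr: "q \<subseteq> r" and "q \<noteq> {0}"
  shows "q = r"
proof -
  have Q: "homogeneous_prime q" and R: "homogeneous_prime r"
    using q r by (auto simp: proj_space_prime)
  obtain b where b: "b \<in> q" "b \<noteq> 0"
    using \<open>q \<noteq> {0}\<close> ideal_0[OF prime_ideal[OF Q]] by auto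
  obtain n where "b = (\<Sum>d<n. hcomponent d b)"
    using sum_hcomponent by blast
  then obtain d where d: "hcomponent d b \<noteq> 0"
    using b(2) by (metis sum.neutral)
  obtain g where g: "degree g \<le> d" "hcomponent d b = homogenize d g"
    using homogenize_exists[OF homogeneous_hcomponent, of d b] by blast
  have "g \<noteq> 0"
    using d g by (auto simp: homogenize_def)
  moreover have "homogenize d g \<in> q"
    using prime_hcomponent[OF Q b(1), of d] g by simp
  ultimately have "Var 2 \<in> q \<or> (\<exists>c. Var 1 - Const c * Var 2 \<in> q)"
    using linear_form_in_prime[OF Q _ g(1)] by blast
  \<comment> \<open>Here w is the variable that survives modulo the linear form, and k expresses
    both variables as multiples of it.\<close>
  then obtain k :: "2 \<Rightarrow> 'k" and w :: 2 where k: "\<And>v. Var v - Const (k v) * Var w \<in> q"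
  proof (elim disjE exE)
    assume *: "Var 2 \<in> q"
    have "Var v - Const (if v = 1 then 1 else 0) * Var 1 \<in> q" for v
      using * exhaust_2[of v] ideal_0[OF prime_ideal[OF Q]] by auto
    then show thesis by (rule that)
  next
    fix c assume *: "Var 1 - Const c * Var 2 \<in> q"
    have "Var v - Const (if v = 1 then c else 1) * Var 2 \<in> q" for v
      using * exhaust_2[of v] ideal_0[OF prime_ideal[OF Q]] by auto
    then show thesis by (rule that)
  qed
  have hom: "a \<in> q" if a: "homogeneous e a" "a \<in> r" for e a
  proof -
    obtain c where c: "subst (\<lambda>v. Const (k v) * Var w) a = Const c * Var w ^ e"
      using subst_collinear[OF a(1)] by blast
    have diff: "a - Const c * Var w ^ e \<in> q"
      using subst_cong_ideal[OF prime_ideal[OF Q], of Var "\<lambda>v. Const (k v) * Var w" a] k by (simp add: c subst_Var_id)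
    show ?thesis
    proof (cases "c = 0")
      case False
      have "Const c * Var w ^ e \<in> r"
        using ideal_congI[OF prime_ideal[OF R], of a] diff qr a(2) by blast
      then have w: "Var w \<in> r"
        using prime_mult[OF R] prime_Const[OF R, of c] prime_power[OF R] False by blast
      have "Var v \<in> r" for v
        using ideal_congI[OF prime_ideal[OF R], of "Var v" "Const (k v) * Var w"] k[of v] qr
          ideal_mult[OF prime_ideal[OF R] w] by blast
      then show ?thesis
        using r by (simp add: proj_space_def)
    qed (use diff in simp)
  qed
  have "a \<in> q" if "a \<in> r" for a
  proof -
    obtain n where n: "a = (\<Sum>d<n. hcomponent d a)"
      using sum_hcomponent by blast
    have "(\<Sum>d<n. hcomponent d a) \<in> q"
      by (intro ideal_sum[OF prime_ideal[OF Q]] hom[OF homogeneous_hcomponent] prime_hcomponent[OF R that])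
    then show ?thesis using n by simp
  qed
  then show ?thesis
    using qr by blast
qed

lemma nonzero_point: "\<exists>q :: (2, 'k::field) mpoly set. q \<in> proj_space \<and> q \<noteq> {0}"
proof -
  let ?\<tau> = "\<lambda>v. if v = 1 then 0 else Var v :: (2, 'k) mpoly"
  let ?q = "{b. subst ?\<tau> b = 0}"
  have hom: "homogeneous 1 (?\<tau> v)" for v
    by simp
  have "is_ideal ?q"
    using ideal_subst_vimage[OF is_ideal_zero] by simp
  moreover have "hcomponent d a \<in> ?q" if "a \<in> ?q" for a d
    using that hcomponent_subst[of 1 ?\<tau> d a] hom by simp
  ultimately have "homogeneous_prime ?q"
    unfolding homogeneous_prime_def by (simp add: subst_mult)
  moreover have "Var 2 \<notin> ?q" "Var 1 \<in> ?q"
    by simp_all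
  ultimately have "?q \<in> proj_space"
    unfolding proj_space_def by blast
  moreover have "A \<noteq> {0}" if "Var 1 \<in> A" for A :: "(2, 'k) mpoly set"
    using that Var_neq_0 by auto
  then have "?q \<noteq> {0}"
    using \<open>Var 1 \<in> ?q\<close> by simp
  ultimately show ?thesis by blast
qed

text \<open>The hypothesis \<open>max\<close> says that P^1 has no chain of three points;
  \<open>nonzero_prime_maximal\<close> supplies it over algebraically closed fields. A chain of
  three closed irreducible sets on the conic would expand to primes \<open>?q 2\<close> <
  \<open>?q 1\<close> < \<open>?q 0\<close>, with the middle one nonzero. The chain of length one
  consists of a point and the whole conic.\<close>

lemma (in veronese) krull_dimension_conic:
  assumes max: "\<And>q r :: (2, 'k) mpoly set. q \<in> proj_space \<Longrightarrow> r \<in> proj_space \<Longrightarrow> q \<subseteq> r \<Longrightarrow> q \<noteq> {0} \<Longrightarrow> q = r"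
  shows "krull_dimension (subscheme_space kernel) = 1"
proof (rule antisym)
  let ?X = "subscheme_space kernel"
  let ?chain = "\<lambda>n Z. (\<forall>i\<le>n. closedin ?X (Z i) \<and> irreducible_in ?X (Z i)) \<and> (\<forall>i<n. Z i \<subset> Z (Suc i))"
  have "n \<le> 1" if chain: "?chain n Z" for n :: nat and Z
  proof (rule ccontr)
    assume "\<not> n \<le> 1"
    define p where "p i = \<Inter>(Z i)" for i
    have p: "p i \<in> zero_locus kernel" "Z i = zero_locus (p i)" if "i \<le> 2" for i
      using generic_point[of kernel "Z i"] chain that \<open>\<not> n \<le> 1\<close> unfolding p_def by auto
    have strict: "p (Suc i) \<subset> p i" if "i < 2" for i
    proof -
      have "Z i \<subset> Z (Suc i)"
        using chain that \<open>\<not> n \<le> 1\<close> by auto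
      then have "zero_locus (p i) \<subset> zero_locus (p (Suc i))"
        using p[of i] p[of "Suc i"] that by simp
      then show ?thesis
        using p(1)[of i] p(1)[of "Suc i"] that zero_locus_subset_iff[of "p i" "p (Suc i)"]
        by (auto simp: zero_locus_iff)
    qed
    let ?q = "\<lambda>i. expand (p i)"
    have q: "?q i \<in> proj_space" if "i \<le> 2" for i
      using expand_proj p(1) that by blast
    have sub: "?q (Suc i) \<subset> ?q i" if "i < 2" for i
    proof -
      have "?q (Suc i) \<subseteq> ?q i"
        using strict[OF that] unfolding expand_def by blast
      moreover have "?q (Suc i) \<noteq> ?q i"
        using strict[OF that] comap_expand p(1)[of i] p(1)[of "Suc i"] that
        by (metis Suc_leI less_imp_le_nat psubset_eq)
      ultimately show ?thesis by blast
    qed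
    have "0 \<in> ?q 2"
      using ideal_0[OF prime_ideal[OF proj_space_prime[OF q]]] by simp
    then have "?q 1 \<noteq> {0}"
      using sub[of 1] by (auto simp: numeral_2_eq_2)
    then show False
      using max[of "?q 1" "?q 0"] q[of 1] q[of 0] sub[of 0] by (simp add: psubset_eq)
  qed
  then show "krull_dimension ?X \<le> 1"
    unfolding krull_dimension_def by (intro Sup_least) (auto simp: one_enat_def)
  obtain q :: "(2, 'k) mpoly set" where q: "q \<in> proj_space" "q \<noteq> {0}"
    using nonzero_point by blast
  let ?Z = "\<lambda>i::nat. if i = 0 then zero_locus (comap q) else zero_locus kernel"
  have kernel: "kernel \<in> zero_locus kernel"
    using kernel_proj by (simp add: zero_locus_iff)
  have closed: "closedin ?X (zero_locus p)" if "p \<in> zero_locus kernel" for p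
  proof -
    have "zero_locus p = zero_locus kernel \<inter> zero_locus p"
      using that unfolding zero_locus_def by blast
    then show ?thesis
      unfolding closedin_subscheme by (rule exI)
  qed
  have sub: "kernel \<subseteq> comap q"
    using comap_proj[OF q(1)] unfolding zero_locus_iff by blast
  have "\<not> comap q \<subseteq> kernel"
  proof
    assume "comap q \<subseteq> kernel"
    then have "comap q = kernel"
      using sub by (rule subset_antisym)
    then have "expand (comap q) = expand (comap {0})"
      by (simp only: comap_zero)
    then show False
      using q expand_comap[OF q(1)] expand_comap[OF zero_in_proj_space] by simp
  qed
  then have "zero_locus (comap q) \<subset> zero_locus kernel"
    using sub kernel unfolding zero_locus_def by blast
  then have "?chain 1 ?Z"
    using closed irreducible_zero_locus comap_proj[OF q(1)] kernel by auto
  then have chain: "\<exists>Z. ?chain 1 Z"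
    by (rule exI[of _ ?Z])
  show "1 \<le> krull_dimension ?X"
    unfolding krull_dimension_def one_enat_def
    by (intro Sup_upper CollectI exI[of _ 1] conjI refl chain)
qed

section \<open>Laplace expansion in blocks of two columns\<close>

section \<open>Expanding a determinant along pairs of columns\<close>

text \<open>The sum over all ways to take one entry out of a list, with sign (-1)^i for position i:
  the shape of a Laplace expansion along one column.\<close>

fun alt1 :: "('r \<Rightarrow> 'r list \<Rightarrow> 'a::comm_ring_1) \<Rightarrow> 'r list \<Rightarrow> 'a" where
  "alt1 G [] = 0"
| "alt1 G (x # xs) = G x xs - alt1 (\<lambda>y ys. G y (x # ys)) xs"

text \<open>The sum over all ways to take out two entries at positions i < j, with sign
  (-1)^(j-i-1), which is the sign of their complement in a Laplace expansion along the first two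
  columns.\<close>

fun alt2 :: "('r \<Rightarrow> 'r \<Rightarrow> 'r list \<Rightarrow> 'a::comm_ring_1) \<Rightarrow> 'r list \<Rightarrow> 'a" where
  "alt2 G [] = 0"
| "alt2 G (x # xs) = alt1 (G x) xs + alt2 (\<lambda>y z zs. G y z (x # zs)) xs"

text \<open>The Laplace expansion of a determinant whose columns are grouped into pairs:
  \<open>w b x y\<close> is the 2 x 2 minor of rows x, y in the pair b.\<close>

fun wedge :: "('b \<Rightarrow> 'r \<Rightarrow> 'r \<Rightarrow> 'a::comm_ring_1) \<Rightarrow> 'b list \<Rightarrow> 'r list \<Rightarrow> 'a" where
  "wedge w [] rs = 1"
| "wedge w (b # bs) rs = alt2 (\<lambda>x y zs. w b x y * wedge w bs zs) rs"

lemma alt1_add: "alt1 (\<lambda>x xs. G x xs + H x xs) rs = alt1 G rs + alt1 H rs"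
  by (induction rs arbitrary: G H) simp_all

lemma alt1_mult: "alt1 (\<lambda>x xs. c * G x xs) rs = c * alt1 G rs"
  by (induction rs arbitrary: G) (simp_all add: algebra_simps)

lemma alt1_uminus: "alt1 (\<lambda>x xs. - G x xs) rs = - alt1 G rs"
  by (induction rs arbitrary: G) simp_all

lemma alt1_cong:
  "(\<And>x xs. Suc (length xs) = length rs \<Longrightarrow> G x xs = H x xs) \<Longrightarrow> alt1 G rs = alt1 H rs"
proof (induction rs arbitrary: G H)
  case (Cons r rs)
  have "alt1 (\<lambda>y ys. G y (r # ys)) rs = alt1 (\<lambda>y ys. H y (r # ys)) rs"
    by (rule Cons.IH) (simp add: Cons.prems)
  then show ?case
    using Cons.prems by simp
qed simp

lemma alt2_cong:
  "(\<And>x y xs. length xs + 2 = length rs \<Longrightarrow> G x y xs = H x y xs) \<Longrightarrow> alt2 G rs = alt2 H rs"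
proof (induction rs arbitrary: G H)
  case (Cons r rs)
  have "alt1 (G r) rs = alt1 (H r) rs"
    by (rule alt1_cong) (simp add: Cons.prems)
  moreover have "alt2 (\<lambda>y z zs. G y z (r # zs)) rs = alt2 (\<lambda>y z zs. H y z (r # zs)) rs"
    by (rule Cons.IH) (simp add: Cons.prems)
  ultimately show ?case by simp
qed simp

text \<open>Taking out x and then y, or y and then x, leaves the same rows with opposite signs; the
  two terms combine into a 2 x 2 minor.\<close>

lemma alt1_alt1:
  "alt1 (\<lambda>x xs. a x * alt1 (\<lambda>y ys. b y * H ys) xs) rs = alt2 (\<lambda>x y ys. (a x * b y - a y * b x) * H ys) rs"
proof (induction rs arbitrary: H)
  case (Cons r rs)
  have "alt1 (\<lambda>x xs. a x * alt1 (\<lambda>y ys. b y * H ys) (r # xs)) rs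
      = alt1 (\<lambda>x xs. (a x * b r) * H xs + - (a x * alt1 (\<lambda>y ys. b y * H (r # ys)) xs)) rs"
    by (rule alt1_cong) (simp add: algebra_simps)
  also have "\<dots> = alt1 (\<lambda>x xs. (a x * b r) * H xs) rs - alt1 (\<lambda>x xs. a x * alt1 (\<lambda>y ys. b y * H (r # ys)) xs) rs"
    unfolding alt1_add alt1_uminus by simp
  also have "alt1 (\<lambda>x xs. a x * alt1 (\<lambda>y ys. b y * H (r # ys)) xs) rs
      = alt2 (\<lambda>x y ys. (a x * b y - a y * b x) * H (r # ys)) rs"
    by (rule Cons.IH)
  finally have "alt1 (\<lambda>x xs. a x * alt1 (\<lambda>y ys. b y * H ys) xs) (r # rs)
      = alt1 (\<lambda>x xs. (a r * (b x * H xs)) + - ((a x * b r) * H xs)) rs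
        + alt2 (\<lambda>x y ys. (a x * b y - a y * b x) * H (r # ys)) rs"
    unfolding alt1_add alt1_uminus alt1_mult by simp
  also have "alt1 (\<lambda>x xs. (a r * (b x * H xs)) + - ((a x * b r) * H xs)) rs
      = alt1 (\<lambda>x xs. (a r * b x - a x * b r) * H xs) rs"
    by (rule alt1_cong) (simp add: algebra_simps)
  finally show ?case by simp
qed simp

lemma alt1_sum:
  "alt1 G rs = (\<Sum>i<length rs. (- 1) ^ i * G (rs ! i) (take i rs @ drop (Suc i) rs))"
proof (induction rs arbitrary: G)
  case (Cons r rs)
  show ?case
    by (simp add: Cons.IH sum.lessThan_Suc_shift sum_negf del: sum.lessThan_Suc)
qed simp

text \<open>The minor of the rows \<open>rs\<close> in the consecutive columns that start at k. Rows
  are arbitrary objects, and matrices with explicit dimensions let the size shrink during the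
  recursion.\<close>

definition array_det :: "('r \<Rightarrow> nat \<Rightarrow> 'a::comm_ring_1) \<Rightarrow> nat \<Rightarrow> 'r list \<Rightarrow> 'a" where
  "array_det e k rs = Determinant.det (Matrix.mat (length rs) (length rs) (\<lambda>(i, j). e (rs ! i) (k + j)))"

lemma array_det_expand:
  assumes "rs \<noteq> []"
  shows "array_det e k rs = alt1 (\<lambda>x xs. e x k * array_det e (Suc k) xs) rs"
proof -
  let ?n = "length rs"
  let ?A = "Matrix.mat ?n ?n (\<lambda>(i, j). e (rs ! i) (k + j))"
  have "Determinant.det ?A = (\<Sum>i<?n. ?A $$ (i, 0) * cofactor ?A i 0)"
    using assms by (intro laplace_expansion_column) auto
  also have "\<dots> = (\<Sum>i<?n. (- 1) ^ i * (e (rs ! i) k * array_det e (Suc k) (take i rs @ drop (Suc i) rs)))"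
  proof (rule sum.cong [OF refl])
    fix i assume i: "i \<in> {..<?n}"
    have "mat_delete ?A i 0 = Matrix.mat (?n - 1) (?n - 1)
        (\<lambda>(i', j). e ((take i rs @ drop (Suc i) rs) ! i') (Suc k + j))"
      using i by (intro eq_matI) (auto simp: mat_delete_def nth_append insert_index_def)
    moreover have "length (take i rs @ drop (Suc i) rs) = ?n - 1"
      using i by auto
    ultimately show "?A $$ (i, 0) * cofactor ?A i 0
        = (- 1) ^ i * (e (rs ! i) k * array_det e (Suc k) (take i rs @ drop (Suc i) rs))"
      using i assms by (simp add: cofactor_def array_det_def)
  qed
  finally show ?thesis
    by (simp add: array_det_def [of e k] alt1_sum)
qed

lemma array_det_wedge:
  fixes e :: "'r \<Rightarrow> nat \<Rightarrow> 'a::comm_ring_1"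
  assumes "length rs = 2 * m"
  shows "array_det e k rs
    = wedge (\<lambda>j x y. e x j * e y (Suc j) - e y j * e x (Suc j)) (map (\<lambda>i. k + 2 * i) [0..<m]) rs"
  using assms
proof (induction m arbitrary: k rs)
  case 0
  then show ?case by (simp add: array_det_def)
next
  case (Suc m)
  have "array_det e k rs = alt1 (\<lambda>x xs. e x k * array_det e (Suc k) xs) rs"
    using Suc.prems by (intro array_det_expand) auto
  also have "\<dots> = alt1 (\<lambda>x xs. e x k * alt1 (\<lambda>y ys. e y (Suc k) * array_det e (k + 2) ys) xs) rs"
  proof (rule alt1_cong)
    fix x :: 'r and xs :: "'r list" assume "Suc (length xs) = length rs"
    then have "array_det e (Suc k) xs = alt1 (\<lambda>y ys. e y (Suc k) * array_det e (Suc (Suc k)) ys) xs"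
      using Suc.prems by (intro array_det_expand) auto
    then show "e x k * array_det e (Suc k) xs = e x k * alt1 (\<lambda>y ys. e y (Suc k) * array_det e (k + 2) ys) xs"
      by simp
  qed
  also have "\<dots> = alt2 (\<lambda>x y ys. (e x k * e y (Suc k) - e y k * e x (Suc k)) * array_det e (k + 2) ys) rs"
    by (rule alt1_alt1)
  also have "\<dots> = alt2 (\<lambda>x y ys. (e x k * e y (Suc k) - e y k * e x (Suc k)) *
      wedge (\<lambda>j x y. e x j * e y (Suc j) - e y j * e x (Suc j)) (map (\<lambda>i. k + 2 + 2 * i) [0..<m]) ys) rs"
    by (rule alt2_cong) (simp add: Suc.IH Suc.prems)
  also have "map (\<lambda>i. k + 2 + 2 * i) [0..<m] = map (\<lambda>i. k + 2 * i) (map Suc [0..<m])"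
    by simp
  finally show ?case
    by (simp add: upt_rec[of 0 "Suc m"] map_Suc_upt del: upt_Suc)
qed

text \<open>Passes from matrices indexed by a finite type to matrices with numerical indices. Rows
  and columns are renamed by the same bijection, and the corresponding conjugation of permutations
  preserves the sign.\<close>

lemma det_reindex:
  fixes F :: "'n::finite \<Rightarrow> 'n \<Rightarrow> 'a::comm_ring_1"
  assumes h: "bij_betw h {0..<n} (UNIV :: 'n set)"
  shows "Determinants.det (\<chi> i j. F i j) = Determinant.det (Matrix.mat n n (\<lambda>(i, j). F (h i) (h j)))"
proof -
  let ?m = "\<lambda>\<pi> x. h (\<pi> (inv_into {0..<n} h x))"
  have bij: "bij_betw ?m {\<pi>. \<pi> permutes {0..<n}} {\<pi>. \<pi> permutes (UNIV :: 'n set)}"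
    using bij_betw_permutations[OF h] by simp
  have img: "h ` {0..<n} = UNIV"
    using h by (simp add: bij_betw_def)
  have inv: "inv_into {0..<n} h (h i) = i" if "i < n" for i
    using h that by (simp add: bij_betw_def)
  have "sign (?m \<pi>) = sign \<pi>" if "\<pi> permutes {0..<n}" for \<pi>
  proof -
    have "?m \<pi> = map_permutation {0..<n} h \<pi>"
      by (auto simp: map_permutation_def restrict_id_def img)
    then show ?thesis
      using sign_map_permutation[of h "{0..<n}" \<pi>] h that by (simp add: bij_betw_def)
  qed
  moreover have "(\<Prod>i\<in>UNIV. F i (?m \<pi> i)) = (\<Prod>i = 0..<n. F (h i) (h (\<pi> i)))" for \<pi>
    using prod.reindex_bij_betw[OF h, of "\<lambda>i. F i (?m \<pi> i)"] inv by (simp cong: prod.cong_simp)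
  moreover have "\<pi> i < n" if "\<pi> permutes {0..<n}" "i < n" for \<pi> i
    using permutes_in_image[OF that(1), of i] that(2) by simp
  ultimately have "(\<Sum>\<pi> | \<pi> permutes UNIV. of_int (sign \<pi>) * (\<Prod>i\<in>UNIV. F i (\<pi> i)))
      = (\<Sum>\<pi> | \<pi> permutes {0..<n}. of_int (sign \<pi>) * (\<Prod>i = 0..<n. F (h i) (h (\<pi> i))))"
    using sum.reindex_bij_betw[OF bij, of "\<lambda>\<pi>. of_int (sign \<pi>) * (\<Prod>i\<in>UNIV. F i (\<pi> i))"]
    by (simp cong: sum.cong_simp)
  then show ?thesis
    by (simp add: Determinants.det_def Determinant.det_def cong: sum.cong_simp prod.cong_simp)
qed

section \<open>From minors in (u, v) to quartics in line coordinates, independently of the dual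
  basis\<close>

section \<open>Minors in line coordinates\<close>

text \<open>The alternating 4 x 4 matrix of a line, with entries above the diagonal in the order 12,
  13, 14, 23, 24, 34. When the Pluecker form vanishes, its nonzero rows are points of the
  line.\<close>

definition skew :: "(6 \<Rightarrow> 'a::comm_ring_1) \<Rightarrow> 4 \<Rightarrow> 4 \<Rightarrow> 'a" where
  "skew n i j =
     (if i = 1 \<and> j = 2 then n 1 else if i = 2 \<and> j = 1 then - n 1
      else if i = 1 \<and> j = 3 then n 2 else if i = 3 \<and> j = 1 then - n 2
      else if i = 1 \<and> j = 4 then n 3 else if i = 4 \<and> j = 1 then - n 3
      else if i = 2 \<and> j = 3 then n 4 else if i = 3 \<and> j = 2 then - n 4
      else if i = 2 \<and> j = 4 then n 5 else if i = 4 \<and> j = 2 then - n 5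
      else if i = 3 \<and> j = 4 then n 6 else if i = 4 \<and> j = 3 then - n 6 else 0)"

definition pluecker_form :: "(6 \<Rightarrow> 'a::comm_ring_1) \<Rightarrow> 'a" where
  "pluecker_form n = n 1 * n 6 - n 2 * n 5 + n 3 * n 4"

lemma distinct_4: "(1::4) \<noteq> 2" "(1::4) \<noteq> 3" "(1::4) \<noteq> 4" "(2::4) \<noteq> 3" "(2::4) \<noteq> 4" "(3::4) \<noteq> 4"
  "(2::4) \<noteq> 1" "(3::4) \<noteq> 1" "(4::4) \<noteq> 1" "(3::4) \<noteq> 2" "(4::4) \<noteq> 2" "(4::4) \<noteq> 3"
  by simp_all

lemma distinct_6: "(1::6) \<noteq> 2" "(1::6) \<noteq> 3" "(1::6) \<noteq> 4" "(1::6) \<noteq> 5" "(1::6) \<noteq> 6"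
  "(2::6) \<noteq> 3" "(2::6) \<noteq> 4" "(2::6) \<noteq> 5" "(2::6) \<noteq> 6" "(3::6) \<noteq> 4" "(3::6) \<noteq> 5" "(3::6) \<noteq> 6"
  "(4::6) \<noteq> 5" "(4::6) \<noteq> 6" "(5::6) \<noteq> 6"
  by simp_all

lemma exhaust_6: "k = 1 \<or> k = 2 \<or> k = 3 \<or> k = 4 \<or> k = 5 \<or> k = 6" for k :: 6
proof (induct k)
  case (of_int z)
  then have "0 \<le> z" "z < 6" by simp_all
  then have "z = 0 \<or> z = 1 \<or> z = 2 \<or> z = 3 \<or> z = 4 \<or> z = 5" by arith
  then show ?case by auto
qed

lemma skew_values [simp]:
  "skew n 1 1 = 0" "skew n 1 2 = n 1" "skew n 1 3 = n 2" "skew n 1 4 = n 3"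
  "skew n 2 1 = - n 1" "skew n 2 2 = 0" "skew n 2 3 = n 4" "skew n 2 4 = n 5"
  "skew n 3 1 = - n 2" "skew n 3 2 = - n 4" "skew n 3 3 = 0" "skew n 3 4 = n 6"
  "skew n 4 1 = - n 3" "skew n 4 2 = - n 5" "skew n 4 3 = - n 6" "skew n 4 4 = 0"
  by (simp_all add: skew_def)

lemma subst_skew: "subst \<sigma> (skew n i j) = skew (\<lambda>k. subst \<sigma> (n k)) i j"
  by (simp add: skew_def subst_uminus)

lemma skew_scale: "skew (\<lambda>k. c * n k) i j = c * skew n i j"
  by (simp add: skew_def)

lemma skew_N_uv: "skew N_uv i j = u_var i * v_var j - u_var j * v_var i"
  using exhaust_4[of i] exhaust_4[of j]
  by (elim disjE) (simp_all add: N_uv_def)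

text \<open>The Grassmann-Pluecker relation. It says that the line through the points given by rows
  p and q of the matrix has coordinates \<open>skew n p q\<close> times the original ones, up to
  multiples of the Pluecker form.\<close>

lemma skew_three_term:
  "\<exists>c. skew n p i * skew n q j - skew n p j * skew n q i - skew n p q * skew n i j = c * pluecker_form n"
proof -
  let ?X = "skew n p i * skew n q j - skew n p j * skew n q i - skew n p q * skew n i j"
  have "?X = 0 * pluecker_form n \<or> ?X = 1 * pluecker_form n \<or> ?X = - 1 * pluecker_form n"
    using exhaust_4[of p] exhaust_4[of q] exhaust_4[of i] exhaust_4[of j]
    by (elim disjE) (simp_all add: pluecker_form_def algebra_simps)
  then show ?thesis by blast
qed

lemma pluecker_form_N_to_M: "pluecker_form N_to_M = pluecker"
  by (simp add: pluecker_form_def N_to_M_def pluecker_def algebra_simps)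

lemma homogeneous_N_to_M: "homogeneous 1 (N_to_M k)"
  by (simp add: N_to_M_def homogeneous_uminus)

lemma homogeneous_skew: "(\<And>k. homogeneous d (n k)) \<Longrightarrow> homogeneous d (skew n i j)"
  by (simp add: skew_def homogeneous_uminus)

definition lin :: "'k::field qform \<Rightarrow> 4 \<Rightarrow> (4 \<Rightarrow> ('v, 'k) mpoly) \<Rightarrow> ('v, 'k) mpoly" where
  "lin g b w = (\<Sum>a\<in>UNIV. Const (g $ (a, b)) * w a)"

text \<open>If N holds the 2 x 2 minors of (u, v), this is the minor of the rows g and h in the
  u-column and the v-column with index b; see \<open>pair_minor_decomposable\<close>.\<close>

definition pair_minor :: "(4 \<Rightarrow> 4 \<Rightarrow> ('v, 'k) mpoly) \<Rightarrow> 4 \<Rightarrow> 'k::field qform \<Rightarrow> 'k qform \<Rightarrow> ('v, 'k) mpoly" where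
  "pair_minor N b g h = (\<Sum>a\<in>UNIV. \<Sum>a'\<in>UNIV. Const (g $ (a, b)) * Const (h $ (a', b)) * N a a')"

definition row_vec :: "(4 \<Rightarrow> ('v, 'k) mpoly) \<Rightarrow> (4 \<Rightarrow> ('v, 'k) mpoly) \<Rightarrow> 'k::field qform \<Rightarrow> ('v, 'k) mpoly ^ (4 + 4)" where
  "row_vec u v g = (\<chi> j. case j of Inl b \<Rightarrow> lin g b u | Inr b \<Rightarrow> lin g b v)"

definition row_det :: "(4 \<Rightarrow> ('v, 'k) mpoly) \<Rightarrow> (4 \<Rightarrow> ('v, 'k) mpoly) \<Rightarrow> (4 + 4 \<Rightarrow> 'k::field qform) \<Rightarrow> ('v, 'k) mpoly" where
  "row_det u v g = Determinants.det (\<chi> i. row_vec u v (g i))"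

definition quartic :: "(4 \<Rightarrow> 4 \<Rightarrow> ('v, 'k) mpoly) \<Rightarrow> 'k::field qform list \<Rightarrow> ('v, 'k) mpoly" where
  "quartic N gs = wedge (pair_minor N) [1, 2, 3, 4] gs"

text \<open>The order puts the u-column and the v-column of each index next to each other, so that
  every pair in the Laplace expansion yields a linear form in the N_ij.\<close>

definition columns :: "(4 + 4) list" where
  "columns = [Inl 1, Inr 1, Inl 2, Inr 2, Inl 3, Inr 3, Inl 4, Inr 4]"

lemma bij_columns: "bij_betw (\<lambda>k. columns ! k) {0..<8} UNIV"
proof -
  have "distinct columns" "length columns = 8"
    by (simp_all add: columns_def)
  moreover have "set columns = UNIV"
    unfolding columns_def UNIV_sum UNIV_4 by auto
  ultimately show ?thesis
    using bij_betw_nth[of columns "{0..<8}" UNIV] by (simp add: lessThan_atLeast0)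
qed

lemma pair_minor_decomposable:
  "pair_minor (\<lambda>a a'. u a * v a' - u a' * v a) b g h = lin g b u * lin h b v - lin h b u * lin g b v"
proof -
  have "lin g b u * lin h b v = (\<Sum>a\<in>UNIV. \<Sum>a'\<in>UNIV. Const (g $ (a, b)) * Const (h $ (a', b)) * (u a * v a'))"
    unfolding lin_def sum_product by (intro sum.cong) (simp_all add: ac_simps)
  moreover have "lin h b u * lin g b v = (\<Sum>a\<in>UNIV. \<Sum>a'\<in>UNIV. Const (g $ (a, b)) * Const (h $ (a', b)) * (u a' * v a))"
    unfolding lin_def sum_product by (subst sum.swap) (intro sum.cong, simp_all add: ac_simps)
  ultimately show ?thesis
    by (simp add: pair_minor_def right_diff_distrib sum_subtractf)
qed

lemma row_det_quartic:
  "row_det u v g = quartic (\<lambda>a a'. u a * v a' - u a' * v a) (map (\<lambda>k. g (columns ! k)) [0..<8])"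
proof -
  let ?e = "\<lambda>r k. row_vec u v r $ (columns ! k)"
  let ?rs = "map (\<lambda>k. g (columns ! k)) [0..<8]"
  have "row_det u v g = Determinants.det (\<chi> i j. row_vec u v (g i) $ j)"
    by (simp add: row_det_def)
  also have "\<dots> = array_det ?e 0 ?rs"
    unfolding det_reindex[OF bij_columns] array_det_def
    by (intro arg_cong[of _ _ Determinant.det] eq_matI) auto
  also have "\<dots> = wedge (\<lambda>j x y. ?e x j * ?e y (Suc j) - ?e y j * ?e x (Suc j)) (map (\<lambda>i. 0 + 2 * i) [0..<4]) ?rs"
    by (rule array_det_wedge) simp
  also have "map (\<lambda>i. 0 + 2 * i) [0..<4] = [0, 2, 4, 6]"
    by (simp add: upt_rec)
  finally show ?thesis
    by (simp add: quartic_def pair_minor_decomposable[abs_def] row_vec_def columns_def del: upt_Suc)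
qed

lemma uv_minor_row_det: "uv_minor f \<rho> = row_det u_var v_var (f \<circ> \<rho>)"
proof -
  have "(\<chi> i j. uv_matrix f $ \<rho> i $ j) = (\<chi> i. row_vec u_var v_var ((f \<circ> \<rho>) i))"
    by (auto simp: Finite_Cartesian_Product.vec_eq_iff uv_matrix_def hat_matrix_def row_vec_def lin_def split: sum.split)
  then show ?thesis
    by (simp add: uv_minor_def row_det_def)
qed

lemma subst_alt1: "subst \<sigma> (alt1 G rs) = alt1 (\<lambda>x xs. subst \<sigma> (G x xs)) rs"
  by (induction rs arbitrary: G) (simp_all add: subst_diff)

lemma subst_alt2: "subst \<sigma> (alt2 G rs) = alt2 (\<lambda>x y xs. subst \<sigma> (G x y xs)) rs"
  by (induction rs arbitrary: G) (simp_all add: subst_add subst_alt1)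

lemma subst_wedge: "subst \<sigma> (wedge w bs rs) = wedge (\<lambda>b x y. subst \<sigma> (w b x y)) bs rs"
  by (induction bs arbitrary: rs) (simp_all add: subst_alt2 subst_mult)

lemma subst_quartic: "subst \<sigma> (quartic N gs) = quartic (\<lambda>i j. subst \<sigma> (N i j)) gs"
  unfolding quartic_def subst_wedge by (simp add: pair_minor_def subst_sum subst_mult)

lemma alt1_ideal: "is_ideal J \<Longrightarrow> (\<And>x xs. G x xs \<in> J) \<Longrightarrow> alt1 G rs \<in> J"
  by (induction rs arbitrary: G) (auto simp: ideal_0 intro: ideal_diff)

lemma alt2_ideal: "is_ideal J \<Longrightarrow> (\<And>x y xs. G x y xs \<in> J) \<Longrightarrow> alt2 G rs \<in> J"
  by (induction rs arbitrary: G) (auto simp: ideal_0 intro!: ideal_add alt1_ideal)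

lemma alt2_diff: "alt2 (\<lambda>x y xs. G x y xs - H x y xs) rs = alt2 G rs - alt2 H rs"
proof (induction rs arbitrary: G H)
  case (Cons r rs)
  have "alt1 (\<lambda>y xs. G r y xs - H r y xs) rs = alt1 (G r) rs - alt1 (H r) rs"
    using alt1_add[of "G r" "\<lambda>y xs. - H r y xs" rs] by (simp add: alt1_uminus)
  then show ?case
    using Cons.IH by simp
qed simp

lemma alt2_mult: "alt2 (\<lambda>x y xs. c * G x y xs) rs = c * alt2 G rs"
  by (induction rs arbitrary: G) (simp_all add: alt1_mult algebra_simps)

lemma wedge_congruent:
  assumes J: "is_ideal J" and w: "\<And>b x y. w b x y - c * w' b x y \<in> J"
  shows "wedge w bs rs - c ^ length bs * wedge w' bs rs \<in> J"
proof (induction bs arbitrary: rs)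
  case (Cons b bs)
  have "w b x y * wedge w bs zs - c ^ length (b # bs) * (w' b x y * wedge w' bs zs) \<in> J" for x y zs
  proof -
    have "w b x y * wedge w bs zs - c ^ length (b # bs) * (w' b x y * wedge w' bs zs)
        = wedge w bs zs * (w b x y - c * w' b x y)
          + (c * w' b x y) * (wedge w bs zs - c ^ length bs * wedge w' bs zs)"
      by (simp add: algebra_simps)
    also have "\<dots> \<in> J"
      by (intro ideal_add[OF J] ideal_mult[OF J] w Cons)
    finally show ?thesis .
  qed
  then have "alt2 (\<lambda>x y zs. w b x y * wedge w bs zs - c ^ length (b # bs) * (w' b x y * wedge w' bs zs)) rs \<in> J"
    by (intro alt2_ideal[OF J])
  then show ?case
    unfolding alt2_diff alt2_mult by simp
qed (simp add: ideal_0[OF J])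

lemma quartic_congruent:
  assumes J: "is_ideal J" and N: "\<And>i j. N i j - c * N' i j \<in> J"
  shows "quartic N gs - c ^ 4 * quartic N' gs \<in> J"
proof -
  have "pair_minor N b g h - c * pair_minor N' b g h \<in> J" for b g h
  proof -
    have "pair_minor N b g h - c * pair_minor N' b g h
        = (\<Sum>a\<in>UNIV. \<Sum>a'\<in>UNIV. Const (g $ (a, b)) * Const (h $ (a', b)) * (N a a' - c * N' a a'))"
      by (simp add: pair_minor_def sum_distrib_left algebra_simps sum_subtractf)
    also have "\<dots> \<in> J"
      by (intro ideal_sum[OF J] ideal_mult[OF J] N)
    finally show ?thesis .
  qed
  then show ?thesis
    using wedge_congruent[OF J, of "pair_minor N" c "pair_minor N'" "[1, 2, 3, 4]" gs]
    by (simp add: quartic_def power4_eq_xxxx mult.assoc del: wedge.simps)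
qed

lemma homogeneous_alt1: "(\<And>x xs. homogeneous d (G x xs)) \<Longrightarrow> homogeneous d (alt1 G rs)"
  by (induction rs arbitrary: G) (auto intro: homogeneous_diff)

lemma homogeneous_alt2: "(\<And>x y xs. homogeneous d (G x y xs)) \<Longrightarrow> homogeneous d (alt2 G rs)"
  by (induction rs arbitrary: G) (auto intro!: homogeneous_add homogeneous_alt1)

lemma homogeneous_wedge: "(\<And>b x y. homogeneous 1 (w b x y)) \<Longrightarrow> homogeneous (length bs) (wedge w bs rs)"
proof (induction bs arbitrary: rs)
  case (Cons b bs)
  have "homogeneous (1 + length bs) (w b x y * wedge w bs zs)" for x y zs
    by (rule homogeneous_mult[OF Cons.prems Cons.IH[OF Cons.prems]])
  then show ?case
    by (simp add: homogeneous_alt2)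
qed simp

lemma homogeneous_quartic:
  assumes "\<And>i j. homogeneous 1 (N i j)"
  shows "homogeneous 4 (quartic N gs)"
proof -
  have "homogeneous 1 (pair_minor N b g h)" for b g h
    unfolding pair_minor_def mult.assoc using assms by (intro homogeneous_sum homogeneous_Const_mult)
  then show ?thesis
    using homogeneous_wedge[of "pair_minor N" "[1, 2, 3, 4]" gs]
    by (simp add: quartic_def eval_nat_numeral del: wedge.simps)
qed

lemma is_ideal_line_scheme: "is_ideal (line_scheme_ideal f)"
  unfolding line_scheme_ideal_def by (rule is_ideal_generated)

lemma pluecker_in_line_scheme: "pluecker \<in> line_scheme_ideal f"
  unfolding line_scheme_ideal_def by (intro ideal_generated_base) simp

text \<open>A minor with rows \<open>gs\<close> is the quartic form of \<open>gs\<close> evaluated at the \<open>2 \<times> 2\<close> minors of \<open>(u, v)\<close>.\<close>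

lemma quartic_in_line_scheme:
  assumes "inj \<rho>"
  shows "quartic (skew N_to_M) (map (\<lambda>k. f (\<rho> (columns ! k))) [0..<8]) \<in> line_scheme_ideal f"
proof -
  let ?q = "quartic (skew Var) (map (\<lambda>k. f (\<rho> (columns ! k))) [0..<8])"
  have "homogeneous 4 ?q"
    by (intro homogeneous_quartic homogeneous_skew) simp
  moreover have "subst N_uv ?q = uv_minor f \<rho>"
    unfolding subst_quartic subst_skew subst_Var skew_N_uv uv_minor_row_det row_det_quartic by simp
  ultimately have "subst N_to_M ?q \<in> line_scheme_ideal f"
    unfolding line_scheme_ideal_def using assms by (intro ideal_generated_base) blast
  then show ?thesis
    by (simp add: subst_quartic subst_skew)
qed

lemma lin_add: "lin (g + h) b w = lin g b w + lin h b w"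
  by (simp add: lin_def Const_add algebra_simps sum.distrib)

lemma lin_scale: "lin (c *s g) b w = Const c * lin g b w"
  by (simp add: lin_def Const_mult sum_distrib_left mult.assoc)

lemma row_det_update: "row_det u v (g(k := x)) = Determinants.det (\<chi> i. if i = k then row_vec u v x else row_vec u v (g i))"
  unfolding row_det_def by (rule arg_cong[of _ _ Determinants.det]) (simp add: Finite_Cartesian_Product.vec_eq_iff)

lemma row_det_add: "row_det u v (g(k := x + y)) = row_det u v (g(k := x)) + row_det u v (g(k := y))"
proof -
  have *: "row_vec u v (x + y) = row_vec u v x + row_vec u v y"
    by (simp add: row_vec_def Finite_Cartesian_Product.vec_eq_iff lin_add split: sum.split)
  show ?thesis
    unfolding row_det_update * by (rule Determinants.det_row_add)
qed

lemma row_det_scale: "row_det u v (g(k := c *s x)) = Const c * row_det u v (g(k := x))"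
proof -
  have *: "row_vec u v (c *s x) = Const c *s row_vec u v x"
    by (simp add: row_vec_def Finite_Cartesian_Product.vec_eq_iff lin_scale split: sum.split)
  show ?thesis
    unfolding row_det_update * by (rule Determinants.det_row_mul)
qed

text \<open>By multilinearity the rows are moved from the spanning set to its span one at a time;
  the induction is on the set T of rows that may lie anywhere in the span.\<close>

lemma row_det_span:
  assumes J: "is_ideal J" and base: "\<And>g. range g \<subseteq> F \<Longrightarrow> row_det u v g \<in> J"
    and g: "range g \<subseteq> vec.span F"
  shows "row_det u v g \<in> J"
proof -
  have "row_det u v g \<in> J"
    if "finite T" "\<And>i. i \<in> T \<Longrightarrow> g i \<in> vec.span F" "\<And>i. i \<notin> T \<Longrightarrow> g i \<in> F" for T g
    using that
  proof (induction T arbitrary: g)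
    case empty
    then show ?case by (intro base) auto
  next
    case (insert k T)
    have "g k \<in> vec.span F"
      using insert.prems by simp
    then have "row_det u v (g(k := g k)) \<in> J"
    proof (induction rule: vec.span_induct)
      case base
      have "row_det u v (g(k := 0)) = 0"
        using row_det_scale[of u v g k 0 0] by simp
      then show ?case
        unfolding vec.subspace_def mem_Collect_eq row_det_add row_det_scale
        by (intro conjI ballI allI impI) (simp_all only: mem_Collect_eq ideal_0[OF J] ideal_add[OF J] ideal_mult[OF J])
    next
      case (step x)
      show ?case
        using insert.prems insert.hyps step by (intro insert.IH) auto
    qed
    then show ?case by simp
  qed
  from this[of UNIV g] g show ?thesis by auto
qed

text \<open>Two rows of the alternating matrix serve as u and v. By the three-term relation each of
  the four column pairs then contributes one factor \<open>skew N_to_M p q\<close> modulo the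
  Pluecker polynomial.\<close>

lemma row_det_congruent:
  fixes g :: "4 + 4 \<Rightarrow> 'k::field qform"
  assumes J: "is_ideal J" "pluecker \<in> J"
  shows "row_det (skew N_to_M p) (skew N_to_M q) g
    - skew N_to_M p q ^ 4 * quartic (skew N_to_M) (map (\<lambda>k. g (columns ! k)) [0..<8]) \<in> J"
  unfolding row_det_quartic
proof (rule quartic_congruent[OF J(1)])
  fix i j
  obtain c where "skew N_to_M p i * skew N_to_M q j - skew N_to_M p j * skew N_to_M q i
      - skew N_to_M p q * skew N_to_M i j = c * (pluecker :: (6, 'k) mpoly)"
    using skew_three_term[of "N_to_M :: 6 \<Rightarrow> (6, 'k) mpoly" p i q j] pluecker_form_N_to_M by metis
  then show "skew N_to_M p i * skew N_to_M q j - skew N_to_M p j * skew N_to_M q i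
      - skew N_to_M p q * skew N_to_M i j \<in> J"
    using ideal_mult[OF J] by simp
qed

text \<open>This frees the ideal from the chosen basis f. By multilinearity the rows may be taken
  among the f i; distinct ones give a multiple of a generator modulo the Pluecker polynomial, and a
  repeated one gives determinant zero.\<close>

lemma row_det_in_line_scheme:
  fixes f :: "10 \<Rightarrow> 'k::field qform" and g :: "4 + 4 \<Rightarrow> 'k qform"
  assumes "range g \<subseteq> vec.span (range f)"
  shows "row_det (skew N_to_M p) (skew N_to_M q) g \<in> line_scheme_ideal f"
proof (rule row_det_span[OF is_ideal_line_scheme _ assms])
  fix g :: "4 + 4 \<Rightarrow> 'k qform" assume "range g \<subseteq> range f"
  then have "\<exists>\<rho>. \<forall>i. g i = f (\<rho> i)"
    by (intro choice) auto
  then obtain \<rho> where \<rho>: "\<And>i. g i = f (\<rho> i)"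
    by blast
  show "row_det (skew N_to_M p) (skew N_to_M q) g \<in> line_scheme_ideal f"
  proof (cases "inj \<rho>")
    case True
    have "quartic (skew N_to_M) (map (\<lambda>k. g (columns ! k)) [0..<8]) \<in> line_scheme_ideal f"
      unfolding \<rho> by (rule quartic_in_line_scheme[OF True])
    then have "skew N_to_M p q ^ 4 * quartic (skew N_to_M) (map (\<lambda>k. g (columns ! k)) [0..<8]) \<in> line_scheme_ideal f"
      by (rule ideal_mult[OF is_ideal_line_scheme])
    then show ?thesis
      by (rule iffD2[OF ideal_congI[OF is_ideal_line_scheme
            row_det_congruent[OF is_ideal_line_scheme pluecker_in_line_scheme]]])
  next
    case False
    then obtain i j where "i \<noteq> j" "\<rho> i = \<rho> j"
      by (auto simp: inj_on_def)
    then have "row_det (skew N_to_M p) (skew N_to_M q) g = 0"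
      unfolding row_det_def
      by (intro Determinants.det_identical_rows[of i j])
        (simp_all add: Finite_Cartesian_Product.row_def Finite_Cartesian_Product.vec_eq_iff \<rho>)
    then show ?thesis
      by (simp add: ideal_0[OF is_ideal_line_scheme])
  qed
qed

text \<open>The fourth power is the price for passing through determinants of actual points u and v.
  It does no harm locally, since some entry of the alternating matrix is a unit at each
  point.\<close>

lemma quartic_span_in_line_scheme:
  assumes len: "length gs = 8" and gs: "set gs \<subseteq> vec.span (range f)"
  shows "skew N_to_M p q ^ 4 * quartic (skew N_to_M) gs \<in> line_scheme_ideal f"
proof -
  define g where "g c = gs ! inv_into {0..<8} (\<lambda>k. columns ! k) c" for c
  have "inv_into {0..<8} (\<lambda>k. columns ! k) c < 8" for c
    using inv_into_into[of c "\<lambda>k. columns ! k" "{0..<8}"] bij_columns by (auto simp: bij_betw_def)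
  then have "range g \<subseteq> vec.span (range f)"
    using gs len by (auto simp: g_def)
  moreover have "map (\<lambda>k. g (columns ! k)) [0..<8] = gs"
    using len inv_into_f_f[of "\<lambda>k. columns ! k" "{0..<8}"] bij_columns
    by (intro nth_equalityI) (auto simp: g_def bij_betw_def simp del: upt_Suc)
  ultimately show ?thesis
    using iffD1[OF ideal_congI[OF is_ideal_line_scheme
          row_det_congruent[OF is_ideal_line_scheme pluecker_in_line_scheme]] row_det_in_line_scheme[of g f p q]]
    by simp
qed

text \<open>Column k of the 10 x 4 matrix for the dual basis z1 z1, z2 z2, z3 z4, z4 z3, z1 z2 + z3
  z3, z2 z1 + b z4 z4, z1 z3 + z2 z4, z4 z1 + z3 z2, z3 z1 + z2 z3, b z4 z2 + z1 z4: an entry (i, l,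
  c) stands for c z_l in row i. Each column has only four nonzero entries.\<close>

definition dual_table :: "'a::comm_ring_1 \<Rightarrow> 4 \<Rightarrow> (nat \<times> 4 \<times> 'a) list" where
  "dual_table b k =
     (if k = 1 then [(1, 1, 1), (6, 2, 1), (8, 4, 1), (9, 3, 1)]
      else if k = 2 then [(2, 2, 1), (5, 1, 1), (8, 3, 1), (10, 4, b)]
      else if k = 3 then [(4, 4, 1), (5, 3, 1), (7, 1, 1), (9, 2, 1)]
      else [(3, 3, 1), (6, 4, b), (7, 2, 1), (10, 1, 1)])"

definition table_minor :: "(6 \<Rightarrow> 'a::comm_ring_1) \<Rightarrow> 'a \<Rightarrow> 4 \<Rightarrow> nat \<Rightarrow> nat \<Rightarrow> 'a" where
  "table_minor n b k i j =
     (case (map_of (dual_table b k) i, map_of (dual_table b k) j) of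
        (Some (l, c), Some (l', c')) \<Rightarrow> c * c' * skew n l l' | _ \<Rightarrow> 0)"

text \<open>The indices i and j are the two omitted rows.\<close>

definition base_minor :: "(6 \<Rightarrow> 'a::comm_ring_1) \<Rightarrow> 'a \<Rightarrow> nat \<Rightarrow> nat \<Rightarrow> 'a" where
  "base_minor n b i j = wedge (table_minor n b) [1, 2, 3, 4] (filter (\<lambda>k. k \<noteq> i \<and> k \<noteq> j) [1, 2, 3, 4, 5, 6, 7, 8, 9, 10])"

lemma wedge_guarded:
  assumes "\<And>x y. \<not> (P x \<and> P y) \<Longrightarrow> w k x y = 0"
  shows "wedge w (k # ks) rs = alt2 (\<lambda>x y zs. if P x \<and> P y then w k x y * wedge w ks zs else 0) rs"
  by (auto intro!: alt2_cong simp: assms)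

text \<open>The guard exploits the sparsity of the table: for concrete rows it is decided before the
  rest of the expansion is unfolded, so branches with a zero factor are dropped at once.\<close>

lemma wedge_table:
  "wedge (table_minor n b) (k # ks) rs = alt2 (\<lambda>x y zs.
     if x \<in> fst ` set (dual_table b k) \<and> y \<in> fst ` set (dual_table b k)
     then table_minor n b k x y * wedge (table_minor n b) ks zs else 0) rs"
proof (rule wedge_guarded)
  fix x y
  assume "\<not> (x \<in> fst ` set (dual_table b k) \<and> y \<in> fst ` set (dual_table b k))"
  then have "map_of (dual_table b k) x = None \<or> map_of (dual_table b k) y = None"
    unfolding map_of_eq_None_iff by blast
  then show "table_minor n b k x y = 0"
    by (auto simp: table_minor_def split: option.split)
qed

lemma fourth_power_cancel:
  fixes a :: "'a::comm_ring_1"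
  assumes "a ^ 4 = 1"
  shows "a * (a * (a * a)) = 1" "a * (a * (a * (a * x))) = x"
  using assms by (simp_all add: power4_eq_xxxx mult.assoc[symmetric])

lemma mult_self_cancel: "b * b = 1 \<Longrightarrow> b * (b * x) = x" for b :: "'a::comm_ring_1"
  by (simp flip: mult.assoc)

text \<open>The parameter b enters only through b * b = 1, so one list of quartics serves S and
  T.\<close>

lemma base_minor_values:
  fixes n :: "6 \<Rightarrow> 'a::comm_ring_1"
  assumes b: "b * b = 1"
  shows
  "base_minor n b 1 2 = - (n 2)\<^sup>2 * n 3 * n 4 + b * n 3 * n 4 * (n 5)\<^sup>2 - (n 3)\<^sup>2 * (n 6)\<^sup>2 + b * (n 4)\<^sup>2 * (n 6)\<^sup>2"
  "base_minor n b 1 3 = (n 1)\<^sup>2 * (n 5)\<^sup>2 + b * n 1 * (n 3)\<^sup>2 * n 6 - n 1 * (n 4)\<^sup>2 * n 6 - (n 5)\<^sup>2 * (n 6)\<^sup>2"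
  "base_minor n b 1 4 = (n 1)\<^sup>2 * n 2 * n 5 - (n 2)\<^sup>2 * (n 4)\<^sup>2 + b * (n 4)\<^sup>2 * (n 5)\<^sup>2 - n 2 * n 5 * (n 6)\<^sup>2"
  "base_minor n b 1 5 = - n 2 * n 3 * (n 4)\<^sup>2 + b * n 4 * n 5 ^ 3 - n 3 * n 5 * (n 6)\<^sup>2"
  "base_minor n b 1 6 = n 1 * n 2 * n 3 * n 6 - b * n 4 * n 5 * (n 6)\<^sup>2"
  "base_minor n b 1 7 = - n 1 * n 2 * (n 5)\<^sup>2 + n 2 * (n 4)\<^sup>2 * n 6 + n 5 * n 6 ^ 3"
  "base_minor n b 1 8 = n 1 * n 2 * n 3 * n 4 - b * (n 4)\<^sup>2 * n 5 * n 6"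
  "base_minor n b 1 9 = n 1 * n 2 * n 3 * n 5 - b * n 4 * (n 5)\<^sup>2 * n 6"
  "base_minor n b 1 10 = - n 1 * n 4 * (n 5)\<^sup>2 + b * n 1 * n 3 * (n 6)\<^sup>2 + n 4 ^ 3 * n 6"
  "base_minor n b 2 3 = (n 1)\<^sup>2 * n 2 * n 5 + b * (n 2)\<^sup>2 * (n 3)\<^sup>2 - (n 3)\<^sup>2 * (n 5)\<^sup>2 - n 2 * n 5 * (n 6)\<^sup>2"
  "base_minor n b 2 4 = (n 1)\<^sup>2 * (n 2)\<^sup>2 - n 1 * (n 3)\<^sup>2 * n 6 + b * n 1 * (n 4)\<^sup>2 * n 6 - (n 2)\<^sup>2 * (n 6)\<^sup>2"
  "base_minor n b 2 5 = b * n 1 * n 4 * n 5 * n 6 - n 2 * n 3 * (n 6)\<^sup>2"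
  "base_minor n b 2 6 = n 2 ^ 3 * n 3 - b * (n 3)\<^sup>2 * n 4 * n 5 - b * n 2 * n 4 * (n 6)\<^sup>2"
  "base_minor n b 2 7 = - n 1 * (n 2)\<^sup>2 * n 5 + (n 3)\<^sup>2 * n 5 * n 6 + n 2 * n 6 ^ 3"
  "base_minor n b 2 8 = b * n 1 * n 3 * n 4 * n 5 - n 2 * (n 3)\<^sup>2 * n 6"
  "base_minor n b 2 9 = n 1 * (n 2)\<^sup>2 * n 3 - n 3 ^ 3 * n 6 - b * n 1 * n 4 * (n 6)\<^sup>2"
  "base_minor n b 2 10 = - n 1 * n 2 * n 4 * n 5 + b * (n 2)\<^sup>2 * n 3 * n 6"
  "base_minor n b 3 4 = b * (n 1)\<^sup>2 * (n 3)\<^sup>2 - (n 1)\<^sup>2 * (n 4)\<^sup>2 - b * (n 2)\<^sup>2 * n 3 * n 4 + n 3 * n 4 * (n 5)\<^sup>2"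
  "base_minor n b 3 5 = - (n 1)\<^sup>2 * n 4 * n 5 - b * n 2 * (n 3)\<^sup>2 * n 4 + n 3 * n 5 ^ 3"
  "base_minor n b 3 6 = - (n 1)\<^sup>2 * n 3 * n 5 + n 1 * n 2 * n 4 * n 6"
  "base_minor n b 3 7 = - b * n 1 * (n 3)\<^sup>2 * n 5 + b * n 2 * n 3 * n 4 * n 6"
  "base_minor n b 3 8 = n 1 ^ 3 * n 5 + b * n 1 * n 2 * (n 3)\<^sup>2 - n 2 * (n 5)\<^sup>2 * n 6"
  "base_minor n b 3 9 = b * n 1 * n 3 ^ 3 + (n 1)\<^sup>2 * n 4 * n 6 - n 3 * (n 5)\<^sup>2 * n 6"
  "base_minor n b 3 10 = - b * n 1 * n 3 * (n 5)\<^sup>2 + b * n 2 * n 4 * n 5 * n 6"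
  "base_minor n b 4 5 = - (n 1)\<^sup>2 * n 2 * n 4 + n 1 * n 3 * n 5 * n 6"
  "base_minor n b 4 6 = - (n 1)\<^sup>2 * n 2 * n 3 + n 2 ^ 3 * n 4 - b * n 3 * (n 4)\<^sup>2 * n 5"
  "base_minor n b 4 7 = - n 1 * n 2 * (n 4)\<^sup>2 + n 3 * n 4 * n 5 * n 6"
  "base_minor n b 4 8 = n 1 ^ 3 * n 2 + b * n 1 * (n 4)\<^sup>2 * n 5 - (n 2)\<^sup>2 * n 5 * n 6"
  "base_minor n b 4 9 = n 1 * (n 2)\<^sup>2 * n 4 - n 2 * n 3 * n 5 * n 6"
  "base_minor n b 4 10 = - b * (n 1)\<^sup>2 * n 3 * n 6 - n 1 * n 4 ^ 3 + b * (n 2)\<^sup>2 * n 4 * n 6"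
  "base_minor n b 5 6 = (n 2)\<^sup>2 * n 3 * n 4 - b * n 3 * n 4 * (n 5)\<^sup>2"
  "base_minor n b 5 7 = - n 1 * n 2 * n 4 * n 5 + n 3 * (n 5)\<^sup>2 * n 6"
  "base_minor n b 5 8 = b * n 1 * n 4 * (n 5)\<^sup>2 - n 2 * n 3 * n 5 * n 6"
  "base_minor n b 5 9 = n 1 * n 2 * n 3 * n 4 - (n 3)\<^sup>2 * n 5 * n 6"
  "base_minor n b 5 10 = - n 1 * (n 4)\<^sup>2 * n 5 + b * n 2 * n 3 * n 4 * n 6"
  "base_minor n b 6 7 = - n 1 * n 2 * n 3 * n 5 + (n 2)\<^sup>2 * n 4 * n 6"
  "base_minor n b 6 8 = n 1 * (n 2)\<^sup>2 * n 3 - b * n 2 * n 4 * n 5 * n 6"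
  "base_minor n b 6 9 = n 1 * n 2 * (n 3)\<^sup>2 - b * n 3 * n 4 * n 5 * n 6"
  "base_minor n b 6 10 = - n 1 * n 3 * n 4 * n 5 + n 2 * (n 4)\<^sup>2 * n 6"
  "base_minor n b 7 8 = - (n 1)\<^sup>2 * n 2 * n 5 + n 2 * n 5 * (n 6)\<^sup>2"
  "base_minor n b 7 9 = - n 1 * n 2 * n 4 * n 6 + n 3 * n 5 * (n 6)\<^sup>2"
  "base_minor n b 7 10 = b * n 1 * n 3 * n 5 * n 6 - b * n 2 * n 4 * (n 6)\<^sup>2"
  "base_minor n b 8 9 = - (n 1)\<^sup>2 * n 2 * n 3 + b * n 1 * n 4 * n 5 * n 6"
  "base_minor n b 8 10 = (n 1)\<^sup>2 * n 4 * n 5 - b * n 1 * n 2 * n 3 * n 6"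
  "base_minor n b 9 10 = - b * n 1 * (n 3)\<^sup>2 * n 6 + n 1 * (n 4)\<^sup>2 * n 6"
  by (simp_all add: base_minor_def wedge_table dual_table_def table_minor_def b mult_self_cancel[OF b]
      power2_eq_square power3_eq_cube algebra_simps del: wedge.simps(2))

text \<open>The signs here and in the next two forms undo the substitution from N to M: evaluated at
  \<open>N_to_M\<close>, the three become M12 + e M34, M13 + e a M24 and M14 + e a M23.\<close>

definition form_A :: "(6 \<Rightarrow> 'a::comm_ring_1) \<Rightarrow> 'a \<Rightarrow> 'a" where
  "form_A n e = n 6 + e * n 1"

definition form_B :: "(6 \<Rightarrow> 'a::comm_ring_1) \<Rightarrow> 'a \<Rightarrow> 'a \<Rightarrow> 'a" where
  "form_B n a e = - n 5 - e * a * n 2"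

definition form_C :: "(6 \<Rightarrow> 'a::comm_ring_1) \<Rightarrow> 'a \<Rightarrow> 'a \<Rightarrow> 'a" where
  "form_C n a e = n 4 + e * a * n 3"

context
  fixes n :: "6 \<Rightarrow> 'a::comm_ring_1" and a d e :: 'a
  assumes a: "a ^ 4 = 1" and d: "d * d = 1" and e: "e * e = 1"
begin

private abbreviation "q \<equiv> base_minor n (a\<^sup>2)"
private abbreviation "A \<equiv> form_A n"
private abbreviation "B \<equiv> form_B n a"
private abbreviation "C \<equiv> form_C n a"

private lemma a2: "a\<^sup>2 * a\<^sup>2 = 1"
  using a by (simp flip: power_add)

text \<open>As d and e run through 1 and -1, the left-hand sides are exactly the products of the
  three forms of a triple with one of the three repeated. Each is a combination of the listed
  quartics, which is verified by expansion. A multiple of the Pluecker form is needed only where the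
  repeated form occurs together with its own sign variant.\<close>

lemma square_products:
  "A d * A d * A (- d) * B e =
     - q 1 7 - a * e * q 2 7 + d * q 3 8 + a * d * e * q 4 8 - a * e * q 5 9 + a ^ 3 * d * e * q 5 10 - a\<^sup>2 * d * q 6 9 + q 6 10
     + (- d * n 5 * n 6 - a * d * e * n 2 * n 6 + n 1 * n 5 + a * e * n 1 * n 2) * pluecker_form n"
  "A 1 * A (- 1) * B e * B e =
     - q 1 3 - a\<^sup>2 * q 2 4 + 2 * a * e * q 7 8"
  "A d * A d * B e * C (- (d * e)) =
     a\<^sup>2 * q 1 6 - a\<^sup>2 * d * q 2 5 - a * d * e * q 3 6 + a * e * q 4 5 + a * d * e * q 7 9 + a ^ 3 * e * q 7 10 - a\<^sup>2 * d * q 8 9 - q 8 10"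
  "A d * B e * B e * C (- (d * e)) =
     - a\<^sup>2 * q 1 9 - a * d * e * q 2 10 + a ^ 3 * e * q 3 10 + a\<^sup>2 * d * q 4 9 - a * d * e * q 5 7 + a\<^sup>2 * d * q 5 8 + a\<^sup>2 * q 6 7 - a ^ 3 * e * q 6 8"
  "A d * B e * C (- (d * e)) * C (- (d * e)) =
     a\<^sup>2 * q 1 8 + a ^ 3 * e * q 2 8 + d * q 3 7 + a * d * e * q 4 7 + a\<^sup>2 * q 5 9 + d * q 5 10 - a ^ 3 * d * e * q 6 9 - a * e * q 6 10"
  "B d * B d * B (- d) * C e =
     - a\<^sup>2 * q 1 5 + d * e * q 2 6 - a * e * q 3 5 + a ^ 3 * d * q 4 6 - a\<^sup>2 * q 7 9 - d * e * q 7 10 - a ^ 3 * d * q 8 9 - a * e * q 8 10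
     + (a * d * n 4 * n 5 + a\<^sup>2 * d * e * n 3 * n 5 - a\<^sup>2 * n 2 * n 4 - a ^ 3 * e * n 2 * n 3) * pluecker_form n"
  "B 1 * B (- 1) * C e * C e =
     a\<^sup>2 * q 1 4 - a\<^sup>2 * q 2 3 - 2 * a ^ 3 * e * q 5 6"
  "C d * C d * C (- d) * A e =
     q 1 10 + a ^ 3 * d * q 2 9 - a * d * e * q 3 9 - e * q 4 10 - a * d * e * q 5 7 + a\<^sup>2 * q 5 8 + a\<^sup>2 * e * q 6 7 - a ^ 3 * d * q 6 8
     + (a * d * n 4 * n 6 - a\<^sup>2 * n 3 * n 6 + a * d * e * n 1 * n 4 - a\<^sup>2 * e * n 1 * n 3) * pluecker_form n"
  "C 1 * C (- 1) * A e * A e =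
     a\<^sup>2 * q 1 2 - q 3 4 + 2 * e * q 9 10"
  unfolding base_minor_values[OF a2] form_A_def form_B_def form_C_def pluecker_form_def
  by (simp_all add: power2_eq_square power3_eq_cube algebra_simps fourth_power_cancel[OF a] d e
      mult_self_cancel[OF d] mult_self_cancel[OF e])

end

section \<open>The kernel of the conic parametrisation is generated by the conic and the linear
  equations\<close>

section \<open>Ideals of plane conics\<close>

lemma two_neq_0: "(2 :: ('v, 'k::field_char_0) mpoly) \<noteq> 0"
  using Const_eq_0_iff[of "2 :: 'k"] by (simp only: Const_numeral) simp

lemma half_sum: "Const (1 / 2) * (x + y) + Const (1 / 2) * (x - y) = x"
  and half_diff: "Const (1 / 2) * (x + y) - Const (1 / 2) * (x - y) = y"
  for x y :: "('v, 'k::field_char_0) mpoly"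
proof -
  have half: "Const (1 / 2) * w + Const (1 / 2) * w = w" for w :: "('v, 'k) mpoly"
    by (simp flip: distrib_right Const_add)
  have "Const (1 / 2) * (x + y) + Const (1 / 2) * (x - y) = Const (1 / 2) * x + Const (1 / 2) * x"
    and "Const (1 / 2) * (x + y) - Const (1 / 2) * (x - y) = Const (1 / 2) * y + Const (1 / 2) * y"
    by (simp_all add: algebra_simps)
  then show "Const (1 / 2) * (x + y) + Const (1 / 2) * (x - y) = x"
    and "Const (1 / 2) * (x + y) - Const (1 / 2) * (x - y) = y"
    by (simp_all only: half)
qed

lemma half_unit: "c \<noteq> 0 \<Longrightarrow> Const c * (Const (1 / (2 * c)) * w) = Const (1 / 2) * w"
  and unit_cancel: "c \<noteq> 0 \<Longrightarrow> Const c * (Const (1 / c) * w) = w"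
  for w :: "('v, 'k::field_char_0) mpoly"
  by (simp_all add: mult.assoc[symmetric] flip: Const_mult)

text \<open>Squaring the variables doubles exponent vectors, so different monomials stay different
  and no cancellation can occur.\<close>

lemma subst_squares_inject:
  fixes p :: "('v, 'k::comm_ring_1) mpoly"
  assumes "subst (\<lambda>i. Var i * Var i) p = 0"
  shows "p = 0"
proof (rule poly_mapping_eqI)
  fix m :: "'v \<Rightarrow>\<^sub>0 nat"
  have mono: "mono_subst (\<lambda>i. Var i * Var i) m = Poly_Mapping.single (m + m) (1 :: 'k)" for m :: "'v \<Rightarrow>\<^sub>0 nat"
  proof (induction m rule: exponent_induct)
    case zero
    show ?case by (simp add: mono_subst_def)
  next
    case (add m v)
    have "mono_subst (\<lambda>i. Var i * Var i) (Poly_Mapping.single v 1) = Var v * (Var v :: ('v, 'k) mpoly)" for v :: 'v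
      by (simp add: mono_subst_def)
    then show ?case
      using add by (simp add: mono_subst_add Var_def mult_single ac_simps)
  qed
  have double: "k + k = m + m \<longleftrightarrow> k = m" for k :: "'v \<Rightarrow>\<^sub>0 nat"
  proof
    assume eq: "k + k = m + m"
    show "k = m"
    proof (rule poly_mapping_eqI)
      fix v
      have "Poly_Mapping.lookup (k + k) v = Poly_Mapping.lookup (m + m) v"
        using eq by simp
      then show "Poly_Mapping.lookup k v = Poly_Mapping.lookup m v"
        by (simp add: lookup_add)
    qed
  qed simp
  have "Poly_Mapping.lookup (subst (\<lambda>i. Var i * Var i) p) (m + m)
      = (\<Sum>k\<in>Poly_Mapping.keys p. if k = m then Poly_Mapping.lookup p k else 0)"
    unfolding subst_def mono_subst_def[symmetric] mono lookup_sum
    by (intro sum.cong) (auto simp: Const_def mult_single lookup_single double when_def)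
  also have "\<dots> = Poly_Mapping.lookup p m"
    by (simp add: in_keys_iff)
  finally show "Poly_Mapping.lookup p m = Poly_Mapping.lookup 0 m"
    using assms by simp
qed

text \<open>Modulo \<open>y\<^sup>2 - x z\<close> every polynomial in \<open>x, y, z\<close> has the form \<open>a(x, z) + y b(x, z)\<close>, and
  \<open>a(s\<^sup>2, t\<^sup>2) + s t b(s\<^sup>2, t\<^sup>2) = 0\<close> forces \<open>a = b = 0\<close>, as is seen by changing the sign of \<open>t\<close>.\<close>

lemma (in veronese) kernel_subset:
  fixes x y z :: "('v, 'k) mpoly"
  assumes J: "is_ideal J" "J \<subseteq> kernel" and conic: "y * y - x * z \<in> J"
    and span: "\<And>v. \<exists>c1 c2 c3. Var v - (Const c1 * x + Const c2 * y + Const c3 * z) \<in> J"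
    and nu: "\<nu> x = Var 1 * Var 1" "\<nu> y = Var 1 * Var 2" "\<nu> z = Var 2 * Var 2"
    and two: "(2 :: (2, 'k) mpoly) \<noteq> 0"
  shows "kernel \<subseteq> J"
proof -
  let ?\<xi> = "subst (\<lambda>i::2. if i = 1 then x else z) :: (2, 'k) mpoly \<Rightarrow> ('v, 'k) mpoly"
  let ?N = "\<lambda>p. \<exists>a b. p - (?\<xi> a + y * ?\<xi> b) \<in> J"
  have normal: "?N p" for p
  proof (induction p rule: mpoly_induct)
    case (Const c)
    show ?case
      by (intro exI[of _ "Const c"] exI[of _ 0]) (simp add: ideal_0[OF J(1)])
  next
    case (add p q)
    then obtain a b a' b' where "p - (?\<xi> a + y * ?\<xi> b) \<in> J" "q - (?\<xi> a' + y * ?\<xi> b') \<in> J"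
      by blast
    then have "(p - (?\<xi> a + y * ?\<xi> b)) + (q - (?\<xi> a' + y * ?\<xi> b')) \<in> J"
      by (rule ideal_add[OF J(1)])
    then have "p + q - (?\<xi> (a + a') + y * ?\<xi> (b + b')) \<in> J"
      by (simp add: subst_add algebra_simps)
    then show ?case by blast
  next
    case (Var p v)
    then obtain a b where ab: "p - (?\<xi> a + y * ?\<xi> b) \<in> J"
      by blast
    obtain c1 c2 c3 where c: "Var v - (Const c1 * x + Const c2 * y + Const c3 * z) \<in> J"
      using span by blast
    let ?l = "Const c1 * Var 1 + Const c3 * Var 2 :: (2, 'k) mpoly"
    \<comment> \<open>Multiplying y * b by the y-part of the linear form gives y^2, which is
      replaced by x z; this is the source of the term with \<open>Var 1 * Var 2 * b\<close>.\<close>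
    let ?a = "a * ?l + Const c2 * (Var 1 * Var 2 * b)" and ?b = "b * ?l + Const c2 * a"
    have "p * Var v - (?\<xi> ?a + y * ?\<xi> ?b)
        = Var v * (p - (?\<xi> a + y * ?\<xi> b))
          + (?\<xi> a + y * ?\<xi> b) * (Var v - (Const c1 * x + Const c2 * y + Const c3 * z))
          + (Const c2 * ?\<xi> b) * (y * y - x * z)"
      by (simp add: subst_add subst_mult algebra_simps)
    also have "\<dots> \<in> J"
      using ab c conic by (intro ideal_add[OF J(1)] ideal_mult[OF J(1)])
    finally show ?case by blast
  qed
  show ?thesis
  proof
    fix p assume p: "p \<in> kernel"
    obtain a b where ab: "p - (?\<xi> a + y * ?\<xi> b) \<in> J"
      using normal by blast
    let ?sq = "subst (\<lambda>i. Var i * Var i) :: (2, 'k) mpoly \<Rightarrow> (2, 'k) mpoly"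
    have sq: "\<nu> (?\<xi> g) = ?sq g" for g
    proof -
      have "(\<lambda>i::2. \<nu> (if i = 1 then x else z)) = (\<lambda>i. Var i * Var i)"
      proof
        fix i :: 2
        show "\<nu> (if i = 1 then x else z) = Var i * Var i"
          using exhaust_2[of i] nu by auto
      qed
      then show ?thesis by (simp add: subst_subst)
    qed
    have "\<nu> (p - (?\<xi> a + y * ?\<xi> b)) = 0"
      using ab J(2) by auto
    then have eq: "?sq a + Var 1 * Var 2 * ?sq b = 0"
      using p by (simp add: subst_diff subst_add subst_mult sq nu)
    \<comment> \<open>The sign change of the second variable fixes the part in the squares and
      negates the part with the factor s t, so both parts vanish separately.\<close>
    let ?\<tau> = "subst (\<lambda>i::2. if i = 1 then Var i else - Var i) :: (2, 'k) mpoly \<Rightarrow> (2, 'k) mpoly"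
    have "?\<tau> (?sq g) = ?sq g" for g
    proof -
      have "(\<lambda>i::2. ?\<tau> (Var i * Var i)) = (\<lambda>i. Var i * Var i)"
        by (auto simp: subst_mult)
      then show ?thesis by (simp add: subst_subst)
    qed
    then have eq': "?sq a - Var 1 * Var 2 * ?sq b = 0"
      using arg_cong[OF eq, of ?\<tau>] by (simp add: subst_add subst_mult)
    have "2 * u = 0" if "u + w = 0" "u - w = 0" for u w :: "(2, 'k) mpoly"
    proof -
      have "2 * u = (u + w) + (u - w)" by simp
      also have "\<dots> = 0" by (simp only: that add_0_left)
      finally show ?thesis .
    qed
    then have "2 * ?sq a = 0"
      using eq eq' .
    then have a: "?sq a = 0"
      using two by simp
    then have b: "?sq b = 0"
      using eq by simp
    have "a = 0" "b = 0"
      using subst_squares_inject[OF a] subst_squares_inject[OF b] .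
    then show "p \<in> J"
      using ab by simp
  qed
qed


section \<open>Diagonal coordinates and parametrisation of the ten conics\<close>

section \<open>The ten conics\<close>

text \<open>The forms with indices 2m and 2m + 1 differ in one sign only. They are the values of
  \<open>form_A\<close>, \<open>form_B\<close> and \<open>form_C\<close> at signs 1 and -1, in this
  order.\<close>

definition Y :: "'k::field \<Rightarrow> nat \<Rightarrow> (6, 'k) mpoly" where
  "Y \<alpha> v = [M12 + M34, M12 - M34, M13 + Const \<alpha> * M24, M13 - Const \<alpha> * M24,
    M14 + Const \<alpha> * M23, M14 - Const \<alpha> * M23] ! v"

text \<open>The triples are the faces of the six-vertex triangulation of the projective plane; equivalently,
  the complements of the faces.\<close>

definition triples :: "nat set list" where
  "triples = [{0, 1, 3}, {0, 1, 2}, {2, 3, 5}, {2, 3, 4}, {1, 4, 5}, {0, 4, 5},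
     {1, 3, 5}, {1, 2, 4}, {0, 3, 4}, {0, 2, 5}]"

definition conic :: "'k::field \<Rightarrow> nat set \<Rightarrow> (6, 'k) mpoly set" where
  "conic \<alpha> T = ideal_generated (insert pluecker (Y \<alpha> ` T))"

text \<open>The coefficients of the squares of the \<open>Y \<alpha> v\<close> in 4 \<alpha> times
  the Pluecker polynomial.\<close>

definition diagonal :: "'k::field \<Rightarrow> nat \<Rightarrow> 'k" where
  "diagonal \<alpha> v = [\<alpha>, - \<alpha>, - 1, 1, 1, - 1] ! v"

lemma pluecker_diagonal:
  "Const (4 * \<alpha>) * pluecker = (\<Sum>v<6. Const (diagonal \<alpha> v) * (Y \<alpha> v * Y \<alpha> v))"
proof -
  have "{..<6::nat} = {0, 1, 2, 3, 4, 5}" by auto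
  then show ?thesis
    by (simp add: diagonal_def Y_def pluecker_def Const_mult Const_uminus Const_numeral algebra_simps)
qed

lemma conic_ideal: "is_ideal (conic \<alpha> T)"
  unfolding conic_def by (rule is_ideal_generated)

lemma homogeneous_Y: "v < 6 \<Longrightarrow> homogeneous 1 (Y \<alpha> v)"
proof -
  assume "v < 6"
  then have "v = 0 \<or> v = 1 \<or> v = 2 \<or> v = 3 \<or> v = 4 \<or> v = 5" by auto
  then show ?thesis
    by (elim disjE) (simp_all add: Y_def homogeneous_add homogeneous_diff homogeneous_Const_mult)
qed

lemma Var_span_Y:
  fixes \<alpha> :: "'k::field_char_0"
  assumes "\<alpha> \<noteq> 0"
  shows "\<exists>c. Var k = (\<Sum>v<6. Const (c v) * Y \<alpha> v)"
proof -
  have set: "{..<6::nat} = {0, 1, 2, 3, 4, 5}" by auto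
  have diff: "Const (1 / (2 * \<alpha>)) * (x + Const \<alpha> * y) - Const (1 / (2 * \<alpha>)) * (x - Const \<alpha> * y) = y"
    for x y :: "(6, 'k) mpoly"
  proof -
    have "Const (1 / (2 * \<alpha>)) * (x + Const \<alpha> * y) - Const (1 / (2 * \<alpha>)) * (x - Const \<alpha> * y)
        = Const \<alpha> * (Const (1 / (2 * \<alpha>)) * (y + y))"
      by (simp add: algebra_simps)
    also have "\<dots> = y"
      unfolding half_unit[OF assms] using half_sum[of y 0] by (simp add: algebra_simps)
    finally show ?thesis .
  qed
  let ?c = "\<lambda>k::6. if k = 1 then (!) [1 / 2, 1 / 2, 0, 0, 0, 0]
    else if k = 2 then (!) [0, 0, 1 / 2, 1 / 2, 0, 0]
    else if k = 3 then (!) [0, 0, 0, 0, 1 / 2, 1 / 2]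
    else if k = 4 then (!) [0, 0, 0, 0, 1 / (2 * \<alpha>), - (1 / (2 * \<alpha>))]
    else if k = 5 then (!) [0, 0, 1 / (2 * \<alpha>), - (1 / (2 * \<alpha>)), 0, 0]
    else (!) [1 / 2, - (1 / 2), 0, 0, 0, 0]"
  have "Var k = (\<Sum>v<6. Const (?c k v) * Y \<alpha> v)"
    using exhaust_6[of k] unfolding set
    by (elim disjE) (simp_all add: Y_def Const_uminus half_sum half_diff diff)
  then show ?thesis by blast
qed

lemma sqrt_exists: "\<exists>r. r * r = (c :: 'k::alg_closed_field)"
proof -
  have "\<exists>r. poly [:- c, 0, 1:] r = 0"
    by (rule alg_closed_imp_poly_has_root) simp
  then show ?thesis
    by (auto simp: algebra_simps)
qed

text \<open>On the plane where the forms of T vanish, the quadric is p^2 Y_i^2 - q^2 Y_j^2 - r^2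
  Y_k^2. With x = p Y_i + q Y_j, z = p Y_i - q Y_j and y = r Y_k it reads x z = y^2, and x = s^2, y
  = s t, z = t^2 parametrises it.\<close>

lemma conic_veronese:
  fixes \<alpha> :: "'k::{alg_closed_field, field_char_0}"
  assumes \<alpha>: "\<alpha> \<noteq> 0" and dist: "distinct [i, j, k]" "i < 6" "j < 6" "k < 6"
    and T: "T = {..<6} - {i, j, k}"
  obtains \<sigma> :: "6 \<Rightarrow> (2, 'k) mpoly"
    where "veronese \<sigma>" "conic \<alpha> T = {a. subst \<sigma> a = 0}" "\<And>v. v < 6 \<Longrightarrow> Y \<alpha> v \<in> conic \<alpha> T \<longleftrightarrow> v \<in> T"
proof -
  let ?\<epsilon> = "diagonal \<alpha>"
  have \<epsilon>: "?\<epsilon> v \<noteq> 0" if "v < 6" for v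
  proof -
    have "v = 0 \<or> v = 1 \<or> v = 2 \<or> v = 3 \<or> v = 4 \<or> v = 5" using that by auto
    then show ?thesis by (elim disjE) (simp_all add: diagonal_def \<alpha>)
  qed
  obtain p q r where pqr: "p * p = ?\<epsilon> i" "q * q = - ?\<epsilon> j" "r * r = - ?\<epsilon> k"
    using sqrt_exists by metis
  have nz: "p \<noteq> 0" "q \<noteq> 0" "r \<noteq> 0"
    using pqr \<epsilon> dist by auto
  let ?s = "Var 1 :: (2, 'k) mpoly" and ?t = "Var 2 :: (2, 'k) mpoly"
  \<comment> \<open>The value that each form \<open>Y \<alpha> v\<close> must take under the
    parametrisation, obtained by solving for Y_i, Y_j, Y_k.\<close>
  define \<eta> where "\<eta> v = (if v = i then Const (1 / (2 * p)) * (?s * ?s + ?t * ?t)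
    else if v = j then Const (1 / (2 * q)) * (?s * ?s - ?t * ?t)
    else if v = k then Const (1 / r) * (?s * ?t) else 0)" for v
  have hom_VV: "homogeneous 2 (Var a * Var b :: (2, 'k) mpoly)" for a b
    using homogeneous_mult[OF homogeneous_Var homogeneous_Var, of a b] by (simp add: numeral_2_eq_2)
  have hom_eta: "homogeneous 2 (\<eta> v)" for v
    by (simp add: \<eta>_def homogeneous_add homogeneous_diff homogeneous_Const_mult hom_VV)
  \<comment> \<open>The values of the six variables, recovered from the prescribed values of the
    forms by half sums and half differences.\<close>
  define \<sigma> :: "6 \<Rightarrow> (2, 'k) mpoly" where "\<sigma> m =
    (if m = 1 then Const (1 / 2) * (\<eta> 0 + \<eta> 1) else if m = 2 then Const (1 / 2) * (\<eta> 2 + \<eta> 3)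
     else if m = 3 then Const (1 / 2) * (\<eta> 4 + \<eta> 5) else if m = 4 then Const (1 / (2 * \<alpha>)) * (\<eta> 4 - \<eta> 5)
     else if m = 5 then Const (1 / (2 * \<alpha>)) * (\<eta> 2 - \<eta> 3) else Const (1 / 2) * (\<eta> 0 - \<eta> 1))" for m
  have nuY: "subst \<sigma> (Y \<alpha> v) = \<eta> v" if "v < 6" for v
  proof -
    have "v = 0 \<or> v = 1 \<or> v = 2 \<or> v = 3 \<or> v = 4 \<or> v = 5" using that by auto
    then show ?thesis
      by (elim disjE) (simp_all add: Y_def subst_simps \<sigma>_def half_unit[OF \<alpha>] half_sum half_diff)
  qed
  let ?x = "Const p * Y \<alpha> i + Const q * Y \<alpha> j" and ?y = "Const r * Y \<alpha> k"
    and ?z = "Const p * Y \<alpha> i - Const q * Y \<alpha> j"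
  have xyz: "subst \<sigma> ?x = ?s * ?s" "subst \<sigma> ?y = ?s * ?t" "subst \<sigma> ?z = ?t * ?t"
    using dist nz by (simp_all add: subst_simps nuY \<eta>_def half_unit unit_cancel half_sum half_diff)
  have hom_xyz: "homogeneous 1 ?x" "homogeneous 1 ?y" "homogeneous 1 ?z"
    using dist homogeneous_Y[of _ \<alpha>] by (simp_all add: homogeneous_add homogeneous_diff homogeneous_Const_mult)
  interpret veronese \<sigma>
  proof
    show "homogeneous 2 (\<sigma> v)" for v
      by (simp add: \<sigma>_def homogeneous_add homogeneous_diff homogeneous_Const_mult hom_eta)
    show "\<exists>a. homogeneous 1 a \<and> subst \<sigma> a = Var i' * Var j'" for i' j' :: 2
    proof -
      consider "i' = 1" "j' = 1" | "i' = 1" "j' = 2" | "i' = 2" "j' = 1" | "i' = 2" "j' = 2"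
        using exhaust_2[of i'] exhaust_2[of j'] by blast
      moreover have "subst \<sigma> ?y = ?t * ?s"
        using xyz(2) by (simp only: mult.commute)
      ultimately show ?thesis
        using xyz hom_xyz by (cases; blast)
    qed
  qed
  have Yi: "Y \<alpha> v \<in> conic \<alpha> T" if "v \<in> T" for v
    using that unfolding conic_def by (intro ideal_generated_base) auto
  have P: "pluecker \<in> conic \<alpha> T"
    unfolding conic_def by (intro ideal_generated_base) auto
  have split: "(\<Sum>v<6. Const (c v) * g v) - (Const (c i) * g i + Const (c j) * g j + Const (c k) * g k)
      = (\<Sum>v\<in>T. Const (c v) * g v)" for c :: "nat \<Rightarrow> 'k" and g :: "nat \<Rightarrow> ('w, 'k) mpoly"
  proof -
    have "{..<6} = insert i (insert j (insert k T))" "i \<notin> insert j (insert k T)" "j \<notin> insert k T" "k \<notin> T" "finite T"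
      using dist T by auto
    then show ?thesis
      by simp
  qed
  have nuP: "subst \<sigma> pluecker = 0"
  proof -
    have "(\<Sum>v\<in>T. Const (?\<epsilon> v) * (\<eta> v * \<eta> v)) = 0"
      by (intro sum.neutral) (auto simp: T \<eta>_def)
    then have "(\<Sum>v<6. Const (?\<epsilon> v) * (\<eta> v * \<eta> v))
        = Const (?\<epsilon> i) * (\<eta> i * \<eta> i) + Const (?\<epsilon> j) * (\<eta> j * \<eta> j) + Const (?\<epsilon> k) * (\<eta> k * \<eta> k)"
      using split[of ?\<epsilon> "\<lambda>v. \<eta> v * \<eta> v"] by simp
    also have "\<dots> = (Const p * \<eta> i + Const q * \<eta> j) * (Const p * \<eta> i - Const q * \<eta> j)
        - (Const r * \<eta> k) * (Const r * \<eta> k)"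
    proof -
      have e: "?\<epsilon> i = p * p" "?\<epsilon> j = - (q * q)" "?\<epsilon> k = - (r * r)"
        using pqr by simp_all
      show ?thesis
        unfolding e by (simp add: Const_mult Const_uminus algebra_simps)
    qed
    also have "\<dots> = (?s * ?s) * (?t * ?t) - (?s * ?t) * (?s * ?t)"
      using xyz dist by (simp add: subst_simps nuY)
    also have "\<dots> = 0" by (simp add: algebra_simps)
    finally have "subst \<sigma> (Const (4 * \<alpha>) * pluecker) = 0"
      unfolding pluecker_diagonal by (simp add: subst_sum subst_mult nuY)
    then show ?thesis
      using \<alpha> by (simp add: subst_mult)
  qed
  have sub: "conic \<alpha> T \<subseteq> kernel"
    unfolding conic_def
    by (rule ideal_generated_least[OF is_ideal_kernel]) (auto simp: nuP nuY T \<eta>_def)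
  have "kernel \<subseteq> conic \<alpha> T"
  proof (rule kernel_subset[OF conic_ideal sub _ _ xyz two_neq_0])
    have "?y * ?y - ?x * ?z
        = - (Const (?\<epsilon> i) * (Y \<alpha> i * Y \<alpha> i) + Const (?\<epsilon> j) * (Y \<alpha> j * Y \<alpha> j) + Const (?\<epsilon> k) * (Y \<alpha> k * Y \<alpha> k))"
    proof -
      have e: "?\<epsilon> i = p * p" "?\<epsilon> j = - (q * q)" "?\<epsilon> k = - (r * r)"
        using pqr by simp_all
      show ?thesis
        unfolding e by (simp add: Const_mult Const_uminus algebra_simps)
    qed
    also have "\<dots> = (\<Sum>v\<in>T. Const (?\<epsilon> v) * (Y \<alpha> v * Y \<alpha> v)) - Const (4 * \<alpha>) * pluecker"
      unfolding pluecker_diagonal split[of ?\<epsilon> "\<lambda>v. Y \<alpha> v * Y \<alpha> v", symmetric] by simp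
    also have "\<dots> \<in> conic \<alpha> T"
      using Yi P by (intro ideal_diff[OF conic_ideal] ideal_sum[OF conic_ideal] ideal_mult[OF conic_ideal])
    finally show "?y * ?y - ?x * ?z \<in> conic \<alpha> T" .
    fix m :: 6
    obtain c where c: "Var m = (\<Sum>v<6. Const (c v) * Y \<alpha> v)"
      using Var_span_Y[OF \<alpha>] by blast
    have "Const (c i / (2 * p)) * ?x + Const (c k / r) * ?y + Const (c i / (2 * p)) * ?z
        + (Const (c j / (2 * q)) * ?x - Const (c j / (2 * q)) * ?z)
        = Const (c i) * Y \<alpha> i + Const (c j) * Y \<alpha> j + Const (c k) * Y \<alpha> k"
    proof -
      have half: "Const a = Const (a / (2 * z)) * Const z + Const (a / (2 * z)) * Const z" if "z \<noteq> 0" for a z :: 'k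
        using that by (simp add: field_simps flip: Const_mult Const_add)
      have k: "Const (c k) = Const (c k / r) * Const r"
        using nz by (simp flip: Const_mult)
      show ?thesis
        unfolding half[OF nz(1), of "c i"] half[OF nz(2), of "c j"] k by (simp only: algebra_simps)
    qed
    then have "Const (c i / (2 * p) + c j / (2 * q)) * ?x + Const (c k / r) * ?y + Const (c i / (2 * p) - c j / (2 * q)) * ?z
        = Const (c i) * Y \<alpha> i + Const (c j) * Y \<alpha> j + Const (c k) * Y \<alpha> k"
      by (simp add: Const_add Const_diff algebra_simps)
    then have "Var m - (Const (c i / (2 * p) + c j / (2 * q)) * ?x + Const (c k / r) * ?y + Const (c i / (2 * p) - c j / (2 * q)) * ?z)
        = (\<Sum>v\<in>T. Const (c v) * Y \<alpha> v)"
      using split[of c "Y \<alpha>"] by (simp add: c)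
    also have "\<dots> \<in> conic \<alpha> T"
      using Yi by (intro ideal_sum[OF conic_ideal] ideal_mult[OF conic_ideal])
    finally show "\<exists>c1 c2 c3. Var m - (Const c1 * ?x + Const c2 * ?y + Const c3 * ?z) \<in> conic \<alpha> T"
      by blast
  qed
  with sub have eq: "conic \<alpha> T = kernel" by blast
  have "Y \<alpha> v \<in> conic \<alpha> T \<longleftrightarrow> v \<in> T" if v: "v < 6" for v
  proof
    assume "Y \<alpha> v \<in> conic \<alpha> T"
    then have 0: "\<eta> v = 0"
      using nuY[OF v] by (simp add: eq)
    have nzx: "?s * ?s \<noteq> 0" "?s * ?t \<noteq> 0" "?t * ?t \<noteq> 0"
      by simp_all
    \<comment> \<open>Setting s = 0 leaves t^2 or - t^2.\<close>
    have xz: "?s * ?s + ?t * ?t \<noteq> 0" "?s * ?s - ?t * ?t \<noteq> 0"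
    proof -
      let ?\<tau> = "subst (\<lambda>i. if i = 1 then 0 else Var i) :: (2, 'k) mpoly \<Rightarrow> (2, 'k) mpoly"
      have nonzero: "g \<noteq> 0" if "?\<tau> g \<noteq> 0" for g
        using that by auto
      show "?s * ?s + ?t * ?t \<noteq> 0" "?s * ?s - ?t * ?t \<noteq> 0"
        by (rule nonzero, simp add: subst_simps)+
    qed
    show "v \<in> T"
      using 0 v nz xz nzx by (auto simp: T \<eta>_def split: if_splits)
  qed (rule Yi)
  then show thesis
    using that[OF _ eq] veronese_axioms by blast
qed

section \<open>Relations whose columns lie on the line, and vanishing of the minors on the
  conics\<close>

section \<open>The conics lie on the line scheme\<close>

text \<open>Cramer's argument: replacing column k by the combination of the columns with
  coefficients w multiplies the determinant by w k, while that combination is zero.\<close>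

lemma det_kernel_vector:
  fixes A :: "'a::idom ^ 'n ^ 'n"
  assumes w: "\<And>i. (\<Sum>j\<in>UNIV. (A $ i) $ j * w j) = 0" and "w k \<noteq> 0"
  shows "Determinants.det A = 0"
proof -
  let ?B = "Finite_Cartesian_Product.transpose A"
  have zero: "(\<Sum>j\<in>UNIV. w j *s ?B $ j) = 0"
    using w by (simp add: Finite_Cartesian_Product.vec_eq_iff Finite_Cartesian_Product.transpose_def mult.commute)
  have "0 = Determinants.det (\<chi> i. if i = k then (\<Sum>j\<in>UNIV. w j *s ?B $ j) else ?B $ i)"
    unfolding zero by (simp only: Determinants.det_row_0)
  also have "\<dots> = (\<Sum>j\<in>UNIV. Determinants.det (\<chi> i. if i = k then w j *s ?B $ j else ?B $ i))"
    by (rule det_linear_row_sum) simp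
  also have "\<dots> = (\<Sum>j\<in>UNIV. w j * Determinants.det (\<chi> i. if i = k then ?B $ j else ?B $ i))"
    by (intro sum.cong refl) (rule Determinants.det_row_mul)
  also have "\<dots> = (\<Sum>j\<in>UNIV. if j = k then w k * Determinants.det ?B else 0)"
  proof (intro sum.cong refl)
    fix j
    show "w j * Determinants.det (\<chi> i. if i = k then ?B $ j else ?B $ i) = (if j = k then w k * Determinants.det ?B else 0)"
    proof (cases "j = k")
      case True
      then have "(\<chi> i. if i = k then ?B $ j else ?B $ i) = ?B"
        by (simp add: Finite_Cartesian_Product.vec_eq_iff)
      then show ?thesis using True by simp
    next
      case False
      have "Determinants.det (\<chi> i. if i = k then ?B $ j else ?B $ i) = 0"
        using False by (intro Determinants.det_identical_rows[of j k])
          (auto simp: Finite_Cartesian_Product.row_def Finite_Cartesian_Product.vec_eq_iff)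
      then show ?thesis using False by simp
    qed
  qed
  finally show ?thesis
    using \<open>w k \<noteq> 0\<close> by (simp add: Determinants.det_transpose)
qed

definition dual_space :: "'k::field \<Rightarrow> 'k qform set" where
  "dual_space b = {g. g $ (1, 2) = g $ (3, 3) \<and> g $ (4, 4) = b * g $ (2, 1) \<and> g $ (1, 3) = g $ (2, 4) \<and>
     g $ (4, 1) = g $ (3, 2) \<and> g $ (2, 3) = g $ (3, 1) \<and> g $ (4, 2) = b * g $ (1, 4)}"

text \<open>The coefficient matrix of the combination, with coefficients c 1 to c 6, of the six
  defining relations in their given order; b = 1 gives S and b = -1 gives T.\<close>

definition relation_matrix :: "'a::comm_ring_1 \<Rightarrow> (6 \<Rightarrow> 'a) \<Rightarrow> 4 \<Rightarrow> 4 \<Rightarrow> 'a" where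
  "relation_matrix b c i j =
     (if i = 1 then (if j = 1 then 0 else if j = 2 then c 1 else if j = 3 then c 3 else - b * c 6)
      else if i = 2 then (if j = 1 then - b * c 2 else if j = 2 then 0 else if j = 3 then c 5 else - c 3)
      else if i = 3 then (if j = 1 then - c 5 else if j = 2 then - c 4 else if j = 3 then - c 1 else 0)
      else (if j = 1 then c 4 else if j = 2 then c 6 else if j = 3 then 0 else c 2))"

lemma relation_matrix_values [simp]:
  "relation_matrix b c 1 1 = 0" "relation_matrix b c 1 2 = c 1" "relation_matrix b c 1 3 = c 3" "relation_matrix b c 1 4 = - (b * c 6)"
  "relation_matrix b c 2 1 = - (b * c 2)" "relation_matrix b c 2 2 = 0" "relation_matrix b c 2 3 = c 5" "relation_matrix b c 2 4 = - c 3"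
  "relation_matrix b c 3 1 = - c 5" "relation_matrix b c 3 2 = - c 4" "relation_matrix b c 3 3 = - c 1" "relation_matrix b c 3 4 = 0"
  "relation_matrix b c 4 1 = c 4" "relation_matrix b c 4 2 = c 6" "relation_matrix b c 4 3 = 0" "relation_matrix b c 4 4 = c 2"
  by (simp_all add: relation_matrix_def)

lemma relation_matrix_orthogonal:
  assumes "g \<in> dual_space b"
  shows "(\<Sum>j\<in>UNIV. \<Sum>i\<in>UNIV. Const (g $ (i, j)) * relation_matrix (Const b) c i j) = 0"
proof -
  have "g $ (1, 2) = g $ (3, 3)" "g $ (4, 4) = b * g $ (2, 1)" "g $ (1, 3) = g $ (2, 4)"
    "g $ (4, 1) = g $ (3, 2)" "g $ (2, 3) = g $ (3, 1)" "g $ (4, 2) = b * g $ (1, 4)"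
    using assms by (simp_all add: dual_space_def)
  then show ?thesis
    unfolding sum_4 relation_matrix_values by (simp add: Const_mult)
qed

text \<open>The columns of the matrix \<open>r\<close> lie on the line with line coordinates \<open>skew n\<close>.\<close>

definition incident :: "(6 \<Rightarrow> 'a::comm_ring_1) \<Rightarrow> (4 \<Rightarrow> 4 \<Rightarrow> 'a) \<Rightarrow> bool" where
  "incident n r \<longleftrightarrow> (\<forall>p q i j. r p j * skew n q i - r q j * skew n p i + r i j * skew n p q = 0)"

text \<open>The incidence expression is alternating in p, q, i, so the four three-element subsets of
  the indices suffice.\<close>

lemma incidentI:
  assumes "\<And>j. r 1 j * n 4 - r 2 j * n 2 + r 3 j * n 1 = 0"
    and "\<And>j. r 1 j * n 5 - r 2 j * n 3 + r 4 j * n 1 = 0"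
    and "\<And>j. r 1 j * n 6 - r 3 j * n 3 + r 4 j * n 2 = 0"
    and "\<And>j. r 2 j * n 6 - r 3 j * n 5 + r 4 j * n 4 = 0"
  shows "incident n r"
  unfolding incident_def
proof (intro allI)
  fix p q i j
  have cases: "s = 1 \<or> s = 2 \<or> s = 3 \<or> s = 4" for s :: 4
    by (rule exhaust_4)
  show "r p j * skew n q i - r q j * skew n p i + r i j * skew n p q = 0"
    using cases[of p] cases[of q] cases[of i] assms[of j]
    by (elim disjE) (simp_all add: algebra_simps)
qed

text \<open>Incidence expresses \<open>skew n p q\<close> times the relation matrix through the
  points u and v, with rows q and p of the matrix as coefficients. Every row of the dual space is
  orthogonal to the relation matrix, so these coefficients form a kernel vector.\<close>

lemma row_det_incident:
  fixes n :: "6 \<Rightarrow> ('v::linorder, 'k::field) mpoly"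
  assumes inc: "incident n (relation_matrix (Const b) c)" and nz: "c k \<noteq> 0" "skew n p q \<noteq> 0"
    and g: "range g \<subseteq> dual_space b"
  shows "row_det (skew n p) (skew n q) g = 0"
proof -
  let ?r = "relation_matrix (Const b) c"
  have r: "skew n p i * ?r q j - skew n q i * ?r p j = skew n p q * ?r i j" for i j
  proof -
    have move: "y - x = z" if "x - y + z = 0" for x y z :: "('v, 'k) mpoly"
    proof -
      have "y - x = y - x + (x - y + z)" using that by simp
      then show ?thesis by simp
    qed
    have "?r p j * skew n q i - ?r q j * skew n p i + ?r i j * skew n p q = 0"
      using inc by (simp only: incident_def)
    from move[OF this] show ?thesis
      by (simp only: mult.commute)
  qed
  have split: "sum F UNIV = (\<Sum>j\<in>UNIV. F (Inl j)) + (\<Sum>j\<in>UNIV. F (Inr j))" for F :: "4 + 4 \<Rightarrow> ('v, 'k) mpoly"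
    using sum.Plus[of UNIV UNIV F] by simp
  \<comment> \<open>The block multiplying the u-columns is row q of the relation matrix; the block
    multiplying the v-columns is minus row p.\<close>
  define w where "w c = (case c of Inl j \<Rightarrow> ?r q j | Inr j \<Rightarrow> - ?r p j)" for c
  have "(\<Sum>j\<in>UNIV. ((\<chi> i. row_vec (skew n p) (skew n q) (g i)) $ i) $ j * w j) = 0" for i
  proof -
    have "(\<Sum>j\<in>UNIV. ((\<chi> i. row_vec (skew n p) (skew n q) (g i)) $ i) $ j * w j)
        = (\<Sum>j\<in>UNIV. lin (g i) j (skew n p) * ?r q j) + (\<Sum>j\<in>UNIV. lin (g i) j (skew n q) * - ?r p j)"
      unfolding split by (simp add: row_vec_def w_def)
    also have "\<dots> = (\<Sum>j\<in>UNIV. \<Sum>a\<in>UNIV. Const (g i $ (a, j)) * (skew n p a * ?r q j - skew n q a * ?r p j))"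
      by (simp add: lin_def sum_distrib_right sum_subtractf sum_negf right_diff_distrib mult.assoc)
    also have "\<dots> = skew n p q * (\<Sum>j\<in>UNIV. \<Sum>a\<in>UNIV. Const (g i $ (a, j)) * ?r a j)"
      unfolding r by (simp add: sum_distrib_left ac_simps)
    also have "\<dots> = 0"
      using g by (subst relation_matrix_orthogonal) auto
    finally show ?thesis .
  qed
  \<comment> \<open>If both rows vanished, the whole relation matrix would vanish, since
    \<open>skew n p q\<close> is nonzero; but its entries contain every c k up to sign.\<close>
  moreover have "\<exists>k. w k \<noteq> 0"
  proof (rule ccontr)
    assume "\<not> (\<exists>k. w k \<noteq> 0)"
    then have w: "w k = 0" for k by simp
    have rows: "?r q j = 0" "?r p j = 0" for j
      using w[of "Inl j"] w[of "Inr j"] by (simp_all add: w_def)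
    then have "?r i j = 0" for i j
      using r[of i j] nz(2) by simp
    from this[of 1 2] this[of 4 4] this[of 1 3] this[of 4 1] this[of 2 3] this[of 4 2]
    show False
      using nz(1) exhaust_6[of k] by auto
  qed
  ultimately show ?thesis
    unfolding row_det_def using det_kernel_vector by blast
qed

definition tuple6 :: "'a \<Rightarrow> 'a \<Rightarrow> 'a \<Rightarrow> 'a \<Rightarrow> 'a \<Rightarrow> 'a \<Rightarrow> 6 \<Rightarrow> 'a" where
  "tuple6 c1 c2 c3 c4 c5 c6 k =
     (if k = 1 then c1 else if k = 2 then c2 else if k = 3 then c3
      else if k = 4 then c4 else if k = 5 then c5 else c6)"

lemma tuple6_values [simp]:
  "tuple6 c1 c2 c3 c4 c5 c6 1 = c1" "tuple6 c1 c2 c3 c4 c5 c6 2 = c2" "tuple6 c1 c2 c3 c4 c5 c6 3 = c3"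
  "tuple6 c1 c2 c3 c4 c5 c6 4 = c4" "tuple6 c1 c2 c3 c4 c5 c6 5 = c5" "tuple6 c1 c2 c3 c4 c5 c6 6 = c6"
  by (simp_all add: tuple6_def)

lemma relation_matrix_cases:
  "P 1 \<Longrightarrow> P 2 \<Longrightarrow> P 3 \<Longrightarrow> P 4 \<Longrightarrow> P (j :: 4)"
  using exhaust_4[of j] by auto

context
  fixes n :: "6 \<Rightarrow> 'a::comm_ring_1" and a :: 'a
  assumes a: "a ^ 4 = 1" and P: "pluecker_form n = 0"
begin

text \<open>Three letters name the forms that vanish on the curve: here both A-forms and one B-form.
  The conic equation \<open>P'\<close> is what makes the products of coordinates cancel. The other
  sign of the B-form is obtained by replacing a by - a.\<close>

lemma incident_AAB:
  assumes n: "n 1 = 0" "n 6 = 0" "n 5 = a * n 2"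
  shows "incident n (relation_matrix (a\<^sup>2) (tuple6 0 0 (a ^ 3 * n 2) (- n 2) (a ^ 3 * n 4) (n 3)))"
proof -
  have P': "n 3 * n 4 = a * (n 2 * n 2)" "n 4 * n 3 = a * (n 2 * n 2)"
    using P by (simp_all add: pluecker_form_def n ac_simps)
  show ?thesis
    by (rule incidentI; rule relation_matrix_cases)
      (simp_all add: n P' power2_eq_square power3_eq_cube algebra_simps fourth_power_cancel[OF a])
qed

lemma incident_BBC:
  assumes n: "n 2 = 0" "n 5 = 0" "n 4 = a * n 3"
  shows "incident n (relation_matrix (a\<^sup>2) (tuple6 (n 3) (- (a ^ 3 * n 3)) (a ^ 3 * n 1) (- n 6) 0 0))"
proof -
  have P': "n 1 * n 6 = - (a * (n 3 * n 3))" "n 6 * n 1 = - (a * (n 3 * n 3))"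
    using P by (simp_all add: pluecker_form_def n ac_simps eq_neg_iff_add_eq_0)
  show ?thesis
    by (rule incidentI; rule relation_matrix_cases)
      (simp_all add: n P' power2_eq_square power3_eq_cube algebra_simps fourth_power_cancel[OF a])
qed

lemma incident_CCA:
  assumes n: "n 3 = 0" "n 4 = 0" "n 6 = e * n 1" and e: "e * e = 1"
  shows "incident n (relation_matrix (a\<^sup>2) (tuple6 (- (e * n 2)) (a\<^sup>2 * n 5) 0 0 (e * n 1) (n 1)))"
proof -
  have P': "n 2 * n 5 = e * (n 1 * n 1)" "n 5 * n 2 = e * (n 1 * n 1)"
    using P by (simp_all add: pluecker_form_def n ac_simps)
  show ?thesis
    by (rule incidentI; rule relation_matrix_cases)
      (simp_all add: n P' power2_eq_square algebra_simps fourth_power_cancel[OF a] e mult_self_cancel[OF e])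
qed

text \<open>The curves on which one form of each kind vanishes; the signs of the A-form and the
  B-form determine that of the C-form.\<close>

lemma incident_ABC:
  assumes n: "n 6 = d * n 1" "n 5 = e * a * n 2" "n 4 = d * e * a * n 3" and d: "d * d = 1" and e: "e * e = 1"
  shows "incident n (relation_matrix (a\<^sup>2)
    (tuple6 (- (a * d * e * n 1)) (n 1) (a * e * n 3) (- (a\<^sup>2 * n 3)) (a\<^sup>2 * n 2) (a\<^sup>2 * d * n 2)))"
proof -
  have "d * (n 1 * n 1) = e * (a * (n 2 * n 2)) - d * (e * (a * (n 3 * n 3)))"
    using P by (simp add: pluecker_form_def n algebra_simps)
  \<comment> \<open>Multiplication by the sign d isolates the square of n 1, so that the conic
    equation can be used as a rewrite rule.\<close>
  then have "d * (d * (n 1 * n 1)) = d * (e * (a * (n 2 * n 2)) - d * (e * (a * (n 3 * n 3))))"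
    by simp
  then have P': "n 1 * n 1 = a * (d * (e * (n 2 * n 2))) - a * (e * (n 3 * n 3))"
    by (simp add: mult_self_cancel[OF d] algebra_simps)
  show ?thesis
    by (rule incidentI; rule relation_matrix_cases)
      (simp_all add: n P' power2_eq_square algebra_simps fourth_power_cancel[OF a] d e
        mult_self_cancel[OF d] mult_self_cancel[OF e])
qed

end

definition form_Y :: "(6 \<Rightarrow> 'a::comm_ring_1) \<Rightarrow> 'a \<Rightarrow> nat \<Rightarrow> 'a" where
  "form_Y n a v = [form_A n 1, form_A n (- 1), form_B n a 1, form_B n a (- 1), form_C n a 1, form_C n a (- 1)] ! v"

lemma form_Y_values:
  "form_Y n a 0 = n 6 + n 1" "form_Y n a 1 = n 6 - n 1" "form_Y n a 2 = - n 5 - a * n 2"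
  "form_Y n a 3 = - n 5 + a * n 2" "form_Y n a 4 = n 4 + a * n 3" "form_Y n a 5 = n 4 - a * n 3"
  by (simp_all add: form_Y_def form_A_def form_B_def form_C_def)

lemma below_6: "v < 6 \<Longrightarrow> v = 0 \<or> v = 1 \<or> v = 2 \<or> v = 3 \<or> v = 4 \<or> v = (5::nat)"
  by auto

lemma Y_form: "v < 6 \<Longrightarrow> Y \<alpha> v = form_Y N_to_M (Const \<alpha>) v"
  by (drule below_6, elim disjE) (simp_all add: form_Y_def form_A_def form_B_def form_C_def Y_def N_to_M_def)

lemma subst_form_Y: "v < 6 \<Longrightarrow> subst \<sigma> (form_Y n (Const \<alpha>) v) = form_Y (\<lambda>k. subst \<sigma> (n k)) (Const \<alpha>) v"
  by (drule below_6, elim disjE) (simp_all only: form_Y_values subst_simps subst_Const)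

lemma triples_below_6: "T \<in> set triples \<Longrightarrow> T \<subseteq> {..<6}"
  by (auto simp: triples_def)

lemma triples_cases:
  assumes "T \<in> set triples"
  shows "T = {0, 1, 3} \<or> T = {0, 1, 2} \<or> T = {2, 3, 5} \<or> T = {2, 3, 4} \<or> T = {1, 4, 5} \<or> T = {0, 4, 5}
    \<or> T = {1, 3, 5} \<or> T = {1, 2, 4} \<or> T = {0, 3, 4} \<or> T = {0, 2, 5}"
  using assms by (simp only: triples_def list.set insert_iff empty_iff simp_thms)

lemma sum_diff_zero:
  fixes x y :: "'a::{idom, ring_char_0}"
  assumes "x + y = 0" "x - y = 0"
  shows "x = 0" "y = 0"
proof -
  have "x = y" using assms(2) by simp
  then have "2 * x = 0" using assms(1) by simp
  then show "x = 0" by simp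
  then show "y = 0" using \<open>x = y\<close> by simp
qed

lemma incident_relation_exists:
  fixes n :: "6 \<Rightarrow> 'a::{idom, ring_char_0}"
  assumes a: "a ^ 4 = 1" and P: "pluecker_form n = 0" and T: "T \<in> set triples"
    and Y0: "\<And>v. v \<in> T \<Longrightarrow> form_Y n a v = 0" and nz: "n l \<noteq> 0"
  shows "\<exists>c k. incident n (relation_matrix (a\<^sup>2) c) \<and> c k \<noteq> 0"
proof -
  have a0: "a \<noteq> 0" using a by auto
  \<comment> \<open>The relations depend on a^2 only, so each incidence lemma may also be used with
    - a.\<close>
  have a': "(- a) ^ 4 = 1" using a by simp
  \<comment> \<open>For every coefficient vector used below, vanishing of all its entries together
    with the equations of the curve would force all line coordinates to vanish.\<close>
  have conclude: ?thesis
    if inc: "incident n (relation_matrix (a\<^sup>2) c)"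
      and zero: "c 1 = 0 \<Longrightarrow> c 2 = 0 \<Longrightarrow> c 3 = 0 \<Longrightarrow> c 4 = 0 \<Longrightarrow> c 5 = 0 \<Longrightarrow> c 6 = 0 \<Longrightarrow>
        n 1 = 0 \<and> n 2 = 0 \<and> n 3 = 0 \<and> n 4 = 0 \<and> n 5 = 0 \<and> n 6 = 0" for c
  proof (rule ccontr)
    assume "\<not> ?thesis"
    then have "c k = 0" for k using inc by blast
    then show False
      using zero nz exhaust_6[of l] by auto
  qed
  have AAB: ?thesis if n: "n 1 = 0" "n 6 = 0" "n 5 = a * n 2 \<or> n 5 = - a * n 2"
    using n(3)
  proof
    assume n5: "n 5 = a * n 2"
    show ?thesis
      by (rule conclude[OF incident_AAB[OF a P n(1,2) n5]]) (use n n5 a0 in auto)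
  next
    assume n5: "n 5 = - a * n 2"
    show ?thesis
      by (rule conclude[OF incident_AAB[OF a' P n(1,2) n5, simplified power2_minus]]) (use n n5 a0 in auto)
  qed
  have BBC: ?thesis if n: "n 2 = 0" "n 5 = 0" "n 4 = a * n 3 \<or> n 4 = - a * n 3"
    using n(3)
  proof
    assume n4: "n 4 = a * n 3"
    show ?thesis
      by (rule conclude[OF incident_BBC[OF a P n(1,2) n4]]) (use n n4 a0 in auto)
  next
    assume n4: "n 4 = - a * n 3"
    show ?thesis
      by (rule conclude[OF incident_BBC[OF a' P n(1,2) n4, simplified power2_minus]]) (use n n4 a0 in auto)
  qed
  have CCA: ?thesis if n: "n 3 = 0" "n 4 = 0" "n 6 = e * n 1" and e: "e * e = 1" for e
    by (rule conclude[OF incident_CCA[OF a P n e]]) (use n e a0 in auto)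
  have ABC: ?thesis
    if n: "n 6 = d * n 1" "n 5 = e * a * n 2" "n 4 = d * e * a * n 3" and d: "d * d = 1" and e: "e * e = 1" for d e
  proof -
    have "d \<noteq> 0" "e \<noteq> 0" using d e by auto
    then show ?thesis
      by (intro conclude[OF incident_ABC[OF a P n d e]]) (use n a0 in auto)
  qed
  have n5: "(- n 5 = a * n 2) = (n 5 = - (a * n 2))"
    using minus_equation_iff[of "n 5" "a * n 2"] by auto
  have Y: "form_Y n a 0 = 0 \<longleftrightarrow> n 6 = - 1 * n 1" "form_Y n a 1 = 0 \<longleftrightarrow> n 6 = 1 * n 1"
    "form_Y n a 2 = 0 \<longleftrightarrow> n 5 = - 1 * a * n 2" "form_Y n a 3 = 0 \<longleftrightarrow> n 5 = 1 * a * n 2"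
    "form_Y n a 4 = 0 \<longleftrightarrow> n 4 = - 1 * a * n 3" "form_Y n a 5 = 0 \<longleftrightarrow> n 4 = 1 * a * n 3"
    unfolding form_Y_values
    by (simp_all only: right_minus_eq n5 neg_equal_iff_equal mult_minus1 mult_1_left mult_minus_left
        flip: eq_neg_iff_add_eq_0)
  have A: "n 1 = 0 \<and> n 6 = 0" if "form_Y n a 0 = 0" "form_Y n a 1 = 0"
    using that sum_diff_zero[of "n 6" "n 1"] by (simp only: form_Y_values)
  have B: "n 2 = 0 \<and> n 5 = 0" if "form_Y n a 2 = 0" "form_Y n a 3 = 0"
    using that sum_diff_zero[of "- n 5" "a * n 2"] a0 by (simp add: form_Y_values)
  have C: "n 3 = 0 \<and> n 4 = 0" if "form_Y n a 4 = 0" "form_Y n a 5 = 0"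
    using that sum_diff_zero[of "n 4" "a * n 3"] a0 by (simp add: form_Y_values)
  from triples_cases[OF T] show ?thesis
  proof (elim disjE)
    assume "T = {0, 1, 3}"
    then have y: "form_Y n a 0 = 0" "form_Y n a 1 = 0" "form_Y n a 3 = 0"
      by (simp_all add: Y0)
    show ?thesis
      by (rule AAB) (use A[OF y(1) y(2)] y(3)[unfolded Y] in simp_all)
  next
    assume "T = {0, 1, 2}"
    then have y: "form_Y n a 0 = 0" "form_Y n a 1 = 0" "form_Y n a 2 = 0"
      by (simp_all add: Y0)
    show ?thesis
      by (rule AAB) (use A[OF y(1) y(2)] y(3)[unfolded Y] in simp_all)
  next
    assume "T = {2, 3, 5}"
    then have y: "form_Y n a 2 = 0" "form_Y n a 3 = 0" "form_Y n a 5 = 0"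
      by (simp_all add: Y0)
    show ?thesis
      by (rule BBC) (use B[OF y(1) y(2)] y(3)[unfolded Y] in simp_all)
  next
    assume "T = {2, 3, 4}"
    then have y: "form_Y n a 2 = 0" "form_Y n a 3 = 0" "form_Y n a 4 = 0"
      by (simp_all add: Y0)
    show ?thesis
      by (rule BBC) (use B[OF y(1) y(2)] y(3)[unfolded Y] in simp_all)
  next
    assume "T = {1, 4, 5}"
    then have y: "form_Y n a 1 = 0" "form_Y n a 4 = 0" "form_Y n a 5 = 0"
      by (simp_all add: Y0)
    show ?thesis
      by (rule CCA[of 1]) (use C[OF y(2) y(3)] y(1)[unfolded Y] in simp_all)
  next
    assume "T = {0, 4, 5}"
    then have y: "form_Y n a 0 = 0" "form_Y n a 4 = 0" "form_Y n a 5 = 0"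
      by (simp_all add: Y0)
    show ?thesis
      by (rule CCA[of "- 1"]) (use C[OF y(2) y(3)] y(1)[unfolded Y] in simp_all)
  next
    assume "T = {1, 3, 5}"
    then have y: "form_Y n a 1 = 0" "form_Y n a 3 = 0" "form_Y n a 5 = 0"
      by (simp_all add: Y0)
    show ?thesis
      by (rule ABC[of 1 1]) (use y[unfolded Y] in simp_all)
  next
    assume "T = {1, 2, 4}"
    then have y: "form_Y n a 1 = 0" "form_Y n a 2 = 0" "form_Y n a 4 = 0"
      by (simp_all add: Y0)
    show ?thesis
      by (rule ABC[of 1 "- 1"]) (use y[unfolded Y] in simp_all)
  next
    assume "T = {0, 3, 4}"
    then have y: "form_Y n a 0 = 0" "form_Y n a 3 = 0" "form_Y n a 4 = 0"
      by (simp_all add: Y0)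
    show ?thesis
      by (rule ABC[of "- 1" 1]) (use y[unfolded Y] in simp_all)
  next
    assume "T = {0, 2, 5}"
    then have y: "form_Y n a 0 = 0" "form_Y n a 2 = 0" "form_Y n a 5 = 0"
      by (simp_all add: Y0)
    show ?thesis
      by (rule ABC[of "- 1" "- 1"]) (use y[unfolded Y] in simp_all)
  qed
qed

lemma triple_veronese:
  fixes \<alpha> :: "'k::{alg_closed_field, field_char_0}"
  assumes \<alpha>: "\<alpha> \<noteq> 0" and T: "T \<in> set triples"
  obtains \<sigma> :: "6 \<Rightarrow> (2, 'k) mpoly"
    where "veronese \<sigma>" "conic \<alpha> T = {a. subst \<sigma> a = 0}" "\<And>v. v < 6 \<Longrightarrow> Y \<alpha> v \<in> conic \<alpha> T \<longleftrightarrow> v \<in> T"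
proof -
  have "\<exists>i j k. distinct [i, j, k] \<and> i < 6 \<and> j < 6 \<and> k < 6 \<and> T = {..<6} - {i, j, k}"
  proof -
    have six: "{..<6::nat} = {0, 1, 2, 3, 4, 5}" by auto
    have complement: ?thesis if "T = {..<6} - {i, j, k}" "distinct [i, j, k]" "i < 6" "j < 6" "k < 6" for i j k
      using that by blast
    from triples_cases[OF T] show ?thesis
    proof (elim disjE)
      assume "T = {0, 1, 3}"
      then show ?thesis
        by (intro complement[of 2 4 5]) (auto simp: six)
    next
      assume "T = {0, 1, 2}"
      then show ?thesis
        by (intro complement[of 3 4 5]) (auto simp: six)
    next
      assume "T = {2, 3, 5}"
      then show ?thesis
        by (intro complement[of 0 1 4]) (auto simp: six)
    next
      assume "T = {2, 3, 4}"
      then show ?thesis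
        by (intro complement[of 0 1 5]) (auto simp: six)
    next
      assume "T = {1, 4, 5}"
      then show ?thesis
        by (intro complement[of 0 2 3]) (auto simp: six)
    next
      assume "T = {0, 4, 5}"
      then show ?thesis
        by (intro complement[of 1 2 3]) (auto simp: six)
    next
      assume "T = {1, 3, 5}"
      then show ?thesis
        by (intro complement[of 0 2 4]) (auto simp: six)
    next
      assume "T = {1, 2, 4}"
      then show ?thesis
        by (intro complement[of 0 3 5]) (auto simp: six)
    next
      assume "T = {0, 3, 4}"
      then show ?thesis
        by (intro complement[of 1 2 5]) (auto simp: six)
    next
      assume "T = {0, 2, 5}"
      then show ?thesis
        by (intro complement[of 1 3 4]) (auto simp: six)
    qed
  qed
  then obtain i j k where "distinct [i, j, k]" "i < 6" "j < 6" "k < 6" "T = {..<6} - {i, j, k}"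
    by blast
  then show thesis
    using that by (rule conic_veronese[OF \<alpha>])
qed

text \<open>The parametrisation gives a line with coordinates in k[s,t], the generic line of the
  conic. The minors vanish on two of its points u and v; since k[s,t] is a domain, the quartics
  vanish at its coordinates, so they lie in the kernel that is the conic ideal.\<close>

lemma line_scheme_subset_conic:
  fixes \<alpha> :: "'k::{alg_closed_field, field_char_0}"
  assumes \<alpha>: "\<alpha> ^ 4 = 1" and T: "T \<in> set triples" and f: "range f \<subseteq> dual_space (\<alpha>\<^sup>2)"
  shows "line_scheme_ideal f \<subseteq> conic \<alpha> T"
proof -
  have "\<alpha> \<noteq> 0" using \<alpha> by auto
  then obtain \<sigma> :: "6 \<Rightarrow> (2, 'k) mpoly" where ver: "veronese \<sigma>" and eq: "conic \<alpha> T = {a. subst \<sigma> a = 0}"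
    using triple_veronese T by metis
  let ?m = "\<lambda>k. subst \<sigma> (N_to_M k)"
  have P: "pluecker \<in> conic \<alpha> T"
    unfolding conic_def by (intro ideal_generated_base) simp
  have Pm: "pluecker_form ?m = 0"
  proof -
    have "subst \<sigma> (pluecker_form N_to_M) = pluecker_form ?m"
      by (simp add: pluecker_form_def subst_simps)
    then show ?thesis
      using P by (simp add: pluecker_form_N_to_M eq)
  qed
  have Ym: "form_Y ?m (Const \<alpha>) v = 0" if v: "v \<in> T" for v
  proof -
    have v6: "v < 6" using v triples_below_6[OF T] by auto
    have "Y \<alpha> v \<in> conic \<alpha> T"
      unfolding conic_def using v by (intro ideal_generated_base) simp
    then show ?thesis
      using subst_form_Y[OF v6, of \<sigma> N_to_M \<alpha>] by (simp add: Y_form[OF v6] eq)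
  qed
  have "\<exists>l. ?m l \<noteq> 0"
  proof (rule ccontr)
    assume "\<nexists>l. ?m l \<noteq> 0"
    then have m: "?m l = 0" for l by simp
    have "subst \<sigma> (Var k) = 0" for k
      using exhaust_6[of k] m[of 1] m[of 2] m[of 3] m[of 4] m[of 5] m[of 6]
      by (elim disjE) (simp_all add: N_to_M_def subst_uminus)
    then have "Var k \<in> {a. subst \<sigma> a = 0}" for k by simp
    then show False
      using veronese.kernel_proj[OF ver] by (auto simp: proj_space_def)
  qed
  then obtain l where l: "?m l \<noteq> 0" by blast
  have a4: "(Const \<alpha> :: (2, 'k) mpoly) ^ 4 = 1"
    using \<alpha> by (simp flip: Const_power)
  obtain c k where inc: "incident ?m (relation_matrix (Const (\<alpha>\<^sup>2)) c)" and k: "c k \<noteq> 0"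
    using incident_relation_exists[OF a4 Pm T Ym l] unfolding Const_power by blast
  obtain p q where pq: "skew ?m p q \<noteq> 0"
  proof -
    have "skew ?m 1 2 \<noteq> 0 \<or> skew ?m 1 3 \<noteq> 0 \<or> skew ?m 1 4 \<noteq> 0 \<or> skew ?m 2 3 \<noteq> 0 \<or> skew ?m 2 4 \<noteq> 0 \<or> skew ?m 3 4 \<noteq> 0"
      using l exhaust_6[of l] by auto
    then show thesis using that by blast
  qed
  let ?u = "skew ?m p" and ?v = "skew ?m q"
  \<comment> \<open>Specialises u and v to two points of the generic line, so that each N_ij becomes
    \<open>skew ?m p q\<close> times the corresponding line coordinate.\<close>
  let ?\<psi> = "subst (\<lambda>c. case c of Inl i \<Rightarrow> ?u i | Inr i \<Rightarrow> ?v i)"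
  have minor: "?\<psi> (skew N_uv i j) = skew ?m p q * skew ?m i j" for i j
  proof -
    obtain d where "?u i * ?v j - ?u j * ?v i - skew ?m p q * skew ?m i j = d * pluecker_form ?m"
      using skew_three_term[of ?m p i q j] by blast
    then have "?u i * ?v j - ?u j * ?v i - skew ?m p q * skew ?m i j = 0"
      by (simp only: Pm mult_zero_right)
    then show ?thesis
      by (simp add: skew_N_uv subst_simps)
  qed
  have N: "?\<psi> (N_uv k) = skew ?m p q * ?m k" for k
    using exhaust_6[of k] minor[of 1 2] minor[of 1 3] minor[of 1 4] minor[of 2 3] minor[of 2 4] minor[of 3 4]
    by (elim disjE) simp_all
  have "subst \<sigma> (subst N_to_M g) = 0"
    if "homogeneous 4 g" "subst N_uv g = uv_minor f \<rho>" for g \<rho>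
  proof -
    have "?\<psi> (uv_minor f \<rho>) = row_det ?u ?v (f \<circ> \<rho>)"
      unfolding uv_minor_row_det row_det_quartic subst_quartic by (simp add: subst_simps)
    also have "\<dots> = 0"
      using f by (intro row_det_incident[OF inc k pq]) auto
    finally have "?\<psi> (subst N_uv g) = 0"
      using that(2) by simp
    \<comment> \<open>A quartic in the N_ij takes out the fourth power of the common factor, which
      is nonzero and can be cancelled.\<close>
    then have "skew ?m p q ^ 4 * subst ?m g = 0"
      unfolding subst_subst N subst_scaled[OF that(1)] .
    then show ?thesis
      using pq by (simp add: subst_subst)
  qed
  then have "{subst N_to_M q | q \<rho>. inj \<rho> \<and> homogeneous 4 q \<and> subst N_uv q = uv_minor f \<rho>} \<subseteq> conic \<alpha> T"
    unfolding eq by blast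
  then show ?thesis
    unfolding line_scheme_ideal_def using P by (intro ideal_generated_least conic_ideal) simp
qed

section \<open>Local equations of the line scheme, its components and reducedness\<close>

section \<open>The quartics of the line scheme\<close>

definition dual_base :: "'k::field \<Rightarrow> nat \<Rightarrow> 'k qform" where
  "dual_base b i = (\<chi> lk. case map_of (dual_table b (snd lk)) i of None \<Rightarrow> 0 | Some (l', c) \<Rightarrow> if fst lk = l' then c else 0)"

lemma dual_base_component:
  "dual_base b i $ (l, k) = (case map_of (dual_table b k) i of None \<Rightarrow> 0 | Some (l', c) \<Rightarrow> if l = l' then c else 0)"
  by (simp add: dual_base_def fst_conv snd_conv cong: if_cong option.case_cong)

lemma dual_base_in_dual_space: "dual_base b i \<in> dual_space b"
  by (simp add: dual_space_def dual_base_component dual_table_def)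

lemma map_of_dual_table_Const:
  "map_of (dual_table (Const b) k) i = map_option (\<lambda>(l, c). (l, Const c)) (map_of (dual_table b k) i)"
  by (simp add: dual_table_def)

text \<open>Each column of a table row has at most one entry, so the bilinear sum collapses to a
  single line coordinate.\<close>

lemma pair_minor_dual_base:
  "pair_minor (skew n) k (dual_base b i) (dual_base b j) = table_minor n (Const b) k i j"
proof (cases "map_of (dual_table b k) i = None \<or> map_of (dual_table b k) j = None")
  case True
  then show ?thesis
    by (auto simp: pair_minor_def table_minor_def dual_base_component map_of_dual_table_Const split: option.split)
next
  case False
  then obtain l c l' c' where *: "map_of (dual_table b k) i = Some (l, c)" "map_of (dual_table b k) j = Some (l', c')"
    by auto
  have delta: "(\<Sum>a\<in>UNIV. x * Const (if a = m then d else 0) * F a) = x * Const d * F m"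
    for x :: "('a, 'b) mpoly" and F and m :: 4 and d
  proof -
    have "x * Const (if a = m then d else 0) * F a = (if a = m then x * Const d * F m else 0)" for a
      by simp
    then show ?thesis by simp
  qed
  show ?thesis
    using delta[of 1 l c "\<lambda>a. Const c' * skew n a l'"]
    by (simp add: pair_minor_def dual_base_component table_minor_def map_of_dual_table_Const * delta flip: mult.assoc)
qed

lemma alt1_map: "alt1 G (map h rs) = alt1 (\<lambda>x xs. G (h x) (map h xs)) rs"
  by (induction rs arbitrary: G) simp_all

lemma alt2_map: "alt2 G (map h rs) = alt2 (\<lambda>x y xs. G (h x) (h y) (map h xs)) rs"
  by (induction rs arbitrary: G) (simp_all add: alt1_map)

lemma wedge_map: "wedge w bs (map h rs) = wedge (\<lambda>b x y. w b (h x) (h y)) bs rs"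
  by (induction bs arbitrary: rs) (simp_all add: alt2_map)

lemma quartic_dual_base:
  "quartic (skew n) (map (dual_base b) ks) = wedge (table_minor n (Const b)) [1, 2, 3, 4] ks"
  unfolding quartic_def wedge_map pair_minor_dual_base ..

text \<open>Both algebras at once: f enters through its span, the annihilator of the relations with
  parameter b = \<alpha>^2.\<close>

locale line_scheme =
  fixes \<alpha> :: "'k::{alg_closed_field, field_char_0}" and f :: "10 \<Rightarrow> 'k qform"
  assumes \<alpha>: "\<alpha> ^ 4 = 1" and span_f: "vec.span (range f) = dual_space (\<alpha>\<^sup>2)"
begin

abbreviation I :: "(6, 'k) mpoly set" where "I \<equiv> line_scheme_ideal f"

text \<open>The length condition says that i and j are two different indices from 1 to 10, in a form
  that simplification decides for concrete numbers.\<close>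

lemma base_minor_in:
  assumes "length (filter (\<lambda>k. k \<noteq> i \<and> k \<noteq> j) [1, 2, 3, 4, 5, 6, 7, 8, 9, 10 :: nat]) = 8"
  shows "skew N_to_M p q ^ 4 * base_minor N_to_M ((Const \<alpha>)\<^sup>2) i j \<in> I"
proof -
  define ks where "ks = filter (\<lambda>k. k \<noteq> i \<and> k \<noteq> j) [1, 2, 3, 4, 5, 6, 7, 8, 9, 10]"
  have "set (map (dual_base (\<alpha>\<^sup>2)) ks) \<subseteq> vec.span (range f)"
    unfolding span_f using dual_base_in_dual_space by auto
  moreover have "length (map (dual_base (\<alpha>\<^sup>2)) ks) = 8"
    using assms unfolding ks_def length_map .
  ultimately have "skew N_to_M p q ^ 4 * quartic (skew N_to_M) (map (dual_base (\<alpha>\<^sup>2)) ks) \<in> I"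
    by (intro quartic_span_in_line_scheme)
  then show ?thesis
    unfolding quartic_dual_base base_minor_def ks_def Const_power .
qed

lemma \<alpha>_neq_0: "\<alpha> \<noteq> 0"
  using \<alpha> by auto

lemma subset_conic: "T \<in> set triples \<Longrightarrow> I \<subseteq> conic \<alpha> T"
  using vec.span_superset[of "range f"] span_f by (intro line_scheme_subset_conic \<alpha>) auto

lemma conic_proj: "T \<in> set triples \<Longrightarrow> conic \<alpha> T \<in> proj_space"
  by (rule triple_veronese[OF \<alpha>_neq_0]) (auto simp: veronese.kernel_proj)

lemma Y_in_conic_iff: "T \<in> set triples \<Longrightarrow> v < 6 \<Longrightarrow> Y \<alpha> v \<in> conic \<alpha> T \<longleftrightarrow> v \<in> T"
  by (rule triple_veronese[OF \<alpha>_neq_0]) auto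

context
  fixes p :: "(6, 'k) mpoly set"
  assumes p: "p \<in> zero_locus I"
begin

private abbreviation "L \<equiv> localized I p"

lemma p_prime: "homogeneous_prime p" and p_ideal: "is_ideal p" and I_sub_p: "I \<subseteq> p"
  using p by (auto simp: zero_locus_iff proj_space_prime prime_ideal)

lemma L_ideal: "is_ideal L"
  by (rule is_ideal_localized[OF is_ideal_line_scheme p_prime])

lemma L_subset: "L \<subseteq> p"
proof
  fix a assume "a \<in> L"
  then obtain t where t: "denominator p t" "t * a \<in> I"
    by (rule localizedE)
  then have "t * a \<in> p"
    using I_sub_p by blast
  then show "a \<in> p"
    using t(1) prime_mult[OF p_prime] by (auto simp: denominator_def)
qed

lemma pluecker_in_L: "pluecker \<in> L"
  by (rule localized_base[OF p_prime pluecker_in_line_scheme])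

lemma skew_notin: "\<exists>i j. skew N_to_M i j \<notin> p"
proof (rule ccontr)
  assume "\<not> ?thesis"
  then have s: "skew N_to_M i j \<in> p" for i j by blast
  have "Var k \<in> p" for k
    using exhaust_6[of k] s[of 1 2] s[of 3 1] s[of 1 4] s[of 2 3] s[of 4 2] s[of 3 4]
    by (elim disjE) (simp_all add: N_to_M_def)
  then show False
    using p by (simp add: zero_locus_iff proj_space_def)
qed

text \<open>Some line coordinate is nonzero at the point, so the fourth power in
  \<open>base_minor_in\<close> can be chosen to be a unit there and cancelled.\<close>

lemma base_minor_in_L:
  assumes "length (filter (\<lambda>k. k \<noteq> i \<and> k \<noteq> j) [1, 2, 3, 4, 5, 6, 7, 8, 9, 10 :: nat]) = 8"
  shows "base_minor N_to_M ((Const \<alpha>)\<^sup>2) i j \<in> L"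
proof -
  obtain k l where kl: "skew N_to_M k l \<notin> p"
    using skew_notin by blast
  have "denominator p (skew N_to_M k l ^ 4)"
    using kl homogeneous_skew[of 1 N_to_M k l, OF homogeneous_N_to_M]
    by (intro denominator_power p_prime) (auto simp: denominator_def)
  then show ?thesis
    using base_minor_in[OF assms] by (rule localizedI)
qed

lemma square_products_in_L:
  assumes d: "d * d = 1" and e: "e * e = (1 :: (6, 'k) mpoly)"
  defines "A \<equiv> form_A N_to_M" and "B \<equiv> form_B N_to_M (Const \<alpha>)" and "C \<equiv> form_C N_to_M (Const \<alpha>)"
  shows "A d * A d * A (- d) * B e \<in> L" "A 1 * A (- 1) * B e * B e \<in> L"
    "A d * A d * B e * C (- (d * e)) \<in> L" "A d * B e * B e * C (- (d * e)) \<in> L"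
    "A d * B e * C (- (d * e)) * C (- (d * e)) \<in> L"
    "B d * B d * B (- d) * C e \<in> L" "B 1 * B (- 1) * C e * C e \<in> L"
    "C d * C d * C (- d) * A e \<in> L" "C 1 * C (- 1) * A e * A e \<in> L"
proof -
  have a: "(Const \<alpha> :: (6, 'k) mpoly) ^ 4 = 1"
    using \<alpha> by (simp flip: Const_power)
  have P: "pluecker_form N_to_M \<in> L"
    using pluecker_in_L by (simp add: pluecker_form_N_to_M)
  note closed = ideal_add[OF L_ideal] ideal_diff[OF L_ideal] ideal_uminus[OF L_ideal] ideal_mult[OF L_ideal]
  show "A d * A d * A (- d) * B e \<in> L" "A 1 * A (- 1) * B e * B e \<in> L"
    "A d * A d * B e * C (- (d * e)) \<in> L" "A d * B e * B e * C (- (d * e)) \<in> L"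
    "A d * B e * C (- (d * e)) * C (- (d * e)) \<in> L"
    "B d * B d * B (- d) * C e \<in> L" "B 1 * B (- 1) * C e * C e \<in> L"
    "C d * C d * C (- d) * A e \<in> L" "C 1 * C (- 1) * A e * A e \<in> L"
    unfolding A_def B_def C_def square_products[OF a d e]
    by (intro closed P base_minor_in_L, (simp; fail)+)+
qed

text \<open>The four choices of the signs d and e in the square products run through all triples and
  all repeated factors.\<close>

lemma triple_square_in_L:
  assumes T: "T \<in> set triples" and x: "x \<in> T"
  shows "Y \<alpha> x * (\<Prod>v\<in>T. Y \<alpha> v) \<in> L"
proof -
  have Y: "form_A N_to_M 1 = Y \<alpha> 0" "form_A N_to_M (- 1) = Y \<alpha> 1"
    "form_B N_to_M (Const \<alpha>) 1 = Y \<alpha> 2" "form_B N_to_M (Const \<alpha>) (- 1) = Y \<alpha> 3"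
    "form_C N_to_M (Const \<alpha>) 1 = Y \<alpha> 4" "form_C N_to_M (Const \<alpha>) (- 1) = Y \<alpha> 5"
    by (simp_all add: form_A_def form_B_def form_C_def Y_def N_to_M_def)
  have sq: "(1 :: (6, 'k) mpoly) * 1 = 1" "(- 1 :: (6, 'k) mpoly) * - 1 = 1"
    by simp_all
  note squares =
    square_products_in_L[OF sq(1) sq(1), simplified mult_1_left minus_minus Y mult_minus1]
    square_products_in_L[OF sq(1) sq(2), simplified mult_1_left minus_minus Y mult_minus1]
    square_products_in_L[OF sq(2) sq(1), simplified mult_1_left minus_minus Y mult_minus1]
    square_products_in_L[OF sq(2) sq(2), simplified mult_1_left minus_minus Y mult_minus1]
  from triples_cases[OF T] show ?thesis
    using x by (elim disjE) (use squares in \<open>auto simp: ac_simps\<close>)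
qed

lemma triple_in_L:
  assumes T: "T \<in> set triples" and x: "x \<in> T" "Y \<alpha> x \<notin> p"
  shows "(\<Prod>v\<in>T. Y \<alpha> v) \<in> L"
proof -
  have "x < 6" using triples_below_6[OF T] x(1) by auto
  then have "denominator p (Y \<alpha> x)"
    using homogeneous_Y x(2) unfolding denominator_def by blast
  then show ?thesis
    using triple_square_in_L[OF T x(1)] by (rule localized_cancel[OF p_prime])
qed

text \<open>Every edge \<open>{x, w}\<close> of the triangulation lies on the two triangles \<open>{x, w, v\<^sub>1}\<close> and
  \<open>{x, w, v\<^sub>4}\<close>.\<close>

lemma edge:
  assumes dist: "distinct [x, w, v1, v2, v3, v4]" and below: "set [x, w, v1, v2, v3, v4] \<subseteq> {..<6}"
    and triples: "{x, w, v2} \<in> set triples" "{x, w, v3} \<in> set triples" "{x, v1, v4} \<in> set triples"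
      "{v2, v3, v4} \<in> set triples" "{v1, v2, v3} \<in> set triples"
    and notin: "Y \<alpha> x \<notin> p" "Y \<alpha> w \<notin> p"
  shows "conic \<alpha> {v2, v3, v4} \<subseteq> p \<or> conic \<alpha> {v1, v2, v3} \<subseteq> p" and "a ^ n \<in> L \<Longrightarrow> a \<in> L"
proof -
  let ?P = "conic \<alpha> {v2, v3, v4}" and ?Q = "conic \<alpha> {v1, v2, v3}"
  have den: "denominator p (Y \<alpha> x)" "denominator p (Y \<alpha> w)"
    using notin below homogeneous_Y[of x \<alpha>] homogeneous_Y[of w \<alpha>] by (auto simp: denominator_def)
  \<comment> \<open>Both Y_x and Y_w are units at p, so a triple that contains x and w forces its
    third form into the local ideal.\<close>
  have v: "Y \<alpha> v \<in> L" if v: "v \<in> {v2, v3}" for v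
  proof -
    have "{x, w, v} \<in> set triples" "x \<noteq> w" "x \<noteq> v" "w \<noteq> v"
      using v triples dist by auto
    then have "Y \<alpha> x * (Y \<alpha> w * Y \<alpha> v) \<in> L"
      using triple_in_L[of "{x, w, v}" x] notin by simp
    then show ?thesis
      using localized_cancel[OF p_prime] den by blast
  qed
  have "Y \<alpha> x * (Y \<alpha> v1 * Y \<alpha> v4) \<in> L"
    using triple_in_L[OF triples(3), of x] dist notin by simp
  then have v14: "Y \<alpha> v1 * Y \<alpha> v4 \<in> L"
    by (rule localized_cancel[OF p_prime den(1)])
  have P_sub: "?P \<subseteq> J" if "is_ideal J" "L \<subseteq> J" "Y \<alpha> v4 \<in> J" for J
    unfolding conic_def using that v pluecker_in_L by (intro ideal_generated_least) auto
  have Q_sub: "?Q \<subseteq> J" if "is_ideal J" "L \<subseteq> J" "Y \<alpha> v1 \<in> J" for J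
    unfolding conic_def using that v pluecker_in_L by (intro ideal_generated_least) auto
  have cover: "Y \<alpha> v1 \<in> p \<or> Y \<alpha> v4 \<in> p"
    using v14 L_subset by (intro prime_mult[OF p_prime]) auto
  then show "?P \<subseteq> p \<or> ?Q \<subseteq> p"
    using P_sub[OF p_ideal L_subset] Q_sub[OF p_ideal L_subset] by blast
  \<comment> \<open>A multiplier t lies outside p, hence outside every conic ideal contained in p;
    since that ideal is prime, it absorbs first a^n and then a.\<close>
  have root: "a \<in> conic \<alpha> T" if T: "T \<in> set triples" "conic \<alpha> T \<subseteq> p" and a: "a ^ n \<in> L" for T
  proof -
    obtain t where t: "denominator p t" "t * a ^ n \<in> I"
      using a by (rule localizedE)
    have prime: "homogeneous_prime (conic \<alpha> T)"
      using conic_proj[OF T(1)] by (rule proj_space_prime)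
    have "t * a ^ n \<in> conic \<alpha> T" "t \<notin> conic \<alpha> T"
      using t subset_conic[OF T(1)] T(2) by (auto simp: denominator_def)
    then have "a ^ n \<in> conic \<alpha> T"
      using prime_mult[OF prime] by blast
    then show ?thesis
      by (rule prime_power[OF prime])
  qed
  show "a \<in> L" if a: "a ^ n \<in> L"
  \<comment> \<open>If one of Y_v1, Y_v4 is a unit at p, only one conic passes through the point and
    the local ideal contains the ideal of that conic. Otherwise two conics meet there, and the local
    ideal must be shown to contain the intersection of their ideals.\<close>
  proof (cases "Y \<alpha> v1 \<in> p \<and> Y \<alpha> v4 \<in> p")
    case False
    then consider "Y \<alpha> v1 \<notin> p" | "Y \<alpha> v4 \<notin> p" by blast
    then show ?thesis
    proof cases
      case 1
      then have "denominator p (Y \<alpha> v1)"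
        using below homogeneous_Y[of v1 \<alpha>] by (auto simp: denominator_def)
      then have "Y \<alpha> v4 \<in> L"
        using v14 by (rule localized_cancel[OF p_prime])
      then have "?P \<subseteq> L"
        by (intro P_sub L_ideal) auto
      then show ?thesis
        using root[OF triples(4) _ a] L_subset by blast
    next
      case 2
      then have "denominator p (Y \<alpha> v4)"
        using below homogeneous_Y[of v4 \<alpha>] by (auto simp: denominator_def)
      moreover have "Y \<alpha> v4 * Y \<alpha> v1 \<in> L"
        using v14 by (simp add: mult.commute)
      ultimately have "Y \<alpha> v1 \<in> L"
        by (rule localized_cancel[OF p_prime])
      then have "?Q \<subseteq> L"
        by (intro Q_sub L_ideal) auto
      then show ?thesis
        using root[OF triples(5) _ a] L_subset by blast
    qed
  next
    case True
    then have "?P \<subseteq> p" "?Q \<subseteq> p"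
      using P_sub[OF p_ideal L_subset] Q_sub[OF p_ideal L_subset] by blast+
    then have aP: "a \<in> ?P" and aQ: "a \<in> ?Q"
      using root[OF triples(4) _ a] root[OF triples(5) _ a] by blast+
    let ?G = "insert pluecker (Y \<alpha> ` {v2, v3})"
    have "?G \<subseteq> L"
      using v pluecker_in_L by auto
    then have G: "ideal_generated ?G \<subseteq> L"
      by (rule ideal_generated_least[OF L_ideal])
    have G': "ideal_generated ?G \<subseteq> ?Q"
      unfolding conic_def by (rule ideal_generated_mono) auto
    have P_eq: "?P = ideal_generated (insert (Y \<alpha> v4) ?G)" and Q_eq: "?Q = ideal_generated (insert (Y \<alpha> v1) ?G)"
      unfolding conic_def by (simp_all add: insert_commute)
    obtain k where k: "a - k * Y \<alpha> v4 \<in> ideal_generated ?G"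
      using aP unfolding P_eq ideal_generated_insert by blast
    have Q: "homogeneous_prime ?Q"
      by (rule proj_space_prime[OF conic_proj[OF triples(5)]])
    have "k * Y \<alpha> v4 \<in> ?Q"
      using ideal_congI[OF prime_ideal[OF Q], of a "k * Y \<alpha> v4"] G' k aQ by blast
    moreover have "Y \<alpha> v4 \<notin> ?Q"
      using Y_in_conic_iff[OF triples(5), of v4] dist below by auto
    ultimately have "k \<in> ?Q"
      using prime_mult[OF Q] by blast
    then obtain h where h: "k - h * Y \<alpha> v1 \<in> ideal_generated ?G"
      unfolding Q_eq ideal_generated_insert by blast
    \<comment> \<open>An element of both conic ideals is k * Y_v4 modulo the common generators. As
      Y_v4 is not in the second prime, k lies there and is h * Y_v1 modulo the same generators, so a
      reduces to a multiple of Y_v1 * Y_v4.\<close>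
    have "a = (a - k * Y \<alpha> v4) + Y \<alpha> v4 * (k - h * Y \<alpha> v1) + h * (Y \<alpha> v1 * Y \<alpha> v4)"
      by (simp add: algebra_simps)
    also have "\<dots> \<in> L"
      using ideal_mult[OF L_ideal subsetD[OF G h], of "Y \<alpha> v4"] ideal_mult[OF L_ideal v14, of h] subsetD[OF G k]
      by (intro ideal_add[OF L_ideal])
    finally show ?thesis .
  qed
qed

text \<open>If five of the forms vanish at p, the diagonal shape of the Pluecker polynomial makes
  the square of the sixth vanish too; then all coordinates would vanish.\<close>

lemma two_Y_notin: "\<exists>x w. x < w \<and> w < 6 \<and> Y \<alpha> x \<notin> p \<and> Y \<alpha> w \<notin> p"
proof (rule ccontr)
  assume none: "\<not> ?thesis"
  have "\<exists>x<6. \<forall>w<6. w \<noteq> x \<longrightarrow> Y \<alpha> w \<in> p"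
  proof (cases "\<exists>x<6. Y \<alpha> x \<notin> p")
    case True
    then obtain x where x: "x < 6" "Y \<alpha> x \<notin> p" by blast
    have "Y \<alpha> w \<in> p" if "w < 6" "w \<noteq> x" for w
      using none x that by (meson nat_neq_iff)
    then show ?thesis using x by blast
  next
    case False
    then show ?thesis by (intro exI[of _ 0]) auto
  qed
  then obtain x where x: "x < 6" "\<And>w. w < 6 \<Longrightarrow> w \<noteq> x \<Longrightarrow> Y \<alpha> w \<in> p" by blast
  have rest: "(\<Sum>v\<in>{..<6} - {x}. Const (diagonal \<alpha> v) * (Y \<alpha> v * Y \<alpha> v)) \<in> p"
    using x(2) by (intro ideal_sum[OF p_ideal] ideal_mult[OF p_ideal]) auto
  have "pluecker \<in> p"
    using I_sub_p pluecker_in_line_scheme by blast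
  then have "Const (4 * \<alpha>) * pluecker \<in> p"
    by (rule ideal_mult[OF p_ideal])
  then have "Const (diagonal \<alpha> x) * (Y \<alpha> x * Y \<alpha> x) + (\<Sum>v\<in>{..<6} - {x}. Const (diagonal \<alpha> v) * (Y \<alpha> v * Y \<alpha> v)) \<in> p"
    using x(1) unfolding pluecker_diagonal by (subst (asm) sum.remove[of _ x]) auto
  then have "Const (diagonal \<alpha> x) * (Y \<alpha> x * Y \<alpha> x) \<in> p"
    using ideal_diff[OF p_ideal _ rest] by fastforce
  moreover have "diagonal \<alpha> x \<noteq> 0"
    using below_6[OF x(1)] \<alpha>_neq_0 by (elim disjE) (simp_all add: diagonal_def)
  ultimately have "Y \<alpha> x \<in> p"
    using prime_mult[OF p_prime] prime_Const[OF p_prime, of "diagonal \<alpha> x"] by blast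
  then have all: "Y \<alpha> w \<in> p" if "w < 6" for w
    using x(2) that by blast
  have "Var k \<in> p" for k
  proof -
    obtain c where "Var k = (\<Sum>v<6. Const (c v) * Y \<alpha> v)"
      using Var_span_Y[OF \<alpha>_neq_0] by blast
    then show ?thesis
      using all by (auto intro!: ideal_sum[OF p_ideal] ideal_mult[OF p_ideal])
  qed
  then show False
    using p by (simp add: zero_locus_iff proj_space_def)
qed

text \<open>A finite check over the fifteen pairs of vertices: v2 and v3 complete {x, w} to triples,
  and v1, v4 are the two remaining vertices, named so that \<open>edge\<close> applies.\<close>

lemma edge_exists:
  assumes "x < w" "w < 6"
  shows "\<exists>v1 v2 v3 v4. distinct [x, w, v1, v2, v3, v4] \<and> set [x, w, v1, v2, v3, v4] \<subseteq> {..<6} \<and>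
    {x, w, v2} \<in> set triples \<and> {x, w, v3} \<in> set triples \<and> {x, v1, v4} \<in> set triples \<and>
    {v2, v3, v4} \<in> set triples \<and> {v1, v2, v3} \<in> set triples"
proof -
  define E :: "(nat \<times> nat \<times> nat \<times> nat \<times> nat \<times> nat) list" where
    "E = [(0, 1, 4, 2, 3, 5), (0, 2, 3, 1, 5, 4), (0, 3, 2, 1, 4, 5), (0, 4, 1, 3, 5, 2), (0, 5, 1, 2, 4, 3),
      (1, 2, 3, 0, 4, 5), (1, 3, 2, 0, 5, 4), (1, 4, 0, 2, 5, 3), (1, 5, 0, 3, 4, 2),
      (2, 3, 0, 4, 5, 1), (2, 4, 0, 1, 3, 5), (2, 5, 1, 0, 3, 4), (3, 4, 1, 0, 2, 5), (3, 5, 0, 1, 2, 4), (4, 5, 2, 0, 1, 3)]"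
  have "list_all (\<lambda>(x, w, v1, v2, v3, v4). distinct [x, w, v1, v2, v3, v4] \<and> set [x, w, v1, v2, v3, v4] \<subseteq> {..<6} \<and>
    {x, w, v2} \<in> set triples \<and> {x, w, v3} \<in> set triples \<and> {x, v1, v4} \<in> set triples \<and>
    {v2, v3, v4} \<in> set triples \<and> {v1, v2, v3} \<in> set triples) E"
    unfolding E_def by code_simp
  moreover have "\<exists>v1 v2 v3 v4. (x, w, v1, v2, v3, v4) \<in> set E"
  proof -
    have "list_all (\<lambda>(x, w). (x, w) \<in> set (map (\<lambda>(x, w, v). (x, w)) E)) [(x, w). w \<leftarrow> [0..<6], x \<leftarrow> [0..<w]]"
      unfolding E_def by code_simp
    moreover have "(x, w) \<in> set [(x, w). w \<leftarrow> [0..<6], x \<leftarrow> [0..<w]]"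
      using assms by (force simp: image_iff)
    ultimately have "(x, w) \<in> (\<lambda>(x, w, v). (x, w)) ` set E"
      unfolding list_all_iff set_map by blast
    then show ?thesis
      by (auto simp: image_iff)
  qed
  ultimately show ?thesis
    unfolding list_all_iff by blast
qed

lemma point_on_conic: "\<exists>T\<in>set triples. conic \<alpha> T \<subseteq> p"
  and localized_radical: "a ^ n \<in> L \<Longrightarrow> a \<in> L"
proof -
  obtain x w where xw: "x < w" "w < 6" and notin: "Y \<alpha> x \<notin> p" "Y \<alpha> w \<notin> p"
    using two_Y_notin by blast
  obtain v1 v2 v3 v4 where dist: "distinct [x, w, v1, v2, v3, v4]" and below: "set [x, w, v1, v2, v3, v4] \<subseteq> {..<6}"
    and triples: "{x, w, v2} \<in> set triples" "{x, w, v3} \<in> set triples" "{x, v1, v4} \<in> set triples"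
      "{v2, v3, v4} \<in> set triples" "{v1, v2, v3} \<in> set triples"
    using edge_exists[OF xw] by blast
  note edge = edge[OF dist below triples notin]
  show "\<exists>T\<in>set triples. conic \<alpha> T \<subseteq> p"
    using edge(1) triples by blast
  show "a ^ n \<in> L \<Longrightarrow> a \<in> L"
    by (rule edge(2))
qed

end

lemma reduced: "reduced_scheme I"
  using reduced_schemeI[OF is_ideal_line_scheme] localized_radical by blast

lemma conic_inject: "T \<in> set triples \<Longrightarrow> T' \<in> set triples \<Longrightarrow> conic \<alpha> T \<subseteq> conic \<alpha> T' \<Longrightarrow> T = T'"
proof -
  assume T: "T \<in> set triples" "T' \<in> set triples" and sub: "conic \<alpha> T \<subseteq> conic \<alpha> T'"
  have "T \<subseteq> T'"
  proof
    fix v assume v: "v \<in> T"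
    then have "v < 6" using triples_below_6[OF T(1)] by auto
    then show "v \<in> T'"
      using v sub Y_in_conic_iff[OF T(1)] Y_in_conic_iff[OF T(2)] by blast
  qed
  moreover have "card S = 3" "finite S" if "S \<in> set triples" for S
    using triples_cases[OF that] by (elim disjE; simp)+
  ultimately show "T = T'"
    using T by (metis card_subset_eq)
qed

lemma components: "irreducible_components (subscheme_space I) = zero_locus ` (conic \<alpha> ` set triples)"
proof (rule irreducible_components_finite)
  show "q \<in> zero_locus I" if "q \<in> conic \<alpha> ` set triples" for q
    using that conic_proj subset_conic by (auto simp: zero_locus_iff)
  show "\<exists>P\<in>conic \<alpha> ` set triples. P \<subseteq> q" if "q \<in> zero_locus I" for q
    using point_on_conic[OF that] by blast
  show "P = Q" if "P \<in> conic \<alpha> ` set triples" "Q \<in> conic \<alpha> ` set triples" "P \<subseteq> Q" for P Q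
    using that conic_inject by blast
qed simp

lemma conic_isomorphic: "T \<in> set triples \<Longrightarrow> isomorphic_schemes (conic \<alpha> T) ({0} :: (2, 'k) mpoly set)"
  by (rule triple_veronese[OF \<alpha>_neq_0]) (auto simp: veronese.isomorphic_projective_line)

lemma conic_dimension: "T \<in> set triples \<Longrightarrow> krull_dimension (subscheme_space (conic \<alpha> T)) = 1"
  by (rule triple_veronese[OF \<alpha>_neq_0])
    (auto simp: veronese.krull_dimension_conic[OF _ nonzero_prime_maximal])

lemma equidimensional: "equidimensional (subscheme_space I) 1"
  unfolding equidimensional_def components
  using subtopology_subscheme[OF subset_conic] conic_dimension by auto

lemma pair_in_prime:
  assumes "homogeneous_prime q"
  shows "x \<in> q \<and> y \<in> q \<longleftrightarrow> x + y \<in> q \<and> x - (y :: (6, 'k) mpoly) \<in> q"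
proof
  assume "x + y \<in> q \<and> x - y \<in> q"
  then have *: "Const (1 / 2) * (x + y) \<in> q" "Const (1 / 2) * (x - y) \<in> q"
    using ideal_mult[OF prime_ideal[OF assms]] by auto
  show "x \<in> q \<and> y \<in> q"
    using ideal_add[OF prime_ideal[OF assms] *] ideal_diff[OF prime_ideal[OF assms] *]
    by (simp only: half_sum half_diff)
qed (use ideal_add[OF prime_ideal[OF assms]] ideal_diff[OF prime_ideal[OF assms]] in auto)

text \<open>Since 2 and \<alpha> are invertible, a prime contains two paired variables exactly if it
  contains the sum form and the difference form. The list \<open>triples\<close> is in the same
  order as the ten curves.\<close>

lemma line_curves_eq: "line_curves \<alpha> = map (\<lambda>T. zero_locus (conic \<alpha> T)) triples"
proof -
  have mult: "Const \<alpha> * y \<in> q \<longleftrightarrow> y \<in> q" if "homogeneous_prime q" for y :: "(6, 'k) mpoly" and q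
    using prime_mult_iff[OF that] prime_Const[OF that, of \<alpha>] \<alpha>_neq_0 by auto
  have eq: "zero_locus G = zero_locus (conic \<alpha> T)"
    if "\<And>q. homogeneous_prime q \<Longrightarrow> G \<subseteq> q \<longleftrightarrow> insert pluecker (Y \<alpha> ` T) \<subseteq> q" for G T
  proof (rule Set.set_eqI)
    fix q
    show "q \<in> zero_locus G \<longleftrightarrow> q \<in> zero_locus (conic \<alpha> T)"
      unfolding conic_def zero_locus_ideal_generated zero_locus_iff
      using that[OF proj_space_prime, of q] by iprover
  qed
  have A: "{M12, M34} \<subseteq> q \<longleftrightarrow> {Y \<alpha> 0, Y \<alpha> 1} \<subseteq> q" and B: "{M13, M24} \<subseteq> q \<longleftrightarrow> {Y \<alpha> 2, Y \<alpha> 3} \<subseteq> q"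
    and C: "{M14, M23} \<subseteq> q \<longleftrightarrow> {Y \<alpha> 4, Y \<alpha> 5} \<subseteq> q" if "homogeneous_prime q" for q
    using pair_in_prime[OF that, of M12 M34] pair_in_prime[OF that, of M13 "Const \<alpha> * M24"]
      pair_in_prime[OF that, of M14 "Const \<alpha> * M23"] mult[OF that] by (simp_all add: Y_def)
  show ?thesis
    unfolding line_curves_def triples_def list.map list.inject
  proof (intro conjI refl; rule eq)
  qed (use A B C in \<open>auto simp: Y_def\<close>)
qed

lemma distinct_curves: "distinct (line_curves \<alpha>)"
proof -
  have "inj_on (\<lambda>T. zero_locus (conic \<alpha> T)) (set triples)"
  proof (rule inj_onI)
    fix T T' assume T: "T \<in> set triples" "T' \<in> set triples" and "zero_locus (conic \<alpha> T) = zero_locus (conic \<alpha> T')"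
    then have "conic \<alpha> T = conic \<alpha> T'"
      by (simp add: zero_locus_inject conic_proj)
    then show "T = T'"
      using conic_inject[OF T] by blast
  qed
  moreover have "distinct triples"
    unfolding triples_def by code_simp
  ultimately show ?thesis
    unfolding line_curves_eq distinct_map by blast
qed

lemma line_scheme_components:
  "irreducible_components (subscheme_space I) = set (line_curves \<alpha>)"
  "C \<in> set (line_curves \<alpha>) \<Longrightarrow> isomorphic_schemes (vanishing_ideal C) ({0} :: (2, 'k) mpoly set)"
  using components conic_isomorphic vanishing_ideal_zero_locus[OF conic_proj]
  by (auto simp: line_curves_eq image_image)

end

lemma pairing_qmonom [simp]: "pairing g (qmonom a b) = g $ (a, b)"
proof -
  have "pairing g (qmonom a b) = (\<Sum>ab\<in>UNIV. if ab = (a, b) then g $ ab else 0)"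
    unfolding pairing_def qmonom_def by (intro sum.cong) (auto simp: axis_def)
  then show ?thesis by simp
qed

lemma pairing_add [simp]: "pairing g (r + s) = pairing g r + pairing g s"
  and pairing_diff [simp]: "pairing g (r - s) = pairing g r - pairing g s"
  by (simp_all add: pairing_def algebra_simps sum.distrib sum_subtractf)

lemma dual_space_relations:
  "{g. \<forall>r\<in>relations_S. pairing g r = 0} = dual_space 1"
  "{g. \<forall>r\<in>relations_T. pairing g r = 0} = dual_space (- 1)"
  by (auto simp: relations_S_def relations_T_def dual_space_def eq_neg_iff_add_eq_0)

theorem theorem4p3p2:
  fixes \<iota> \<alpha> :: "'k::{alg_closed_field, field_char_0}"
    and R :: "'k qform set"
    and f :: "10 \<Rightarrow> 'k qform"
  assumes "\<iota> ^ 4 = 1" and "\<forall>n. 0 < n \<and> n < 4 \<longrightarrow> \<iota> ^ n \<noteq> 1"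
    and "R = relations_S \<and> \<alpha> = 1 \<or> R = relations_T \<and> \<alpha> = \<iota>"
    and "quadratic_dual_basis R f"
  shows "irreducible_components (subscheme_space (line_scheme_ideal f)) = set (line_curves \<alpha>) \<and>
    distinct (line_curves \<alpha>) \<and>
    (\<forall>C \<in> set (line_curves \<alpha>).
       isomorphic_schemes (vanishing_ideal C) ({0} :: (2, 'k) mpoly set)) \<and>
    equidimensional (subscheme_space (line_scheme_ideal f)) 1 \<and>
    reduced_scheme (line_scheme_ideal f)"
proof -
  \<comment> \<open>A primitive fourth root of unity squares to -1, so \<alpha>^2 is 1 for S and -1
    for T, the parameter of the dual space.\<close>
  have "(\<iota>\<^sup>2 - 1) * (\<iota>\<^sup>2 + 1) = 0"
    using assms(1) by (simp add: algebra_simps flip: power_add)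
  moreover have "\<iota>\<^sup>2 \<noteq> 1"
    using assms(2) by simp
  ultimately have \<iota>: "\<iota>\<^sup>2 = - 1"
    by (simp add: eq_neg_iff_add_eq_0)
  have "vec.span (range f) = {g. \<forall>r\<in>R. pairing g r = 0}"
    using assms(4) by (simp add: quadratic_dual_basis_def)
  also have "\<dots> = dual_space (\<alpha>\<^sup>2)"
    using assms(3) dual_space_relations \<iota> by auto
  finally have span: "vec.span (range f) = dual_space (\<alpha>\<^sup>2)" .
  have "\<alpha> ^ 4 = 1"
    using assms(1,3) by auto
  then interpret line_scheme \<alpha> f
    using span by unfold_locales
  show ?thesis
    using line_scheme_components distinct_curves equidimensional reduced by blast
qed

end
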